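(* Let $0<\alpha<1$ and $p,q>0$. Then the following conditions are equivalent: (i) $G_{\alpha,p}(A,B)\le\mathcal{A}_{\alpha,q}(A,B)$ for all positive semidefinite $A,B\in\mathbb{M}_n$ and all $n\in\mathbb{N}$; (ii) $G_{\alpha,p}(A,B)\le\mathcal{A}_{\alpha,q}(A,B)$ for all positive definite $2\times2$ matrices $A,B$; (iii) $1\le p\le q$.
   Context: $\mathbb{M}_n$ is the set of $n\times n$ complex matrices, and $\le$ is the Loewner order. For positive definite $A,B$, $A\#_\alpha B:=A^{1/2}(A^{-1/2}BA^{-1/2})^\alpha A^{1/2}$; for positive semidefinite $A,B$, $A\#_\alpha B:=\lim_{\varepsilon\searrow0}(A+\varepsilon I)\#_\alpha(B+\varepsilon I)$. Then $G_{\alpha,p}(A,B):=(A^p\#_\alpha B^p)^{1/p}$ and $\mathcal{A}_{\alpha,q}(A,B):=((1-\alpha)A^q+\alpha B^q)^{1/q}$. *)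

theory Defs
  imports Complex_Main "Jordan_Normal_Form.Schur_Decomposition"
begin

definition hermitian_mat :: "complex mat \<Rightarrow> bool" where
  "hermitian_mat A \<longleftrightarrow> A \<in> carrier_mat (dim_row A) (dim_row A) \<and> mat_adjoint A = A"

definition psd_mat :: "complex mat \<Rightarrow> bool" where
  "psd_mat A \<longleftrightarrow> hermitian_mat A \<and>
     (\<forall>v \<in> carrier_vec (dim_row A). 0 \<le> Re ((conjugate v) \<bullet> (A *\<^sub>v v)))"

definition pd_mat :: "complex mat \<Rightarrow> bool" where
  "pd_mat A \<longleftrightarrow> hermitian_mat A \<and>
     (\<forall>v \<in> carrier_vec (dim_row A). v \<noteq> 0\<^sub>v (dim_row A) \<longrightarrow> 0 < Re ((conjugate v) \<bullet> (A *\<^sub>v v)))"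

definition loewner_le :: "complex mat \<Rightarrow> complex mat \<Rightarrow> bool" where
  "loewner_le A B \<longleftrightarrow> dim_row A = dim_row B \<and> dim_col A = dim_col B \<and> psd_mat (B - A)"

definition unitary_mat :: "nat \<Rightarrow> complex mat \<Rightarrow> bool" where
  "unitary_mat n U \<longleftrightarrow> U \<in> carrier_mat n n \<and> U * mat_adjoint U = 1\<^sub>m n"

text \<open>Functional calculus for Hermitian matrices: if A = U diag(d) U^* with U unitary
  and d real, then f(A) = U diag(f d) U^*. (This is independent of the choice of U, d.)\<close>
definition mat_fun :: "(real \<Rightarrow> real) \<Rightarrow> complex mat \<Rightarrow> complex mat" where
  "mat_fun f A = (THE B. \<exists>U d. unitary_mat (dim_row A) U \<and>
      A = U * mat_diag (dim_row A) (\<lambda>i. complex_of_real (d i)) * mat_adjoint U \<and>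
      B = U * mat_diag (dim_row A) (\<lambda>i. complex_of_real (f (d i))) * mat_adjoint U)"

text \<open>Real powers of positive semidefinite matrices (0 powr t = 0, so for t > 0 this
  is the usual power; negative powers are only used for positive definite matrices).\<close>
definition mat_powr :: "complex mat \<Rightarrow> real \<Rightarrow> complex mat" where
  "mat_powr A t = mat_fun (\<lambda>x. x powr t) A"

definition wgm_pd :: "real \<Rightarrow> complex mat \<Rightarrow> complex mat \<Rightarrow> complex mat" where
  "wgm_pd \<alpha> A B = mat_powr A (1/2) * mat_powr (mat_powr A (-1/2) * B * mat_powr A (-1/2)) \<alpha>
                    * mat_powr A (1/2)"

definition wgm :: "real \<Rightarrow> complex mat \<Rightarrow> complex mat \<Rightarrow> complex mat" where
  "wgm \<alpha> A B = (THE M. M \<in> carrier_mat (dim_row A) (dim_row A) \<and>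
     (\<forall>i < dim_row A. \<forall>j < dim_row A.
        ((\<lambda>\<epsilon>::real. wgm_pd \<alpha> (A + complex_of_real \<epsilon> \<cdot>\<^sub>m 1\<^sub>m (dim_row A))
                                (B + complex_of_real \<epsilon> \<cdot>\<^sub>m 1\<^sub>m (dim_row A)) $$ (i, j))
          \<longlongrightarrow> M $$ (i, j)) (at_right 0)))"

definition G_mean :: "real \<Rightarrow> real \<Rightarrow> complex mat \<Rightarrow> complex mat \<Rightarrow> complex mat" where
  "G_mean \<alpha> p A B = mat_powr (wgm \<alpha> (mat_powr A p) (mat_powr B p)) (1/p)"

definition A_mean :: "real \<Rightarrow> real \<Rightarrow> complex mat \<Rightarrow> complex mat \<Rightarrow> complex mat" where
  "A_mean \<alpha> q A B = mat_powr (complex_of_real (1 - \<alpha>) \<cdot>\<^sub>m mat_powr A q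
                               + complex_of_real \<alpha> \<cdot>\<^sub>m mat_powr B q) (1/q)"

end

theory Submission
  imports Defs "HOL-Analysis.Equivalence_Lebesgue_Henstock_Integration" "Jordan_Normal_Form.Spectral_Radius"
begin

text \<open>
  For positive definite \<open>A\<close>, the quadratic form of \<open>A #\<^sub>\<alpha> B\<close> at \<open>v\<close> is a constant times the integral over
  \<open>t > 0\<close> of \<open>t powr (\<alpha> - 2) * min\<^sub>x (\<langle>x, B x\<rangle> + t \<langle>v - x, A (v - x)\<rangle>)\<close>. The minimum is monotone and
  concave in \<open>(A, B)\<close>, hence so is \<open>A #\<^sub>\<alpha> B\<close>; taking \<open>A = 1\<close>, so are the powers \<open>B\<^sup>r\<close> with \<open>0 < r \<le> 1\<close>.
  If \<open>1 \<le> p \<le> q\<close> this gives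
  \<open>A\<^sup>p #\<^sub>\<alpha> B\<^sup>p \<le> (1 - \<alpha>) A\<^sup>p + \<alpha> B\<^sup>p \<le> ((1 - \<alpha>) A\<^sup>q + \<alpha> B\<^sup>q)\<^bsup>p/q\<^esup>\<close>,
  and the power \<open>1/p\<close> preserves the order.

  Conversely let \<open>A = diag(a, 1)\<close> and let \<open>B\<close> be a rotation of \<open>diag(b, 1)\<close> by an angle with sine \<open>s\<close>; let \<open>a \<rightarrow> 0\<close>.
  If \<open>q < p\<close>, take \<open>b = a\<close> and \<open>s\<^sup>2 = a\<^sup>q\<close>: the least eigenvalue of the arithmetic mean is \<open>O(a)\<close>, while that of
  the geometric mean is not. If \<open>p < 1\<close>, take \<open>b\<^sup>p = 2 a\<^sup>p\<close> and \<open>s = a\<^bsup>1+q\<^esup>\<close>: the difference of the two means has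
  diagonal entries \<open>O(a)\<close> and \<open>O(s\<^sup>2 a\<^bsup>-p\<^esup>)\<close>, with product \<open>o(s\<^sup>2)\<close>, but its off-diagonal entry is
  \<open>(2\<^sup>\<alpha> - 1 - \<alpha>) s + o(s)\<close>, so that its determinant is eventually negative.
\<close>

unbundle no vec_syntax
unbundle no inner_syntax
hide_type (open) Finite_Cartesian_Product.vec
hide_const (open) Finite_Cartesian_Product.vec Finite_Cartesian_Product.mat Finite_Cartesian_Product.row
  Finite_Cartesian_Product.rows Finite_Cartesian_Product.transpose

text \<open>Matrices are compared through their quadratic forms at one fixed vector, so that only
  real functions are integrated. Every order relation for geometric means comes from using the
  minimiser of one pair as a competitor for another. For the converse, a power of a 2x2 matrix is
  affine in that matrix, by interpolation at the two eigenvalues, so the geometric mean of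
  \<open>A^p\<close> and \<open>B^p\<close> is \<open>e0 * A^p + e1 * B^p\<close>. If
  \<open>q < p\<close>, the choice \<open>s^2 = a^q\<close> keeps the rotation comparable with the
  small eigenvalue of \<open>A^q\<close>, but it gives \<open>A^(-p) B^p\<close> an eigenvalue of
  order \<open>a^(q-p)\<close>, which is unbounded. The determinant of the geometric mean of
  \<open>A^p\<close> and \<open>B^p\<close> stays \<open>a^p\<close> while its trace tends to 0, so
  both eigenvalues far exceed \<open>a^p\<close>. If \<open>p < 1\<close>, taking
  \<open>b = a\<close> would give both means the off-diagonal entry \<open>-\<alpha> * s\<close> to
  first order. The factor 2 replaces the tangent slope \<alpha> of the power function at 1 by its
  secant slope \<open>2^\<alpha> - 1\<close> on [1, 2], which is strictly smaller. The angle is so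
  small that the diagonal of the arithmetic mean does not feel it, and the factor
  \<open>a^(1-p)\<close> then decides.\<close>

section \<open>Powers as mixtures of resolvents\<close>

text \<open>The substitution \<open>t = d * u\<close> pulls \<open>d powr r\<close> out of the
  integral, so \<open>C\<close> is the value at \<open>d = 1\<close>, that is pi / sin (pi r). Its
  positivity allows it to be cancelled from inequalities.\<close>

lemma has_bochner_integral_resolvent:
  fixes r :: real
  assumes r: "0 < r" "r < 1"
  shows "\<exists>C>0. \<forall>d\<ge>0. has_bochner_integral lborel
           (\<lambda>t. indicator {0<..} t * (t powr (r - 1) * (d / (d + t)))) (C * d powr r)"
proof -
  let ?f = "\<lambda>t::real. indicator {0<..} t * (t powr (r - 1) * (1 / (1 + t)))"
  \<comment> \<open>Majorant: the singularity \<open>t powr (r - 1)\<close> at 0 is integrable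
    because \<open>r > 0\<close>, the tail \<open>t powr (r - 2)\<close> because
    \<open>r < 1\<close>.\<close>
  let ?g = "\<lambda>t::real. indicator {0..1} t * t powr (r - 1) + indicator {1..} t * t powr (r - 2)"
  have 1: "(\<lambda>t. t powr (r - 1)) absolutely_integrable_on {0..1::real}"
    by (rule nonnegative_absolutely_integrable_1[OF integrable_on_powr_from_0]) (use r in auto)
  have 2: "(\<lambda>t. t powr (r - 2)) absolutely_integrable_on {1::real..}"
    by (rule nonnegative_absolutely_integrable_1[OF has_integral_integrable[OF has_integral_powr_to_inf]]) (use r in auto)
  have "integrable lebesgue ?g"
    using Bochner_Integration.integrable_add[OF 1[unfolded set_integrable_def] 2[unfolded set_integrable_def]] by simp
  then have g: "integrable lborel ?g"
    by (subst (asm) integrable_completion) auto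
  have f: "integrable lborel ?f"
  proof (rule Bochner_Integration.integrable_bound[OF g])
    show "AE t in lborel. norm (?f t) \<le> norm (?g t)"
    proof (rule AE_I2)
      fix t :: real
      consider "t \<le> 0" | "0 < t" "t < 1" | "1 \<le> t" by linarith
      then show "norm (?f t) \<le> norm (?g t)"
      proof cases
        case 3
        have "t powr (r - 1) = t * t powr (r - 2)"
          using 3 powr_mult_base[of t "r-2"] by simp
        then have "t powr (r - 1) / (1 + t) \<le> t powr (r - 2)"
          using 3 by (simp add: field_simps)
        with 3 show ?thesis by (auto simp: indicator_def)
      qed (auto simp: indicator_def field_simps)
    qed
  qed measurable
  have nn: "0 \<le> ?f t" for t by (cases "t > 0") auto
  define C where "C = integral\<^sup>L lborel ?f"
  have bf: "has_bochner_integral lborel ?f C"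
    using f by (simp add: C_def has_bochner_integral_iff)
  have "C \<noteq> 0"
  proof
    assume "C = 0"
    then have "AE t in lborel. ?f t = 0"
      using integral_nonneg_eq_0_iff_AE[OF f] nn unfolding C_def by blast
    then have "AE t in lborel. t \<notin> {0<..<1::real}"
      by (rule AE_mp) (auto intro!: AE_I2 simp: indicator_def)
    then have "{0<..<1::real} \<in> null_sets lborel"
      by (subst AE_iff_null_sets) auto
    then have "emeasure lborel {0<..<1::real} = 0" by (rule null_setsD1)
    moreover have "emeasure lborel {0<..<1::real} = ennreal (1 - 0)" by (rule emeasure_lborel_Ioo) simp
    ultimately show False by (metis diff_zero ennreal_1 zero_neq_one)
  qed
  moreover have "C \<ge> 0" unfolding C_def by (intro integral_nonneg_AE AE_I2 nn)
  ultimately have "C > 0" by simp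
  moreover have "has_bochner_integral lborel
           (\<lambda>t. indicator {0<..} t * (t powr (r - 1) * (d / (d + t)))) (C * d powr r)" if "d \<ge> 0" for d
  proof (cases "d = 0")
    case True
    then show ?thesis using r by (simp add: has_bochner_integral_zero)
  next
    case False
    with that have d: "d > 0" by simp
    let ?h = "\<lambda>t. indicator {0<..} t * (t powr (r - 1) * (d / (d + t)))"
    have eq: "?h (0 + d * t) = d powr (r - 1) * ?f t" for t
    proof (cases "t > 0")
      case True
      have "d / (d * 1 + d * t) = 1 / (1 + t)"
        unfolding distrib_left[symmetric] using d by simp
      with True d show ?thesis by (simp add: powr_mult)
    qed (use d in \<open>auto simp: indicator_def zero_less_mult_iff\<close>)
    have "has_bochner_integral lborel (\<lambda>t. ?h (0 + d * t)) (d powr (r - 1) * C)"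
      unfolding eq by (intro has_bochner_integral_mult_right bf)
    also have "d powr (r - 1) * C = (C * d powr r) /\<^sub>R \<bar>d\<bar>"
      using d by (simp add: powr_diff field_simps)
    finally show ?thesis
      using lborel_has_bochner_integral_real_affine_iff[of d ?h "C * d powr r" 0] d by simp
  qed
  ultimately show ?thesis by blast
qed

text \<open>Integration against \<open>t powr (r - 1)\<close> turns each resolvent term into a
  power, with the same positive constant for all \<open>i\<close>. The weights may have either sign,
  so whole inequalities pass from resolvents to powers.\<close>

lemma sum_powr_nonneg:
  fixes w d :: "'a \<Rightarrow> real"
  assumes r: "0 < r" "r < 1" and "finite I" and d: "\<And>i. i \<in> I \<Longrightarrow> d i \<ge> 0"
    and nn: "\<And>t. t > 0 \<Longrightarrow> (\<Sum>i\<in>I. w i * (d i / (d i + t))) \<ge> 0"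
  shows "(\<Sum>i\<in>I. w i * d i powr r) \<ge> 0"
proof -
  obtain C where C: "C > 0" "\<And>d. d \<ge> 0 \<Longrightarrow> has_bochner_integral lborel
           (\<lambda>t. indicator {0<..} t * (t powr (r - 1) * (d / (d + t)))) (C * d powr r)"
    using has_bochner_integral_resolvent[OF r] by blast
  have "has_bochner_integral lborel (\<lambda>t. \<Sum>i\<in>I. w i * (indicator {0<..} t * (t powr (r - 1) * (d i / (d i + t)))))
      (\<Sum>i\<in>I. w i * (C * d i powr r))"
    by (intro has_bochner_integral_sum has_bochner_integral_mult_right C(2) d)
  moreover have "(\<Sum>i\<in>I. w i * (indicator {0<..} t * (t powr (r - 1) * (d i / (d i + t))))) \<ge> 0" for t
  proof (cases "t > 0")
    case True
    then have "(\<Sum>i\<in>I. w i * (indicator {0<..} t * (t powr (r - 1) * (d i / (d i + t)))))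
      = t powr (r - 1) * (\<Sum>i\<in>I. w i * (d i / (d i + t)))"
      by (simp add: sum_distrib_left mult_ac)
    then show ?thesis using nn[OF True] by simp
  qed simp
  ultimately have "0 \<le> (\<Sum>i\<in>I. w i * (C * d i powr r))"
    by (metis (no_types, lifting) has_bochner_integral_integral_eq integral_nonneg_AE AE_I2)
  also have "\<dots> = C * (\<Sum>i\<in>I. w i * d i powr r)" by (simp add: sum_distrib_left mult_ac)
  finally show ?thesis using C(1) by (simp add: zero_le_mult_iff)
qed

section \<open>Quadratic forms and the spectral theorem\<close>

abbreviation adj :: "complex mat \<Rightarrow> complex mat" where "adj \<equiv> mat_adjoint"

abbreviation rdiag :: "nat \<Rightarrow> (nat \<Rightarrow> real) \<Rightarrow> complex mat" where
  "rdiag n d \<equiv> mat_diag n (\<lambda>i. complex_of_real (d i))"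

lemma dim_adj [simp]: "dim_row (adj A) = dim_col A" "dim_col (adj A) = dim_row A"
  by (auto simp: mat_adjoint_def)

lemma adj_carrier [simp]: "A \<in> carrier_mat n m \<Longrightarrow> adj A \<in> carrier_mat m n"
  by (metis carrier_matD carrier_matI dim_adj)

lemma adj_index [simp]:
  "i < dim_col A \<Longrightarrow> j < dim_row A \<Longrightarrow> adj A $$ (i, j) = cnj (A $$ (j, i))"
  by (simp add: mat_adjoint_def mat_of_rows_index)

lemma adj_adj [simp]: "adj (adj A) = A"
  by (rule eq_matI) auto

lemma adj_mult:
  assumes "A \<in> carrier_mat n m" "B \<in> carrier_mat m k"
  shows "adj (A * B) = adj B * adj A"
  using assms by (intro eq_matI) (auto simp: scalar_prod_def mult.commute)

lemma adj_add:
  assumes "A \<in> carrier_mat n m" "B \<in> carrier_mat n m"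
  shows "adj (A + B) = adj A + adj B"
  using assms by (intro eq_matI) auto

lemma adj_minus:
  assumes "A \<in> carrier_mat n m" "B \<in> carrier_mat n m"
  shows "adj (A - B) = adj A - adj B"
  using assms by (intro eq_matI) auto

lemma adj_smult: "adj (c \<cdot>\<^sub>m A) = cnj c \<cdot>\<^sub>m adj A"
  by (intro eq_matI) auto

lemma adj_one [simp]: "adj (1\<^sub>m n) = 1\<^sub>m n"
  by (intro eq_matI) auto

lemma adj_rdiag [simp]: "adj (rdiag n d) = rdiag n d"
  by (intro eq_matI) (auto simp: mat_diag_def)

lemma unitary_matD:
  assumes "unitary_mat n U"
  shows "U \<in> carrier_mat n n" "U * adj U = 1\<^sub>m n" "adj U * U = 1\<^sub>m n"
  using assms mat_mult_left_right_inverse[of U n "adj U"] by (auto simp: unitary_mat_def)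

lemma unitary_cancel:
  assumes "unitary_mat n U" "X \<in> carrier_mat n m"
  shows "U * (adj U * X) = X" "adj U * (U * X) = X"
  using assms(2) unitary_matD[OF assms(1)] assoc_mult_mat[of U n n "adj U" n X m]
    assoc_mult_mat[of "adj U" n n U n X m] by auto

definition inner_c :: "complex vec \<Rightarrow> complex vec \<Rightarrow> complex" where
  "inner_c v w = conjugate v \<bullet> w"

definition qf :: "complex mat \<Rightarrow> complex vec \<Rightarrow> real" where
  "qf A v = Re (inner_c v (A *\<^sub>v v))"

lemma inner_c_sum: "w \<in> carrier_vec n \<Longrightarrow> dim_vec v = n \<Longrightarrow> inner_c v w = (\<Sum>i<n. cnj (v $ i) * w $ i)"
  by (auto simp: inner_c_def scalar_prod_def lessThan_atLeast0 intro!: sum.cong)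

lemma inner_c_adj:
  assumes A: "A \<in> carrier_mat n m" and v: "v \<in> carrier_vec n" and w: "w \<in> carrier_vec m"
  shows "inner_c v (A *\<^sub>v w) = inner_c (adj A *\<^sub>v v) w"
proof -
  have "inner_c v (A *\<^sub>v w) = (\<Sum>i<n. cnj (v $ i) * (\<Sum>j<m. A $$ (i, j) * w $ j))"
    using assms by (subst inner_c_sum[of _ n]) (auto simp: scalar_prod_def lessThan_atLeast0)
  also have "\<dots> = (\<Sum>j<m. \<Sum>i<n. cnj (v $ i) * (A $$ (i, j) * w $ j))"
    unfolding sum_distrib_left by (rule sum.swap)
  also have "\<dots> = inner_c (adj A *\<^sub>v v) w"
    using assms by (subst inner_c_sum[of _ m])
      (auto simp: scalar_prod_def lessThan_atLeast0 sum_distrib_right sum_distrib_left mult_ac intro!: sum.cong)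
  finally show ?thesis .
qed

lemma qf_def': "qf A v = Re (conjugate v \<bullet> (A *\<^sub>v v))"
  by (simp add: qf_def inner_c_def)

lemma inner_c_add_right:
  "v \<in> carrier_vec n \<Longrightarrow> w \<in> carrier_vec n \<Longrightarrow> w' \<in> carrier_vec n \<Longrightarrow>
    inner_c v (w + w') = inner_c v w + inner_c v w'"
  by (simp add: inner_c_def scalar_prod_add_distrib[of _ n])

lemma inner_c_smult_right:
  "v \<in> carrier_vec n \<Longrightarrow> w \<in> carrier_vec n \<Longrightarrow> inner_c v (c \<cdot>\<^sub>v w) = c * inner_c v w"
  by (simp add: inner_c_def)

lemma inner_c_add_left:
  "v \<in> carrier_vec n \<Longrightarrow> v' \<in> carrier_vec n \<Longrightarrow> w \<in> carrier_vec n \<Longrightarrow>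
    inner_c (v + v') w = inner_c v w + inner_c v' w"
  by (simp add: inner_c_def conjugate_add_vec add_scalar_prod_distrib[of _ n])

lemma inner_c_smult_left:
  "v \<in> carrier_vec n \<Longrightarrow> w \<in> carrier_vec n \<Longrightarrow> inner_c (c \<cdot>\<^sub>v v) w = cnj c * inner_c v w"
  by (simp add: inner_c_def conjugate_smult_vec)

lemma inner_c_cnj:
  "v \<in> carrier_vec n \<Longrightarrow> w \<in> carrier_vec n \<Longrightarrow> cnj (inner_c v w) = inner_c w v"
  by (simp add: inner_c_sum mult.commute)

lemma qf_add:
  "A \<in> carrier_mat n n \<Longrightarrow> B \<in> carrier_mat n n \<Longrightarrow> v \<in> carrier_vec n \<Longrightarrow> qf (A + B) v = qf A v + qf B v"
  by (simp add: qf_def add_mult_distrib_mat_vec[of _ n n] inner_c_add_right[of _ n])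

lemma qf_smult:
  "A \<in> carrier_mat n n \<Longrightarrow> v \<in> carrier_vec n \<Longrightarrow> qf (complex_of_real c \<cdot>\<^sub>m A) v = c * qf A v"
proof -
  assume *: "A \<in> carrier_mat n n" "v \<in> carrier_vec n"
  then have "(complex_of_real c \<cdot>\<^sub>m A) *\<^sub>v v = complex_of_real c \<cdot>\<^sub>v (A *\<^sub>v v)"
    by (intro eq_vecI) auto
  with * show ?thesis by (simp add: qf_def inner_c_smult_right[of _ n])
qed

lemma qf_minus:
  assumes "A \<in> carrier_mat n n" "B \<in> carrier_mat n n" "v \<in> carrier_vec n"
  shows "qf (A - B) v = qf A v - qf B v"
proof -
  have "qf A v = qf ((A - B) + B) v" using assms by (intro arg_cong[of _ _ "\<lambda>X. qf X v"] eq_matI) auto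
  then show ?thesis using assms minus_carrier_mat[OF assms(2), of A] by (simp add: qf_add[of _ n])
qed

lemma qf_conj:
  assumes "A \<in> carrier_mat n n" "X \<in> carrier_mat n m" "v \<in> carrier_vec m"
  shows "qf (adj X * A * X) v = qf A (X *\<^sub>v v)"
proof -
  have "(adj X * A * X) *\<^sub>v v = adj X *\<^sub>v (A *\<^sub>v (X *\<^sub>v v))"
    using assms assoc_mult_mat_vec[of "adj X * A" m n X m v] assoc_mult_mat_vec[of "adj X" m n A n "X *\<^sub>v v"]
    by (simp add: mult_carrier_mat[of _ m n])
  then show ?thesis using assms by (simp add: qf_def inner_c_adj[of "adj X" m n])
qed

lemma qf_rdiag:
  assumes "v \<in> carrier_vec n"
  shows "qf (rdiag n d) v = (\<Sum>i<n. d i * (cmod (v $ i))\<^sup>2)"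
proof -
  have "(rdiag n d *\<^sub>v v) $ i = complex_of_real (d i) * v $ i" if "i < n" for i
  proof -
    have "(rdiag n d *\<^sub>v v) $ i = (\<Sum>j\<in>{0..<n}. (if i = j then complex_of_real (d j) else 0) * v $ j)"
      using assms that by (auto simp: scalar_prod_def mat_diag_def)
    also have "\<dots> = (\<Sum>j\<in>{0..<n}. (if i = j then complex_of_real (d j) * v $ j else 0))"
      by (intro sum.cong) auto
    finally show ?thesis using that by simp
  qed
  moreover have "cnj z * (complex_of_real c * z) = complex_of_real (c * (cmod z)\<^sup>2)" for z c
    by (metis complex_norm_square mult.commute mult.left_commute of_real_mult)
  ultimately have "inner_c v (rdiag n d *\<^sub>v v) = (\<Sum>i<n. complex_of_real (d i * (cmod (v $ i))\<^sup>2))"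
    using assms mult_mat_vec_carrier[OF mat_diag_dim assms]
    by (subst inner_c_sum[of _ n]) (auto simp del: index_mult_mat_vec of_real_mult of_real_power intro!: sum.cong)
  then show ?thesis unfolding qf_def by (simp only: of_real_sum[symmetric] Re_complex_of_real)
qed

lemma qf_one:
  assumes "v \<in> carrier_vec n"
  shows "qf (1\<^sub>m n) v = (\<Sum>i<n. (cmod (v $ i))\<^sup>2)"
  using qf_rdiag[OF assms, of "\<lambda>_. 1"] by simp

lemma psd_mat_iff:
  "A \<in> carrier_mat n n \<Longrightarrow> psd_mat A \<longleftrightarrow> adj A = A \<and> (\<forall>v\<in>carrier_vec n. 0 \<le> qf A v)"
  by (auto simp: psd_mat_def qf_def' hermitian_mat_def)

lemma pd_mat_iff:
  "A \<in> carrier_mat n n \<Longrightarrow> pd_mat A \<longleftrightarrow> adj A = A \<and> (\<forall>v\<in>carrier_vec n. v \<noteq> 0\<^sub>v n \<longrightarrow> 0 < qf A v)"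
  by (auto simp: pd_mat_def qf_def' hermitian_mat_def)

lemma qf_zero_vec: "A \<in> carrier_mat n n \<Longrightarrow> qf A (0\<^sub>v n) = 0"
  by (simp add: qf_def inner_c_def)

lemma pd_imp_psd: "pd_mat A \<Longrightarrow> psd_mat A"
proof -
  assume A: "pd_mat A"
  then have c: "A \<in> carrier_mat (dim_row A) (dim_row A)" by (simp add: pd_mat_def hermitian_mat_def)
  show ?thesis
    using A unfolding psd_mat_iff[OF c] pd_mat_iff[OF c] by (metis order.refl order_less_imp_le qf_zero_vec[OF c])
qed

lemma loewner_le_iff:
  assumes "A \<in> carrier_mat n n" "B \<in> carrier_mat n n" "adj A = A" "adj B = B"
  shows "loewner_le A B \<longleftrightarrow> (\<forall>v\<in>carrier_vec n. qf A v \<le> qf B v)"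
proof -
  have "B - A \<in> carrier_mat n n" using assms(1) by (rule minus_carrier_mat)
  then show ?thesis
    using assms by (auto simp: loewner_le_def psd_mat_iff adj_minus[of _ n n] qf_minus[of _ n])
qed

lemma qf_plus_vec:
  assumes A: "A \<in> carrier_mat n n" "adj A = A" and v: "v \<in> carrier_vec n" and w: "w \<in> carrier_vec n"
  shows "qf A (v + w) = qf A v + qf A w + 2 * Re (inner_c v (A *\<^sub>v w))"
proof -
  have "inner_c w (A *\<^sub>v v) = cnj (inner_c v (A *\<^sub>v w))"
    using inner_c_adj[OF A(1) w v] inner_c_cnj[of v n "A *\<^sub>v w"] assms by simp
  moreover have "A *\<^sub>v (v + w) = A *\<^sub>v v + A *\<^sub>v w"
    using assms by (simp add: mult_add_distrib_mat_vec[of _ n n])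
  ultimately show ?thesis
    using assms by (simp add: qf_def inner_c_add_left[of _ n] inner_c_add_right[of _ n])
qed

lemma inner_c_unit_vec:
  assumes "A \<in> carrier_mat n n" "i < n" "j < n"
  shows "inner_c (unit_vec n i) (A *\<^sub>v unit_vec n j) = A $$ (i, j)"
proof -
  have "A *\<^sub>v unit_vec n j = col A j" 
    using assms by (intro eq_vecI) (auto simp: scalar_prod_right_unit)
  moreover have "conjugate (unit_vec n i) = (unit_vec n i :: complex vec)"
    by (intro eq_vecI) (auto simp: unit_vec_def)
  ultimately show ?thesis using assms by (simp add: inner_c_def scalar_prod_left_unit[of _ n])
qed

text \<open>Polarisation: \<open>c = 1\<close> yields the real part of the entry and
  \<open>c = - \<i>\<close> the imaginary part. It carries equality and convergence from quadratic
  forms to entries.\<close>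

lemma Re_entry:
  assumes "A \<in> carrier_mat n n" "adj A = A" "i < n" "j < n"
  shows "Re (c * A $$ (i, j)) =
    (qf A (unit_vec n i + c \<cdot>\<^sub>v unit_vec n j) - qf A (unit_vec n i) - qf A (c \<cdot>\<^sub>v unit_vec n j)) / 2"
proof -
  have "A *\<^sub>v (c \<cdot>\<^sub>v unit_vec n j) = c \<cdot>\<^sub>v (A *\<^sub>v unit_vec n j)"
    using assms by (simp add: mult_mat_vec[of _ n n])
  then show ?thesis
    using qf_plus_vec[OF assms(1,2), of "unit_vec n i" "c \<cdot>\<^sub>v unit_vec n j"] assms
      inner_c_unit_vec[of A n i j] inner_c_smult_right[of "unit_vec n i" n "A *\<^sub>v unit_vec n j" c]
    by simp
qed

lemma adj_four_block_mat:
  assumes "A \<in> carrier_mat n1 m1" "B \<in> carrier_mat n1 m2" "C \<in> carrier_mat n2 m1" "D \<in> carrier_mat n2 m2"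
  shows "adj (four_block_mat A B C D) = four_block_mat (adj A) (adj C) (adj B) (adj D)"
  using assms by (intro eq_matI) auto

lemma unitary_mat_mult:
  assumes "unitary_mat n U" "unitary_mat n V"
  shows "unitary_mat n (U * V)"
proof -
  note u = unitary_matD[OF assms(1)] and v = unitary_matD[OF assms(2)]
  have "U * V * adj (U * V) = U * (V * adj V) * adj U"
    using u(1) v(1) by (simp add: adj_mult[of _ n n _ n] assoc_mult_mat[of _ n n _ n _ n] mult_carrier_mat[of _ n n _ n])
  then show ?thesis using u v by (simp add: unitary_mat_def mult_carrier_mat[of _ n n _ n])
qed

text \<open>Gram-Schmidt on a basis that starts with \<open>v\<close> keeps \<open>v\<close> as its
  first vector but gives only orthogonal vectors; dividing by the norms makes the columns
  orthonormal, hence the scalar \<open>c\<close>.\<close>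

lemma unitary_first_col:
  assumes v: "v \<in> carrier_vec n" "v \<noteq> 0\<^sub>v n"
  shows "\<exists>W c. unitary_mat n W \<and> col W 0 = c \<cdot>\<^sub>v v"
proof -
  interpret cof_vec_space n "TYPE(complex)" .
  have n: "n \<noteq> 0" using v by (metis carrier_vecD eq_vecI index_zero_vec(2) not_less_zero)
  define b where "b = basis_completion v"
  define ws where "ws = gram_schmidt n b"
  from basis_completion[OF v, folded b_def]
  have dist_b: "distinct b" and indep: "\<not> lin_dep (set b)" and b: "set b \<subseteq> carrier_vec n"
    and hdb: "hd b = v" and len_b: "length b = n" by auto
  from hdb len_b n obtain vs where bv: "b = v # vs" by (cases b) auto
  from gram_schmidt_result[OF b dist_b indep refl, folded ws_def]
  have ws: "set ws \<subseteq> carrier_vec n" "corthogonal ws" "length ws = n" by (auto simp: len_b)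
  have hd_ws: "hd ws = v" using gram_schmidt_hd[OF v(1), of vs] by (simp add: ws_def bv)
  have ws0: "ws ! 0 = v" using hd_ws ws(3) n by (metis hd_conv_nth list.size(3))
  have wsc: "ws ! i \<in> carrier_vec n" if "i < n" for i using ws that by auto
  define c where "c i = complex_of_real (1 / sqrt (Re (inner_c (ws ! i) (ws ! i))))" for i
  define W where "W = mat_of_cols n (map (\<lambda>i. c i \<cdot>\<^sub>v (ws ! i)) [0..<n])"
  have W: "W \<in> carrier_mat n n" by (rule carrier_matI) (simp_all add: W_def)
  have colW: "col W i = c i \<cdot>\<^sub>v (ws ! i)" if "i < n" for i
    unfolding W_def using that wsc[OF that] by (subst col_mat_of_cols) auto
  have ort: "inner_c (ws ! i) (ws ! j) = 0 \<longleftrightarrow> i \<noteq> j" if "i < n" "j < n" for i j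
  proof -
    have "inner_c (ws ! i) (ws ! j) = ws ! j \<bullet>c ws ! i"
      unfolding inner_c_def by (rule conjugate_vec_sprod_comm[symmetric]) (use wsc that in auto)
    then show ?thesis using corthogonalD[OF ws(2), of j i] ws(3) that by auto
  qed
  have nrm: "c i * c i * inner_c (ws ! i) (ws ! i) = 1" if "i < n" for i
  proof -
    let ?x = "inner_c (ws ! i) (ws ! i)"
    have x: "?x = complex_of_real (\<Sum>k<n. (cmod (ws ! i $ k))\<^sup>2)"
      using wsc[OF that] by (subst inner_c_sum[of _ n]) (auto simp: complex_norm_square mult.commute simp del: of_real_power)
    moreover have "?x \<noteq> 0" using ort[OF that that] by simp
    ultimately have "(\<Sum>k<n. (cmod (ws ! i $ k))\<^sup>2) > 0"
      by (metis of_real_0 order_le_less sum_nonneg zero_le_power2)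
    then show ?thesis unfolding c_def x Re_complex_of_real of_real_mult[symmetric] by simp
  qed
  have "adj W * W = 1\<^sub>m n"
  proof (rule eq_matI)
    fix i j assume ij: "i < dim_row (1\<^sub>m n :: complex mat)" "j < dim_col (1\<^sub>m n :: complex mat)"
    then have ij: "i < n" "j < n" by auto
    have "row (adj W) i = conjugate (col W i)"
      using W ij by (intro eq_vecI) auto
    then have "(adj W * W) $$ (i, j) = inner_c (col W i) (col W j)"
      using W ij by (simp add: inner_c_def)
    also have "\<dots> = cnj (c i) * (c j * inner_c (ws ! i) (ws ! j))"
      using ij wsc by (simp add: colW inner_c_smult_left[of _ n] inner_c_smult_right[of _ n])
    also have "\<dots> = 1\<^sub>m n $$ (i, j)"
      using ij ort[OF ij] nrm[of i] by (auto simp: c_def)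
    finally show "(adj W * W) $$ (i, j) = 1\<^sub>m n $$ (i, j)" .
  qed (use W in auto)
  then have "W * adj W = 1\<^sub>m n" using mat_mult_left_right_inverse[of "adj W" n W] W by simp
  then have "unitary_mat n W" using W by (simp add: unitary_mat_def)
  then show ?thesis using colW[of 0] ws0 n by auto
qed

text \<open>Deflation by induction on the size. A unitary whose first column is an eigenvector makes
  the first column of the conjugated matrix \<open>B\<close> a multiple of the first unit vector. As
  \<open>B\<close> is Hermitian, its first row is cleared too and the eigenvalue \<open>e\<close> is
  real, which leaves a Hermitian block \<open>C\<close> of size \<open>n\<close>.\<close>

lemma spectral_exists:
  assumes "A \<in> carrier_mat n n" "adj A = A"
  shows "\<exists>U d. unitary_mat n U \<and> A = U * rdiag n d * adj U"
  using assms
proof (induction n arbitrary: A)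
  case 0
  then show ?case
    by (intro exI[of _ "1\<^sub>m 0"] exI[of _ "\<lambda>_. 0"]) (auto simp: unitary_mat_def)
next
  case (Suc n)
  let ?N = "Suc n"
  note A = Suc.prems
  obtain e where "eigenvalue A e"
    using spectrum_non_empty[OF A(1)] by (auto simp: spectrum_def)
  then obtain v where v: "v \<in> carrier_vec ?N" "v \<noteq> 0\<^sub>v ?N" "A *\<^sub>v v = e \<cdot>\<^sub>v v"
    using A by (auto simp: eigenvalue_def eigenvector_def)
  obtain W c where uW: "unitary_mat ?N W" and W0: "col W 0 = c \<cdot>\<^sub>v v"
    using unitary_first_col[OF v(1,2)] by blast
  note W = unitary_matD[OF uW]
  define B where "B = adj W * A * W"
  have B: "B \<in> carrier_mat ?N ?N" unfolding B_def
    by (rule mult_carrier_mat[OF mult_carrier_mat[OF adj_carrier[OF W(1)] A(1)] W(1)])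
  have adjB: "adj B = B"
    using W(1) A by (simp add: B_def adj_mult[of _ ?N ?N _ ?N] assoc_mult_mat[of _ ?N ?N _ ?N _ ?N] mult_carrier_mat[of _ ?N ?N _ ?N])
  have AB: "A = W * B * adj W"
  proof -
    have "W * B * adj W = (W * adj W) * A * (W * adj W)"
      using W(1) A by (simp add: B_def assoc_mult_mat[of _ ?N ?N _ ?N _ ?N] mult_carrier_mat[of _ ?N ?N _ ?N])
    then show ?thesis using W A by simp
  qed
  have "B *\<^sub>v unit_vec ?N 0 = e \<cdot>\<^sub>v unit_vec ?N 0"
  proof -
    have Wu: "W *\<^sub>v unit_vec ?N 0 = col W 0"
      using W(1) by (intro eq_vecI) (auto simp: scalar_prod_right_unit)
    have "B *\<^sub>v unit_vec ?N 0 = adj W *\<^sub>v (A *\<^sub>v (W *\<^sub>v unit_vec ?N 0))"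
      using W(1) A by (simp add: B_def assoc_mult_mat_vec[of _ ?N ?N _ ?N] mult_carrier_mat[of _ ?N ?N _ ?N])
    also have "A *\<^sub>v (W *\<^sub>v unit_vec ?N 0) = e \<cdot>\<^sub>v (W *\<^sub>v unit_vec ?N 0)"
      unfolding Wu W0 using v A by (simp add: mult_mat_vec[of _ ?N ?N] smult_smult_assoc mult.commute)
    also have "adj W *\<^sub>v (e \<cdot>\<^sub>v (W *\<^sub>v unit_vec ?N 0)) = e \<cdot>\<^sub>v ((adj W * W) *\<^sub>v unit_vec ?N 0)"
      using W(1) by (simp add: mult_mat_vec[of _ ?N ?N] assoc_mult_mat_vec[of _ ?N ?N _ ?N])
    finally show ?thesis using W(3) by simp
  qed
  moreover have "B *\<^sub>v unit_vec ?N 0 = col B 0"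
    using B by (intro eq_vecI) (auto simp: scalar_prod_right_unit)
  ultimately have "col B 0 $ i = (e \<cdot>\<^sub>v unit_vec ?N 0) $ i" for i by simp
  then have B0: "B $$ (i, 0) = (if i = 0 then e else 0)" if "i < ?N" for i
    using that B by (metis carrier_matD index_col index_smult_vec(1) index_unit_vec mult.right_neutral mult_zero_right zero_less_Suc)
  have B0': "B $$ (0, i) = (if i = 0 then e else 0)" "B $$ (0, 0) = cnj (B $$ (0, 0))" if "i < ?N" for i
    using adj_index[of 0 B i] adj_index[of 0 B 0] that B adjB B0[OF that] by (auto split: if_splits)
  have e: "e = complex_of_real (Re e)"
    using B0'(2)[of 0] B0[of 0] by (metis Reals_cnj_iff of_real_Re zero_less_Suc)
  define C where "C = mat n n (\<lambda>(i, j). B $$ (Suc i, Suc j))"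
  have C: "C \<in> carrier_mat n n" by (simp add: C_def)
  have "cnj (B $$ (j, i)) = B $$ (i, j)" if "i < ?N" "j < ?N" for i j
    using adj_index[of i B j] that B unfolding adjB by auto
  then have "adj C = C"
    by (intro eq_matI) (auto simp: C_def)
  from Suc.IH[OF C this] obtain V d where uV: "unitary_mat n V" and Cd: "C = V * rdiag n d * adj V" by blast
  note V = unitary_matD[OF uV]
  define P where "P = four_block_mat (1\<^sub>m 1) (0\<^sub>m 1 n) (0\<^sub>m n 1) V"
  \<comment> \<open>The new eigenvalue takes index 0 and those of \<open>C\<close> move up by one,
    matching the block form of \<open>P\<close>.\<close>
  define D where "D = case_nat (Re e) d"
  have P: "P \<in> carrier_mat ?N ?N" using V(1) four_block_carrier_mat[of "1\<^sub>m 1" 1 1 V n n] by (simp add: P_def)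
  have adj0: "adj (0\<^sub>m a b) = 0\<^sub>m b a" for a b by (intro eq_matI) auto
  have adjP: "adj P = four_block_mat (1\<^sub>m 1) (0\<^sub>m 1 n) (0\<^sub>m n 1) (adj V)"
    unfolding P_def by (subst adj_four_block_mat[of _ 1 1 _ n _ n]) (use V in \<open>auto simp: adj0\<close>)
  have dD: "rdiag ?N D = four_block_mat (mat 1 1 (\<lambda>_. e)) (0\<^sub>m 1 n) (0\<^sub>m n 1) (rdiag n d)"
    using e by (intro eq_matI) (auto simp: mat_diag_def D_def split: nat.splits)
  have "P * adj P = 1\<^sub>m ?N"
    unfolding adjP unfolding P_def
    by (subst mult_four_block_mat[of _ 1 1 _ n _ n _ _ 1 _ n]) (use V in \<open>auto simp: four_block_one_mat[of 1 n, simplified]\<close>)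
  then have uP: "unitary_mat ?N P" using P by (simp add: unitary_mat_def)
  have "P * rdiag ?N D * adj P = four_block_mat (mat 1 1 (\<lambda>_. e)) (0\<^sub>m 1 n) (0\<^sub>m n 1) C"
  proof -
    have *: "P * rdiag ?N D = four_block_mat (mat 1 1 (\<lambda>_. e)) (0\<^sub>m 1 n) (0\<^sub>m n 1) (V * rdiag n d)"
      unfolding dD unfolding P_def
      by (subst mult_four_block_mat[of _ 1 1 _ n _ n _ _ 1 _ n]) (use V in \<open>auto simp: left_mult_zero_mat[OF mat_diag_dim] mult_carrier_mat[of _ n n _ n]\<close>)
    show ?thesis
      unfolding * adjP Cd
      by (subst mult_four_block_mat[of _ 1 1 _ n _ n _ _ 1 _ n])
        (use V in \<open>auto simp: mult_carrier_mat[of _ n n _ n] right_mult_zero_mat[of _ n n]\<close>)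
  qed
  also have "\<dots> = B"
  proof (rule eq_matI)
    fix i j assume "i < dim_row B" "j < dim_col B"
    then show "four_block_mat (mat 1 1 (\<lambda>_. e)) (0\<^sub>m 1 n) (0\<^sub>m n 1) C $$ (i, j) = B $$ (i, j)"
      using B B0[of i] B0'(1)[of j] C by (cases i; cases j) (auto simp: C_def)
  qed (use B C in auto)
  finally have BP: "B = P * rdiag ?N D * adj P" ..
  have "A = (W * P) * rdiag ?N D * adj (W * P)"
    unfolding AB BP using W(1) P
    by (simp add: adj_mult[of _ ?N ?N _ ?N] assoc_mult_mat[of _ ?N ?N _ ?N _ ?N] mult_carrier_mat[of _ ?N ?N _ ?N])
  then show ?case using unitary_mat_mult[OF uW uP] by blast
qed

section \<open>Functional calculus\<close>

text \<open>The definite description in \<open>mat_fun\<close> denotes because the result is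
  independent of the diagonalisation: for two of them, \<open>W = adj V * U\<close> intertwines the
  two diagonals, hence also their images under \<open>f\<close>.\<close>

lemma mat_fun_eq:
  assumes U: "unitary_mat n U" and A: "A = U * rdiag n d * adj U"
  shows "mat_fun f A = U * rdiag n (\<lambda>i. f (d i)) * adj U"
proof -
  note uD = unitary_matD[OF U]
  have dA: "dim_row A = n" using uD A by simp
  show ?thesis
    unfolding mat_fun_def dA
  proof (rule the_equality)
    show "\<exists>U' d'. unitary_mat n U' \<and> A = U' * rdiag n d' * adj U' \<and>
       U * rdiag n (\<lambda>i. f (d i)) * adj U = U' * rdiag n (\<lambda>i. f (d' i)) * adj U'"
      using U A by blast
  next
    fix B assume "\<exists>U d. unitary_mat n U \<and> A = U * rdiag n d * adj U \<and> B = U * rdiag n (\<lambda>i. f (d i)) * adj U"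
    then obtain V e where V: "unitary_mat n V" "A = V * rdiag n e * adj V"
      and B: "B = V * rdiag n (\<lambda>i. f (e i)) * adj V" by blast
    note vD = unitary_matD[OF V(1)]
    define W where "W = adj V * U"
    have W: "W \<in> carrier_mat n n" unfolding W_def by (rule mult_carrier_mat[OF adj_carrier[OF vD(1)] uD(1)])
    have *: "V * (W * X) * adj U = U * X * adj U" if "X \<in> carrier_mat n n" for X
    proof -
      have "V * (W * X) = (V * adj V) * (U * X)"
        using that uD vD
        by (simp add: W_def assoc_mult_mat[of _ n n _ n _ n] mult_carrier_mat[of _ n n _ n] unitary_cancel[OF V(1), where m = n])
      then show ?thesis using that uD vD by simp
    qed
    have **: "V * (X * W) * adj U = V * X * adj V" if "X \<in> carrier_mat n n" for X
    proof -
      have "V * (X * W) * adj U = V * X * adj V * (U * adj U)"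
        using that uD(1) vD(1) by (simp add: W_def assoc_mult_mat[of _ n n _ n _ n] mult_carrier_mat[of _ n n _ n])
      then show ?thesis using that uD vD by simp
    qed
    have "W * rdiag n d = adj V * (U * rdiag n d * adj U) * U"
    proof -
      have "adj V * (U * rdiag n d * adj U) * U = adj V * U * rdiag n d * (adj U * U)"
        using uD(1) vD(1) by (simp add: assoc_mult_mat[of _ n n _ n _ n] mult_carrier_mat[of _ n n _ n])
      then show ?thesis using uD vD
        by (simp add: W_def right_mult_one_mat[of _ n n] left_mult_one_mat[of _ n n] mult_carrier_mat[of _ n n _ n])
    qed
    also have "\<dots> = adj V * (V * rdiag n e * adj V) * U" using A V by simp
    also have "\<dots> = rdiag n e * W"
    proof -
      have "adj V * (V * rdiag n e * adj V) * U = (adj V * V) * (rdiag n e * (adj V * U))"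
        using uD(1) vD(1) by (simp add: assoc_mult_mat[of _ n n _ n _ n] mult_carrier_mat[of _ n n _ n])
      then show ?thesis using uD vD
        by (simp add: W_def right_mult_one_mat[of _ n n] left_mult_one_mat[of _ n n] mult_carrier_mat[of _ n n _ n])
    qed
    finally have eq: "W * rdiag n d = rdiag n e * W" .
    have "W * rdiag n (\<lambda>i. f (d i)) = rdiag n (\<lambda>i. f (e i)) * W"
    proof (rule eq_matI)
      fix i j assume "i < dim_row (rdiag n (\<lambda>i. f (e i)) * W)" "j < dim_col (rdiag n (\<lambda>i. f (e i)) * W)"
      then have ij: "i < n" "j < n" using W by (auto simp: mat_diag_def)
      have "W $$ (i, j) * complex_of_real (d j) = complex_of_real (e i) * W $$ (i, j)"
        using arg_cong[OF eq, of "\<lambda>X. X $$ (i, j)"] ij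
        by (simp add: mat_diag_mult_left[OF W] mat_diag_mult_right[OF W])
      \<comment> \<open>A nonzero entry of \<open>W\<close> links only equal eigenvalues, and these
        have equal images under \<open>f\<close>.\<close>
      then have "W $$ (i, j) = 0 \<or> d j = e i" by auto
      then show "(W * rdiag n (\<lambda>i. f (d i))) $$ (i, j) = (rdiag n (\<lambda>i. f (e i)) * W) $$ (i, j)"
        using ij by (auto simp: mat_diag_mult_left[OF W] mat_diag_mult_right[OF W])
    qed (use W in \<open>auto simp: mat_diag_def\<close>)
    then show "B = U * rdiag n (\<lambda>i. f (d i)) * adj U"
      using *[of "rdiag n (\<lambda>i. f (d i))"] **[of "rdiag n (\<lambda>i. f (e i))"] by (simp add: B)
  qed
qed

text \<open>With the diagonalising pair as explicit data, matrices sharing one \<open>U\<close> are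
  combined eigenvalue by eigenvalue. Values of \<open>d\<close> from index \<open>n\<close> on are
  arbitrary and may be chosen at will.\<close>

definition spectral :: "nat \<Rightarrow> complex mat \<Rightarrow> complex mat \<Rightarrow> (nat \<Rightarrow> real) \<Rightarrow> bool" where
  "spectral n A U d \<longleftrightarrow> unitary_mat n U \<and> A = U * rdiag n d * adj U"

lemma spectral_carrier: "spectral n A U d \<Longrightarrow> A \<in> carrier_mat n n"
  unfolding spectral_def using unitary_matD(1)[of n U] by auto

lemma spectral_adj: "spectral n A U d \<Longrightarrow> adj A = A"
  unfolding spectral_def using unitary_matD(1)[of n U]
  by (auto simp: adj_mult[of _ n n _ n] assoc_mult_mat[of _ n n _ n _ n] mult_carrier_mat[of _ n n _ n])

lemma spectral_cong:
  assumes "spectral n A U d" "\<And>i. i < n \<Longrightarrow> d i = e i"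
  shows "spectral n A U e"
proof -
  have "rdiag n d = rdiag n e" using assms(2) by (intro eq_matI) (auto simp: mat_diag_def)
  with assms(1) show ?thesis by (simp add: spectral_def)
qed

lemma spectral_mat_fun: "spectral n A U d \<Longrightarrow> spectral n (mat_fun f A) U (\<lambda>i. f (d i))"
  unfolding spectral_def using mat_fun_eq by blast

lemma spectral_powr: "spectral n A U d \<Longrightarrow> spectral n (mat_powr A s) U (\<lambda>i. d i powr s)"
  unfolding mat_powr_def by (rule spectral_mat_fun)

lemma spectral_unique: "spectral n A U d \<Longrightarrow> spectral n B U d \<Longrightarrow> A = B"
  by (simp add: spectral_def)

lemma spectral_one: "unitary_mat n U \<Longrightarrow> spectral n (1\<^sub>m n) U (\<lambda>_. 1)"
  unfolding spectral_def using unitary_matD[of n U] by simp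

lemma spectral_mult:
  assumes "spectral n A U d" "spectral n B U e"
  shows "spectral n (A * B) U (\<lambda>i. d i * e i)"
proof -
  have u: "unitary_mat n U" using assms by (simp add: spectral_def)
  note U = unitary_matD[OF u]
  have "A * B = U * (rdiag n d * rdiag n e) * adj U"
    using assms U unfolding spectral_def
    by (simp del: mat_diag_diag add: assoc_mult_mat[of _ n n _ n _ n] mult_carrier_mat[of _ n n _ n]
        unitary_cancel[OF u, where m = n])
  then show ?thesis using u by (simp add: spectral_def)
qed

lemma spectral_lin:
  assumes "spectral n A U d" "spectral n B U e"
  shows "spectral n (complex_of_real a \<cdot>\<^sub>m A + complex_of_real b \<cdot>\<^sub>m B) U (\<lambda>i. a * d i + b * e i)"
proof -
  have u: "unitary_mat n U" using assms by (simp add: spectral_def)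
  note U = unitary_matD[OF u]
  have D: "rdiag n (\<lambda>i. a * d i + b * e i) = complex_of_real a \<cdot>\<^sub>m rdiag n d + complex_of_real b \<cdot>\<^sub>m rdiag n e"
    by (intro eq_matI) (auto simp: mat_diag_def)
  have "U * (complex_of_real a \<cdot>\<^sub>m rdiag n d + complex_of_real b \<cdot>\<^sub>m rdiag n e) * adj U
    = complex_of_real a \<cdot>\<^sub>m (U * rdiag n d * adj U) + complex_of_real b \<cdot>\<^sub>m (U * rdiag n e * adj U)"
    using U by (simp add: mult_add_distrib_mat[of _ n n _ n] add_mult_distrib_mat[of _ n n _ _ n]
        mult_smult_distrib[of _ n n _ n] mult_smult_assoc_mat[of _ n n _ n] mult_carrier_mat[of _ n n _ n])
  then show ?thesis using assms u unfolding spectral_def D by simp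
qed

section \<open>Eigenvalues and bounds on quadratic forms\<close>

definition nsq :: "complex vec \<Rightarrow> real" where
  "nsq v = (\<Sum>i<dim_vec v. (cmod (v $ i))\<^sup>2)"

lemma nsq_qf: "v \<in> carrier_vec n \<Longrightarrow> nsq v = qf (1\<^sub>m n) v"
  by (auto simp: nsq_def qf_one)

lemma nsq_nonneg [simp]: "nsq v \<ge> 0"
  by (simp add: nsq_def sum_nonneg)

lemma nsq_pos: "v \<in> carrier_vec n \<Longrightarrow> v \<noteq> 0\<^sub>v n \<Longrightarrow> nsq v > 0"
proof -
  assume v: "v \<in> carrier_vec n" "v \<noteq> 0\<^sub>v n"
  then obtain i where "i < n" "v $ i \<noteq> 0" by (metis carrier_vecD eq_vecI index_zero_vec)
  then show ?thesis using v by (auto simp: nsq_def intro!: sum_pos2[of _ i])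
qed

lemma nsq_unitary:
  assumes "unitary_mat n U" "v \<in> carrier_vec n"
  shows "nsq (adj U *\<^sub>v v) = nsq v" "nsq (U *\<^sub>v v) = nsq v"
proof -
  note U = unitary_matD[OF assms(1)]
  show "nsq (adj U *\<^sub>v v) = nsq v"
    using qf_conj[of "1\<^sub>m n" n "adj U" n v] U assms by (simp add: nsq_qf[of _ n] mult_mat_vec_carrier[of _ n n])
  show "nsq (U *\<^sub>v v) = nsq v"
    using qf_conj[of "1\<^sub>m n" n U n v] U assms by (simp add: nsq_qf[of _ n] mult_mat_vec_carrier[of _ n n])
qed

lemma qf_spectral:
  assumes "spectral n A U d" "v \<in> carrier_vec n"
  shows "qf A v = (\<Sum>i<n. d i * (cmod ((adj U *\<^sub>v v) $ i))\<^sup>2)"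
proof -
  have U: "unitary_mat n U" "A = U * rdiag n d * adj U" using assms by (auto simp: spectral_def)
  note U' = unitary_matD(1)[OF U(1)]
  have "qf A v = qf (rdiag n d) (adj U *\<^sub>v v)"
    using qf_conj[of "rdiag n d" n "adj U" n v] U' assms U by simp
  also have "\<dots> = (\<Sum>i<n. d i * (cmod ((adj U *\<^sub>v v) $ i))\<^sup>2)"
    by (rule qf_rdiag) (use mult_mat_vec_carrier[OF adj_carrier[OF U'] assms(2)] in simp)
  finally show ?thesis .
qed

lemma nsq_adj_sum:
  assumes "unitary_mat n U" "v \<in> carrier_vec n"
  shows "(\<Sum>i<n. (cmod ((adj U *\<^sub>v v) $ i))\<^sup>2) = nsq v"
  using nsq_unitary(1)[OF assms] unitary_matD(1)[OF assms(1)] by (simp add: nsq_def)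

text \<open>The columns of \<open>U\<close> are unit eigenvectors; testing on them turns bounds on
  forms into bounds on eigenvalues.\<close>

lemma spectral_eigvec:
  assumes "spectral n A U d" "i < n"
  shows "U *\<^sub>v unit_vec n i \<in> carrier_vec n" "nsq (U *\<^sub>v unit_vec n i) = 1" "qf A (U *\<^sub>v unit_vec n i) = d i"
proof -
  have U: "unitary_mat n U" using assms by (auto simp: spectral_def)
  note U' = unitary_matD[OF U]
  show c: "U *\<^sub>v unit_vec n i \<in> carrier_vec n" using U' by simp
  have *: "adj U *\<^sub>v (U *\<^sub>v unit_vec n i) = unit_vec n i"
    using U' by (simp add: assoc_mult_mat_vec[of "adj U" n n U n "unit_vec n i", symmetric])
  have cm: "(\<Sum>k<n. f k * (cmod (unit_vec n i $ k))\<^sup>2) = f i" for f :: "nat \<Rightarrow> real"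
  proof -
    have "(\<Sum>k<n. f k * (cmod (unit_vec n i $ k))\<^sup>2) = (\<Sum>k<n. if k = i then f k else 0)"
      using assms(2) by (intro sum.cong) auto
    then show ?thesis using assms by simp
  qed
  show "nsq (U *\<^sub>v unit_vec n i) = 1"
    using nsq_adj_sum[OF U c] cm[of "\<lambda>_. 1"] unfolding * by simp
  show "qf A (U *\<^sub>v unit_vec n i) = d i"
    using qf_spectral[OF assms(1) c] unfolding * cm .
qed

lemma psd_spectral:
  assumes "A \<in> carrier_mat n n" "psd_mat A"
  obtains U d where "spectral n A U d" "\<And>i. d i \<ge> 0"
proof -
  have A: "adj A = A" "\<And>v. v \<in> carrier_vec n \<Longrightarrow> qf A v \<ge> 0" using assms by (auto simp: psd_mat_iff)
  obtain U d where s: "spectral n A U d" using spectral_exists[OF assms(1) A(1)] by (auto simp: spectral_def)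
  have "d i \<ge> 0" if "i < n" for i using spectral_eigvec[OF s that] A(2) by metis
  \<comment> \<open>The default 0 from index \<open>n\<close> on makes the sign hold for every
    natural number.\<close>
  then show ?thesis using that[of U "\<lambda>i. if i < n then d i else 0"] spectral_cong[OF s] by auto
qed

lemma pd_spectral:
  assumes "A \<in> carrier_mat n n" "pd_mat A"
  obtains U d where "spectral n A U d" "\<And>i. d i > 0"
proof -
  have A: "adj A = A" "\<And>v. v \<in> carrier_vec n \<Longrightarrow> v \<noteq> 0\<^sub>v n \<Longrightarrow> qf A v > 0" using assms by (auto simp: pd_mat_iff)
  obtain U d where s: "spectral n A U d" using spectral_exists[OF assms(1) A(1)] by (auto simp: spectral_def)
  have "d i > 0" if "i < n" for i
  proof -
    have "nsq (0\<^sub>v n) = 0" by (simp add: nsq_def)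
    then have "U *\<^sub>v unit_vec n i \<noteq> 0\<^sub>v n" using spectral_eigvec(2)[OF s that] by fastforce
    then show ?thesis using spectral_eigvec[OF s that] A(2) by metis
  qed
  then show ?thesis using that[of U "\<lambda>i. if i < n then d i else 1"] spectral_cong[OF s] by auto
qed

lemma spectral_psd:
  assumes "spectral n A U d" "\<And>i. i < n \<Longrightarrow> d i \<ge> 0"
  shows "psd_mat A"
  using assms spectral_carrier[OF assms(1)] spectral_adj[OF assms(1)]
  by (auto simp: psd_mat_iff qf_spectral intro!: sum_nonneg)

lemma spectral_lower:
  assumes "spectral n A U d" "\<And>i. i < n \<Longrightarrow> l \<le> d i" "v \<in> carrier_vec n"
  shows "l * nsq v \<le> qf A v"
proof -
  have "unitary_mat n U" using assms by (simp add: spectral_def)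
  note nsq_adj_sum[OF this assms(3)]
  then have "l * nsq v = (\<Sum>i<n. l * (cmod ((adj U *\<^sub>v v) $ i))\<^sup>2)" by (metis sum_distrib_left)
  also have "\<dots> \<le> qf A v" unfolding qf_spectral[OF assms(1,3)]
    by (intro sum_mono mult_right_mono assms) auto
  finally show ?thesis .
qed

lemma spectral_upper:
  assumes "spectral n A U d" "\<And>i. i < n \<Longrightarrow> d i \<le> l" "v \<in> carrier_vec n"
  shows "qf A v \<le> l * nsq v"
proof -
  have "unitary_mat n U" using assms by (simp add: spectral_def)
  note nsq_adj_sum[OF this assms(3)]
  then have "l * nsq v = (\<Sum>i<n. l * (cmod ((adj U *\<^sub>v v) $ i))\<^sup>2)" by (metis sum_distrib_left)
  also have "\<dots> \<ge> qf A v" unfolding qf_spectral[OF assms(1,3)]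
    by (intro sum_mono mult_right_mono assms) auto
  finally show ?thesis .
qed

lemma pd_lower:
  assumes "A \<in> carrier_mat n n" "pd_mat A"
  obtains l where "l > 0" "\<And>v. v \<in> carrier_vec n \<Longrightarrow> l * nsq v \<le> qf A v"
proof -
  obtain U d where s: "spectral n A U d" "\<And>i. d i > 0" using pd_spectral[OF assms] by blast
  \<comment> \<open>The element 1 keeps the minimum defined and positive when
    \<open>n = 0\<close>.\<close>
  let ?l = "Min (insert 1 (d ` {..<n}))"
  have "?l > 0" using s(2) by auto
  moreover have "?l \<le> d i" if "i < n" for i using that by auto
  ultimately show ?thesis using that[of ?l] spectral_lower[OF s(1)] by blast
qed

lemma pdI_lower:
  assumes "A \<in> carrier_mat n n" "adj A = A" "l > 0" "\<And>v. v \<in> carrier_vec n \<Longrightarrow> l * nsq v \<le> qf A v"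
  shows "pd_mat A"
  using assms by (auto simp: pd_mat_iff) (metis mult_pos_pos nsq_pos order_less_le_trans)

lemma spectral_pd:
  assumes "spectral n A U d" "\<And>i. d i > 0"
  shows "pd_mat A"
proof (rule pdI_lower)
  let ?l = "Min (insert 1 (d ` {..<n}))"
  show "?l > 0" using assms(2) by auto
  show "?l * nsq v \<le> qf A v" if "v \<in> carrier_vec n" for v
    using spectral_lower[OF assms(1) _ that, of ?l] by auto
qed (use spectral_carrier[OF assms(1)] spectral_adj[OF assms(1)] in auto)

section \<open>Powers and square roots of positive matrices\<close>

lemma mat_powr_psd:
  assumes "A \<in> carrier_mat n n" "psd_mat A"
  shows "mat_powr A s \<in> carrier_mat n n" "psd_mat (mat_powr A s)"
proof -
  obtain U d where *: "spectral n A U d" "\<And>i. d i \<ge> 0" using psd_spectral[OF assms] by blast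
  note sp = spectral_powr[OF *(1), of s]
  show "mat_powr A s \<in> carrier_mat n n" "psd_mat (mat_powr A s)"
    using spectral_carrier[OF sp] spectral_psd[OF sp] by auto
qed

lemma mat_powr_powr:
  assumes "A \<in> carrier_mat n n" "psd_mat A"
  shows "mat_powr (mat_powr A s) t = mat_powr A (s * t)"
proof -
  obtain U d where *: "spectral n A U d" "\<And>i. d i \<ge> 0" using psd_spectral[OF assms] by blast
  have "spectral n (mat_powr (mat_powr A s) t) U (\<lambda>i. d i powr (s * t))"
    using spectral_powr[OF spectral_powr[OF *(1), of s], of t] by (simp add: powr_powr)
  then show ?thesis using spectral_powr[OF *(1), of "s * t"] by (rule spectral_unique)
qed

lemma mat_powr_1:
  assumes "A \<in> carrier_mat n n" "psd_mat A"
  shows "mat_powr A 1 = A"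
proof -
  obtain U d where *: "spectral n A U d" "\<And>i. d i \<ge> 0" using psd_spectral[OF assms] by blast
  have "spectral n (mat_powr A 1) U d" using spectral_powr[OF *(1), of 1] *(2) by simp
  then show ?thesis using *(1) by (rule spectral_unique)
qed

lemma mat_powr_one: "mat_powr (1\<^sub>m n) s = 1\<^sub>m n"
proof -
  have "unitary_mat n (1\<^sub>m n)" by (simp add: unitary_mat_def)
  from spectral_one[OF this] spectral_powr[OF spectral_one[OF this], of s] show ?thesis
    by (simp add: spectral_unique)
qed

lemma sqrt_pd:
  assumes "A \<in> carrier_mat n n" "pd_mat A"
  defines "R \<equiv> mat_powr A (1/2)" and "Ri \<equiv> mat_powr A (-1/2)"
  shows "R \<in> carrier_mat n n" "Ri \<in> carrier_mat n n" "adj R = R" "adj Ri = Ri"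
    "R * R = A" "R * Ri = 1\<^sub>m n" "Ri * R = 1\<^sub>m n"
proof -
  obtain U d where *: "spectral n A U d" "\<And>i. d i > 0" using pd_spectral[OF assms(1,2)] by blast
  note R = spectral_powr[OF *(1), of "1/2", folded R_def]
  note Ri = spectral_powr[OF *(1), of "-1/2", folded Ri_def]
  show "R \<in> carrier_mat n n" "Ri \<in> carrier_mat n n" "adj R = R" "adj Ri = Ri"
    using spectral_carrier[OF R] spectral_carrier[OF Ri] spectral_adj[OF R] spectral_adj[OF Ri] by auto
  have d: "d i \<noteq> 0" "d i \<ge> 0" for i using *(2)[of i] by auto
  have "spectral n (R * R) U d"
    using spectral_mult[OF R R] by (rule spectral_cong) (simp add: d powr_half_sqrt)
  then show "R * R = A" using *(1) by (rule spectral_unique)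
  have one: "spectral n (1\<^sub>m n) U (\<lambda>_. 1)" using *(1) spectral_one by (simp add: spectral_def)
  have "spectral n (R * Ri) U (\<lambda>_. 1)"
    using spectral_mult[OF R Ri] by (rule spectral_cong) (simp add: d flip: powr_add)
  then show "R * Ri = 1\<^sub>m n" using one by (rule spectral_unique)
  have "spectral n (Ri * R) U (\<lambda>_. 1)"
    using spectral_mult[OF Ri R] by (rule spectral_cong) (simp add: d flip: powr_add)
  then show "Ri * R = 1\<^sub>m n" using one by (rule spectral_unique)
qed

section \<open>The weighted geometric mean\<close>

text \<open>\<open>t * d / (d + t)\<close> is the parallel sum of \<open>d\<close> and
  \<open>t\<close>, the least value of \<open>d * a^2 + t * b^2\<close> under
  \<open>a + b = 1\<close>. For \<open>c = a + b\<close> the gap, after clearing denominators, is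
  the square of \<open>d * a - t * b\<close>.\<close>

lemma parallel_sum_ineq:
  fixes a b c d t :: real
  assumes "d \<ge> 0" "t > 0" "0 \<le> c" "c \<le> a + b"
  shows "c\<^sup>2 * (t * (d / (d + t))) \<le> d * a\<^sup>2 + t * b\<^sup>2"
proof -
  have p: "d + t > 0" using assms by simp
  have "t * d * (a + b)\<^sup>2 \<le> (d * a\<^sup>2 + t * b\<^sup>2) * (d + t)"
  proof -
    have "(d * a\<^sup>2 + t * b\<^sup>2) * (d + t) - t * d * (a + b)\<^sup>2 = (d * a - t * b)\<^sup>2"
      by (simp add: power2_eq_square algebra_simps)
    then show ?thesis by (metis diff_ge_0_iff_ge zero_le_power2)
  qed
  moreover have "t * d * c\<^sup>2 \<le> t * d * (a + b)\<^sup>2"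
    using assms by (intro mult_left_mono power_mono) auto
  ultimately have "t * d * c\<^sup>2 \<le> (d * a\<^sup>2 + t * b\<^sup>2) * (d + t)" by linarith
  then show ?thesis using p by (simp add: field_simps)
qed

text \<open>The weights do not depend on \<open>\<alpha>\<close>, and the weighted resolvent sum is the quadratic form of the
  parallel sum of \<open>t A\<close> and \<open>B\<close>, i.e. a minimum of functions linear in \<open>(A, B)\<close>.\<close>

lemma wgm_pd_weights:
  assumes A: "A \<in> carrier_mat n n" "pd_mat A" and B: "B \<in> carrier_mat n n" "psd_mat B"
    and v: "v \<in> carrier_vec n"
  obtains w d :: "nat \<Rightarrow> real" where
    "\<And>\<alpha>. qf (wgm_pd \<alpha> A B) v = (\<Sum>i<n. w i * d i powr \<alpha>)"
    "\<And>i. w i \<ge> 0" "\<And>i. d i \<ge> 0"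
    "qf A v = (\<Sum>i<n. w i)" "qf B v = (\<Sum>i<n. w i * d i)"
    "\<And>t x. t > 0 \<Longrightarrow> x \<in> carrier_vec n \<Longrightarrow> t * (\<Sum>i<n. w i * (d i / (d i + t))) \<le> qf B x + t * qf A (v - x)"
    "\<And>t. t > 0 \<Longrightarrow> \<exists>x\<in>carrier_vec n. t * (\<Sum>i<n. w i * (d i / (d i + t))) = qf B x + t * qf A (v - x)"
proof -
  define R where "R = mat_powr A (1/2)"
  define Ri where "Ri = mat_powr A (-1/2)"
  note R = sqrt_pd[OF A, folded R_def Ri_def]
  define C where "C = Ri * B * Ri"
  have C: "C \<in> carrier_mat n n" using R(2) B(1) by (simp add: C_def mult_carrier_mat[of _ n n _ n])
  have Bh: "adj B = B" using B by (simp add: psd_mat_iff)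
  have Ch: "adj C = C"
    using R(1-4) B(1) Bh
    by (simp add: C_def adj_mult[of _ n n _ n] assoc_mult_mat[of _ n n _ n _ n] mult_carrier_mat[of _ n n _ n])
  have qC: "qf C x = qf B (Ri *\<^sub>v x)" if "x \<in> carrier_vec n" for x
    using qf_conj[OF B(1) R(2) that] R(4) by (simp add: C_def)
  have "psd_mat C"
    using B R(2) by (simp add: psd_mat_iff[OF C] psd_mat_iff[OF B(1)] Ch qC mult_mat_vec_carrier[of _ n n])
  from psd_spectral[OF C this] obtain U d where s: "spectral n C U d" and d: "\<And>i. d i \<ge> 0" by blast
  have uU: "unitary_mat n U" using s by (simp add: spectral_def)
  note U = unitary_matD[OF uU]
  \<comment> \<open>Coordinates of \<open>R *\<^sub>v v\<close> in the eigenbasis of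
    \<open>C\<close>. After this change of variables the form of \<open>A\<close> is the squared
    norm and that of \<open>B\<close> is diagonal with entries \<open>d i\<close>.\<close>
  define z where "z = adj U *\<^sub>v (R *\<^sub>v v)"
  have z: "z \<in> carrier_vec n" using U R v by (simp add: z_def mult_mat_vec_carrier[of _ n n])
  define w where "w i = (cmod (z $ i))\<^sup>2" for i
  have Rv: "R *\<^sub>v x \<in> carrier_vec n" if "x \<in> carrier_vec n" for x
    using R that by (simp add: mult_mat_vec_carrier[of _ n n])
  have RiR: "Ri *\<^sub>v (R *\<^sub>v x) = x" if "x \<in> carrier_vec n" for x
    using that R by (simp add: assoc_mult_mat_vec[of Ri n n R n x, symmetric])
  have RRi: "R *\<^sub>v (Ri *\<^sub>v x) = x" if "x \<in> carrier_vec n" for x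
    using that R by (simp add: assoc_mult_mat_vec[of R n n Ri n x, symmetric])
  have qA: "qf A x = nsq (adj U *\<^sub>v (R *\<^sub>v x))" if "x \<in> carrier_vec n" for x
  proof -
    have "qf A x = qf (adj R * 1\<^sub>m n * R) x" using R by simp
    also have "\<dots> = qf (1\<^sub>m n) (R *\<^sub>v x)" by (rule qf_conj) (use R that in auto)
    finally show ?thesis using nsq_unitary(1)[OF uU Rv[OF that]] Rv[OF that] by (simp add: nsq_qf[of "R *\<^sub>v x" n])
  qed
  have qB: "qf B x = (\<Sum>i<n. d i * (cmod ((adj U *\<^sub>v (R *\<^sub>v x)) $ i))\<^sup>2)" if "x \<in> carrier_vec n" for x
    using qC[OF Rv[OF that]] qf_spectral[OF s Rv[OF that]] RiR[OF that] by simp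
  \<comment> \<open>In these coordinates the minimisation over \<open>x\<close> splits into
    \<open>n\<close> independent scalar problems.\<close>
  have min: "qf B x + t * qf A (v - x)
     = (\<Sum>i<n. d i * (cmod ((adj U *\<^sub>v (R *\<^sub>v x)) $ i))\<^sup>2 + t * (cmod (z $ i - (adj U *\<^sub>v (R *\<^sub>v x)) $ i))\<^sup>2)"
    if x: "x \<in> carrier_vec n" for x t
  proof -
    have vx: "v - x \<in> carrier_vec n" using v x by simp
    have c: "adj U *\<^sub>v (R *\<^sub>v x) \<in> carrier_vec n" using U Rv[OF x] by (simp add: mult_mat_vec_carrier[of _ n n])
    have "adj U *\<^sub>v (R *\<^sub>v (v - x)) = z - adj U *\<^sub>v (R *\<^sub>v x)"
      using U R v x Rv by (simp add: z_def mult_minus_distrib_mat_vec[of _ n n])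
    then have "qf A (v - x) = (\<Sum>i<n. (cmod (z $ i - (adj U *\<^sub>v (R *\<^sub>v x)) $ i))\<^sup>2)"
      unfolding qA[OF vx] nsq_def using z c by (auto simp del: index_mult_mat_vec dim_mult_mat_vec intro!: sum.cong)
    then show ?thesis using qB[OF x] by (simp add: sum.distrib sum_distrib_left)
  qed
  show ?thesis
  proof (rule that[of w d])
    show "qf (wgm_pd \<alpha> A B) v = (\<Sum>i<n. w i * d i powr \<alpha>)" for \<alpha>
    proof -
      have "wgm_pd \<alpha> A B = adj R * mat_powr C \<alpha> * R"
        unfolding R(3) unfolding wgm_pd_def R_def Ri_def C_def ..
      then have "qf (wgm_pd \<alpha> A B) v = qf (mat_powr C \<alpha>) (R *\<^sub>v v)"
        using qf_conj[OF spectral_carrier[OF spectral_powr[OF s]] R(1) v] by simp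
      then show ?thesis
        using qf_spectral[OF spectral_powr[OF s] Rv[OF v]] by (simp add: w_def z_def mult.commute)
    qed
    show "w i \<ge> 0" for i by (simp add: w_def)
    show "d i \<ge> 0" for i by (rule d)
    show "qf A v = (\<Sum>i<n. w i)" using qA[OF v] z by (simp add: z_def[symmetric] w_def nsq_def)
    show "qf B v = (\<Sum>i<n. w i * d i)" using qB[OF v] by (simp add: z_def[symmetric] w_def mult.commute)
  next
    fix t :: real and x :: "complex vec" assume t: "t > 0" and x: "x \<in> carrier_vec n"
    show "t * (\<Sum>i<n. w i * (d i / (d i + t))) \<le> qf B x + t * qf A (v - x)"
      unfolding min[OF x] sum_distrib_left
    proof (rule sum_mono)
      fix i assume "i \<in> {..<n}"
      let ?y = "(adj U *\<^sub>v (R *\<^sub>v x)) $ i"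
      have "cmod (z $ i) \<le> cmod ?y + cmod (z $ i - ?y)" by (metis add.commute diff_add_cancel norm_triangle_ineq)
      from parallel_sum_ineq[OF d t norm_ge_zero this, of i]
      show "t * (w i * (d i / (d i + t))) \<le> d i * (cmod ?y)\<^sup>2 + t * (cmod (z $ i - ?y))\<^sup>2"
        by (simp add: w_def mult_ac)
    qed
  next
    fix t :: real assume t: "t > 0"
    \<comment> \<open>The scalar function
      \<open>d * \<bar>y\<bar>^2 + t * \<bar>z - y\<bar>^2\<close> is minimal at
      \<open>y = t / (d + t) * z\<close>; \<open>x\<close> is this vector carried back to the
      original coordinates.\<close>
    define y where "y = vec n (\<lambda>i. complex_of_real (t / (d i + t)) * z $ i)"
    define x where "x = Ri *\<^sub>v (U *\<^sub>v y)"
    have y: "y \<in> carrier_vec n" by (simp add: y_def)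
    have x: "x \<in> carrier_vec n" using R U y by (simp add: x_def mult_mat_vec_carrier[of _ n n])
    have "adj U *\<^sub>v (R *\<^sub>v x) = y"
      using U R y by (simp add: x_def RRi mult_mat_vec_carrier[of _ n n] assoc_mult_mat_vec[of "adj U" n n U n y, symmetric])
    note m = min[OF x, of t, unfolded this]
    have "t * (w i * (d i / (d i + t))) = d i * (cmod (y $ i))\<^sup>2 + t * (cmod (z $ i - y $ i))\<^sup>2" if "i < n" for i
    proof -
      have p: "d i + t > 0" using d[of i] t by simp
      have "z $ i - y $ i = complex_of_real (1 - t / (d i + t)) * z $ i"
        using that by (simp add: y_def algebra_simps)
      also have "1 - t / (d i + t) = d i / (d i + t)" using p by (simp add: field_simps)
      finally have 1: "(cmod (z $ i - y $ i))\<^sup>2 = (d i / (d i + t))\<^sup>2 * w i"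
        by (simp add: norm_mult w_def power_mult_distrib power_divide norm_divide del: of_real_divide of_real_add)
      have 2: "(cmod (y $ i))\<^sup>2 = (t / (d i + t))\<^sup>2 * w i"
        using that by (simp add: y_def norm_mult w_def power_mult_distrib power_divide norm_divide del: of_real_divide of_real_add)
      have "d i * (t / (d i + t))\<^sup>2 + t * (d i / (d i + t))\<^sup>2 = t * (d i / (d i + t))"
      proof -
        have "d i * (t / (d i + t))\<^sup>2 + t * (d i / (d i + t))\<^sup>2 = (t * d i * (d i + t)) / (d i + t)\<^sup>2"
          by (simp add: power_divide power2_eq_square add_divide_distrib algebra_simps)
        then show ?thesis using p by (simp add: power2_eq_square)
      qed
      then have "(d i * (t / (d i + t))\<^sup>2 + t * (d i / (d i + t))\<^sup>2) * w i = t * (d i / (d i + t)) * w i" by simp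
      then show ?thesis unfolding 1 2 by (simp add: algebra_simps)
    qed
    then have "t * (\<Sum>i<n. w i * (d i / (d i + t))) = qf B x + t * qf A (v - x)"
      unfolding m sum_distrib_left by (intro sum.cong) auto
    then show "\<exists>x\<in>carrier_vec n. t * (\<Sum>i<n. w i * (d i / (d i + t))) = qf B x + t * qf A (v - x)"
      using x by blast
  qed
qed

lemma wgm_pd_hermitian:
  assumes A: "A \<in> carrier_mat n n" "pd_mat A" and B: "B \<in> carrier_mat n n" "psd_mat B"
  shows "wgm_pd \<alpha> A B \<in> carrier_mat n n" "adj (wgm_pd \<alpha> A B) = wgm_pd \<alpha> A B"
proof -
  define R where "R = mat_powr A (1/2)"
  define Ri where "Ri = mat_powr A (-1/2)"
  note R = sqrt_pd[OF A, folded R_def Ri_def]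
  define C where "C = Ri * B * Ri"
  have C: "C \<in> carrier_mat n n" using R(2) B(1) by (simp add: C_def mult_carrier_mat[of _ n n _ n])
  have Bh: "adj B = B" using B by (simp add: psd_mat_iff)
  have Ch: "adj C = C"
    using R(1-4) B(1) Bh
    by (simp add: C_def adj_mult[of _ n n _ n] assoc_mult_mat[of _ n n _ n _ n] mult_carrier_mat[of _ n n _ n])
  obtain U d where s: "spectral n C U d" using spectral_exists[OF C Ch] by (auto simp: spectral_def)
  note P = spectral_carrier[OF spectral_powr[OF s]] spectral_adj[OF spectral_powr[OF s]]
  have "wgm_pd \<alpha> A B = R * mat_powr C \<alpha> * R"
    unfolding wgm_pd_def R_def Ri_def C_def ..
  then show "wgm_pd \<alpha> A B \<in> carrier_mat n n" "adj (wgm_pd \<alpha> A B) = wgm_pd \<alpha> A B"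
    using R(1-4) P
    by (simp_all add: adj_mult[of _ n n _ n] assoc_mult_mat[of _ n n _ n _ n] mult_carrier_mat[of _ n n _ n])
qed

text \<open>The minimiser \<open>x\<close> for \<open>(A, B)\<close> is a competitor for the other
  two pairs, which gives the inequality for each \<open>t\<close>, and integration gives it for the
  means. Unnormalised \<open>c1\<close> and \<open>c2\<close> cover joint concavity, monotonicity
  (\<open>c1 = 1\<close>, \<open>c2 = 0\<close>) and scaling at once.\<close>

lemma wgm_pd_concave_mono:
  assumes \<alpha>: "0 < \<alpha>" "\<alpha> < 1"
    and A: "A \<in> carrier_mat n n" "pd_mat A" and B: "B \<in> carrier_mat n n" "psd_mat B"
    and A1: "A1 \<in> carrier_mat n n" "pd_mat A1" and B1: "B1 \<in> carrier_mat n n" "psd_mat B1"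
    and A2: "A2 \<in> carrier_mat n n" "pd_mat A2" and B2: "B2 \<in> carrier_mat n n" "psd_mat B2"
    and c: "c1 \<ge> 0" "c2 \<ge> 0"
    and le: "\<And>x. x \<in> carrier_vec n \<Longrightarrow> c1 * qf A1 x + c2 * qf A2 x \<le> qf A x"
      "\<And>x. x \<in> carrier_vec n \<Longrightarrow> c1 * qf B1 x + c2 * qf B2 x \<le> qf B x"
    and v: "v \<in> carrier_vec n"
  shows "c1 * qf (wgm_pd \<alpha> A1 B1) v + c2 * qf (wgm_pd \<alpha> A2 B2) v \<le> qf (wgm_pd \<alpha> A B) v"
proof -
  obtain w d where 0: "qf (wgm_pd \<alpha> A B) v = (\<Sum>i<n. w i * d i powr \<alpha>)" "\<And>i. d i \<ge> 0"
    "\<And>t. t > 0 \<Longrightarrow> \<exists>x\<in>carrier_vec n. t * (\<Sum>i<n. w i * (d i / (d i + t))) = qf B x + t * qf A (v - x)"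
    by (rule wgm_pd_weights[OF A B v]) blast
  obtain w1 d1 where 1: "qf (wgm_pd \<alpha> A1 B1) v = (\<Sum>i<n. w1 i * d1 i powr \<alpha>)" "\<And>i. d1 i \<ge> 0"
    "\<And>t x. t > 0 \<Longrightarrow> x \<in> carrier_vec n \<Longrightarrow> t * (\<Sum>i<n. w1 i * (d1 i / (d1 i + t))) \<le> qf B1 x + t * qf A1 (v - x)"
    by (rule wgm_pd_weights[OF A1 B1 v]) blast
  obtain w2 d2 where 2: "qf (wgm_pd \<alpha> A2 B2) v = (\<Sum>i<n. w2 i * d2 i powr \<alpha>)" "\<And>i. d2 i \<ge> 0"
    "\<And>t x. t > 0 \<Longrightarrow> x \<in> carrier_vec n \<Longrightarrow> t * (\<Sum>i<n. w2 i * (d2 i / (d2 i + t))) \<le> qf B2 x + t * qf A2 (v - x)"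
    by (rule wgm_pd_weights[OF A2 B2 v]) blast
  \<comment> \<open>The three spectral sums are glued over a disjoint union, two of them with
    negative sign, so that the claim becomes nonnegativity of a single weighted sum of
    powers.\<close>
  define I where "I = {..<n} <+> ({..<n} <+> {..<n})"
  define W where "W = case_sum w (case_sum (\<lambda>i. - c1 * w1 i) (\<lambda>i. - c2 * w2 i))"
  define D where "D = case_sum d (case_sum d1 d2)"
  have sumI: "(\<Sum>k\<in>I. W k * f (D k)) =
    (\<Sum>i<n. w i * f (d i)) - c1 * (\<Sum>i<n. w1 i * f (d1 i)) - c2 * (\<Sum>i<n. w2 i * f (d2 i))" for f :: "real \<Rightarrow> real"
    by (simp add: I_def sum.Plus W_def D_def sum_distrib_left sum_negf mult.assoc)
  have "(\<Sum>k\<in>I. W k * D k powr \<alpha>) \<ge> 0"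
  proof (rule sum_powr_nonneg[OF \<alpha>])
    show "D k \<ge> 0" for k using 0(2) 1(2) 2(2) by (auto simp: D_def split: sum.splits)
    fix t :: real assume t: "t > 0"
    from 0(3)[OF t] obtain x where x: "x \<in> carrier_vec n"
      and eq: "t * (\<Sum>i<n. w i * (d i / (d i + t))) = qf B x + t * qf A (v - x)" by blast
    have "c1 * (t * (\<Sum>i<n. w1 i * (d1 i / (d1 i + t)))) + c2 * (t * (\<Sum>i<n. w2 i * (d2 i / (d2 i + t))))
      \<le> c1 * (qf B1 x + t * qf A1 (v - x)) + c2 * (qf B2 x + t * qf A2 (v - x))"
      by (intro add_mono mult_left_mono 1(3) 2(3) t x c)
    also have "\<dots> = (c1 * qf B1 x + c2 * qf B2 x) + t * (c1 * qf A1 (v - x) + c2 * qf A2 (v - x))"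
      by (simp add: algebra_simps)
    also have "\<dots> \<le> qf B x + t * qf A (v - x)"
      using t v x by (intro add_mono mult_left_mono le) auto
    finally have "0 \<le> t * (\<Sum>k\<in>I. W k * (D k / (D k + t)))"
      unfolding sumI[of "\<lambda>d. d / (d + t)"] eq[symmetric] by (simp add: algebra_simps)
    then show "0 \<le> (\<Sum>k\<in>I. W k * (D k / (D k + t)))" using t by (simp add: zero_le_mult_iff)
  qed (simp add: I_def)
  then show ?thesis unfolding sumI[of "\<lambda>d. d powr \<alpha>"] 0(1) 1(1) 2(1) by simp
qed

section \<open>Concavity of powers and comparison with the arithmetic mean\<close>

lemma one_pd: "pd_mat (1\<^sub>m n)"
  by (rule pdI_lower[of _ n 1]) (auto simp: nsq_qf)

lemma wgm_pd_one:
  assumes "B \<in> carrier_mat n n" "psd_mat B"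
  shows "wgm_pd \<alpha> (1\<^sub>m n) B = mat_powr B \<alpha>"
  using assms mat_powr_psd(1)[OF assms] by (simp add: wgm_pd_def mat_powr_one right_mult_one_mat[of _ n n] left_mult_one_mat[of _ n n])

text \<open>The mean of 1 and \<open>B\<close> with weight \<open>r\<close> is
  \<open>mat_powr B r\<close>, so this is the result on means with all first arguments equal to 1;
  \<open>c1 + c2 \<le> 1\<close> is its hypothesis on those arguments. The exponent 1 lies outside
  the range of the integral representation and is handled directly.\<close>

lemma mat_powr_concave_mono:
  assumes r: "0 < r" "r \<le> 1"
    and B: "B \<in> carrier_mat n n" "psd_mat B"
    and B1: "B1 \<in> carrier_mat n n" "psd_mat B1" and B2: "B2 \<in> carrier_mat n n" "psd_mat B2"
    and c: "c1 \<ge> 0" "c2 \<ge> 0" "c1 + c2 \<le> 1"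
    and le: "\<And>x. x \<in> carrier_vec n \<Longrightarrow> c1 * qf B1 x + c2 * qf B2 x \<le> qf B x"
    and v: "v \<in> carrier_vec n"
  shows "c1 * qf (mat_powr B1 r) v + c2 * qf (mat_powr B2 r) v \<le> qf (mat_powr B r) v"
proof (cases "r = 1")
  case True
  then show ?thesis using le[OF v] B B1 B2 by (simp add: mat_powr_1)
next
  case False
  have "c1 * qf (1\<^sub>m n) x + c2 * qf (1\<^sub>m n) x \<le> qf (1\<^sub>m n) x" if "x \<in> carrier_vec n" for x
    using mult_right_mono[OF c(3), of "nsq x"] that by (simp add: nsq_qf[symmetric] distrib_right)
  from wgm_pd_concave_mono[OF r(1) _ one_carrier_mat one_pd B one_carrier_mat one_pd B1 one_carrier_mat one_pd B2 c(1,2) this le v]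
  show ?thesis using False r B B1 B2 by (simp add: wgm_pd_one)
qed

text \<open>Both bounds hold term by term in the spectral weights; the upper one is the scalar Young
  inequality for \<open>d i\<close> and 1.\<close>

lemma wgm_pd_le_arith:
  assumes \<alpha>: "0 < \<alpha>" "\<alpha> < 1" and A: "A \<in> carrier_mat n n" "pd_mat A" and B: "B \<in> carrier_mat n n" "psd_mat B"
    and v: "v \<in> carrier_vec n"
  shows "0 \<le> qf (wgm_pd \<alpha> A B) v" "qf (wgm_pd \<alpha> A B) v \<le> (1 - \<alpha>) * qf A v + \<alpha> * qf B v"
proof -
  obtain w d where 0: "qf (wgm_pd \<alpha> A B) v = (\<Sum>i<n. w i * d i powr \<alpha>)" "\<And>i. w i \<ge> 0" "\<And>i. d i \<ge> 0"
    "qf A v = (\<Sum>i<n. w i)" "qf B v = (\<Sum>i<n. w i * d i)"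
    by (rule wgm_pd_weights[OF A B v]) blast
  show "0 \<le> qf (wgm_pd \<alpha> A B) v" unfolding 0(1) by (intro sum_nonneg mult_nonneg_nonneg 0) auto
  have young: "d i powr \<alpha> \<le> (1 - \<alpha>) + \<alpha> * d i" for i
  proof (cases "d i = 0")
    case False
    then show ?thesis
      using Youngs_inequality_0[of \<alpha> "1 - \<alpha>" "d i" 1] \<alpha> 0(3)[of i] by simp
  qed (use \<alpha> in simp)
  have "(\<Sum>i<n. w i * d i powr \<alpha>) \<le> (\<Sum>i<n. w i * ((1 - \<alpha>) + \<alpha> * d i))"
    by (intro sum_mono mult_left_mono young 0)
  also have "\<dots> = (1 - \<alpha>) * qf A v + \<alpha> * qf B v"
    unfolding 0 by (simp add: sum_distrib_left sum.distrib algebra_simps sum_subtractf)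
  finally show "qf (wgm_pd \<alpha> A B) v \<le> (1 - \<alpha>) * qf A v + \<alpha> * qf B v" unfolding 0(1) .
qed

section \<open>The mean of semidefinite matrices as a limit\<close>

abbreviation shift :: "nat \<Rightarrow> real \<Rightarrow> complex mat \<Rightarrow> complex mat" where
  "shift n \<epsilon> A \<equiv> A + complex_of_real \<epsilon> \<cdot>\<^sub>m 1\<^sub>m n"

lemma qf_shift:
  "A \<in> carrier_mat n n \<Longrightarrow> v \<in> carrier_vec n \<Longrightarrow> qf (shift n \<epsilon> A) v = qf A v + \<epsilon> * nsq v"
  by (simp add: qf_add[of _ n] qf_smult[of _ n] nsq_qf)

lemma shift_hermitian:
  assumes "A \<in> carrier_mat n n" "adj A = A"
  shows "shift n \<epsilon> A \<in> carrier_mat n n" "adj (shift n \<epsilon> A) = shift n \<epsilon> A"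
  using assms by (simp_all add: adj_add[of _ n n] adj_smult)

lemma shift_pd:
  assumes A: "A \<in> carrier_mat n n" "psd_mat A" and "\<epsilon> > 0"
  shows "pd_mat (shift n \<epsilon> A)"
proof (rule pdI_lower)
  show "\<epsilon> * nsq v \<le> qf (shift n \<epsilon> A) v" if "v \<in> carrier_vec n" for v
    using A that by (simp add: qf_shift psd_mat_iff)
qed (use assms shift_hermitian[of A n] in \<open>auto simp: psd_mat_iff\<close>)

lemma qf_entries:
  assumes "A \<in> carrier_mat n n" "v \<in> carrier_vec n"
  shows "qf A v = Re (\<Sum>i<n. cnj (v $ i) * (\<Sum>j<n. A $$ (i, j) * v $ j))"
  using assms by (simp add: qf_def inner_c_sum[of _ n] scalar_prod_def lessThan_atLeast0)

text \<open>The forms of the shifted means decrease with \<epsilon> and are bounded below by 0, so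
  they converge at every vector. Polarisation turns this into convergence of the entries, so that
  the definite description in \<open>wgm\<close> denotes.\<close>

lemma wgm_limit:
  assumes \<alpha>: "0 < \<alpha>" "\<alpha> < 1"
    and A: "A \<in> carrier_mat n n" "psd_mat A" and B: "B \<in> carrier_mat n n" "psd_mat B"
  shows "wgm \<alpha> A B \<in> carrier_mat n n" "adj (wgm \<alpha> A B) = wgm \<alpha> A B"
    "\<And>v. v \<in> carrier_vec n \<Longrightarrow>
      ((\<lambda>\<epsilon>. qf (wgm_pd \<alpha> (shift n \<epsilon> A) (shift n \<epsilon> B)) v) \<longlongrightarrow> qf (wgm \<alpha> A B) v) (at_right 0)"
proof -
  define W where "W \<epsilon> = wgm_pd \<alpha> (shift n \<epsilon> A) (shift n \<epsilon> B)" for \<epsilon>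
  have hA: "adj A = A" and hB: "adj B = B" using A B by (auto simp: psd_mat_iff)
  note sA = shift_hermitian[OF A(1) hA] and sB = shift_hermitian[OF B(1) hB]
  have W: "W \<epsilon> \<in> carrier_mat n n" "adj (W \<epsilon>) = W \<epsilon>" if "\<epsilon> > 0" for \<epsilon>
    unfolding W_def
    by (rule wgm_pd_hermitian[OF sA(1) shift_pd[OF A that] sB(1) pd_imp_psd[OF shift_pd[OF B that]]])+
  have "\<exists>L. ((\<lambda>\<epsilon>. qf (W \<epsilon>) v) \<longlongrightarrow> L) (at_right 0)" if v: "v \<in> carrier_vec n" for v
  proof -
    have "((\<lambda>\<epsilon>. qf (W \<epsilon>) v) \<longlongrightarrow> Inf ((\<lambda>\<epsilon>. qf (W \<epsilon>) v) ` ({0<..} \<inter> UNIV))) (at 0 within ({0<..} \<inter> UNIV))"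
    proof (rule Lim_right_bound[where K = 0])
      fix a b :: real assume ab: "0 < a" "a \<le> b"
      then have b: "0 < b" by simp
      note pA = shift_pd[OF A ab(1)] and pB = pd_imp_psd[OF shift_pd[OF B ab(1)]]
      \<comment> \<open>Monotonicity is the case of coefficients 1 and 0; the second pair merely
        repeats the first.\<close>
      have "1 * qf (W a) v + 0 * qf (W a) v \<le> qf (W b) v"
        unfolding W_def
        by (rule wgm_pd_concave_mono[OF \<alpha> sA(1) shift_pd[OF A b] sB(1) pd_imp_psd[OF shift_pd[OF B b]]
              sA(1) pA sB(1) pB sA(1) pA sB(1) pB _ _ _ _ v])
          (use ab in \<open>auto simp: qf_shift[OF A(1)] qf_shift[OF B(1)] intro!: mult_right_mono\<close>)
      then show "qf (W a) v \<le> qf (W b) v" by simp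
    next
      fix a :: real assume a: "0 < a"
      show "0 \<le> qf (W a) v"
        unfolding W_def
        by (rule wgm_pd_le_arith(1)[OF \<alpha> sA(1) shift_pd[OF A a] sB(1) pd_imp_psd[OF shift_pd[OF B a]] v])
    qed
    then show ?thesis by auto
  qed
  then obtain L where L: "\<And>v. v \<in> carrier_vec n \<Longrightarrow> ((\<lambda>\<epsilon>. qf (W \<epsilon>) v) \<longlongrightarrow> L v) (at_right 0)"
    by metis
  \<comment> \<open>The limit of \<open>Re (c * W \<epsilon> $$ (i, j))\<close> that polarisation
    predicts.\<close>
  define H where "H c i j = (L (unit_vec n i + c \<cdot>\<^sub>v unit_vec n j) - L (unit_vec n i) - L (c \<cdot>\<^sub>v unit_vec n j)) / 2"
    for c :: complex and i j
  define M where "M = mat n n (\<lambda>(i, j). Complex (H 1 i j) (H (- \<i>) i j))"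
  have Mlim: "((\<lambda>\<epsilon>. W \<epsilon> $$ (i, j)) \<longlongrightarrow> M $$ (i, j)) (at_right 0)" if ij: "i < n" "j < n" for i j
  proof -
    have "((\<lambda>\<epsilon>. Re (c * W \<epsilon> $$ (i, j))) \<longlongrightarrow> H c i j) (at_right 0)" for c
    proof (rule Lim_transform_eventually)
      show "((\<lambda>\<epsilon>. (qf (W \<epsilon>) (unit_vec n i + c \<cdot>\<^sub>v unit_vec n j) - qf (W \<epsilon>) (unit_vec n i)
          - qf (W \<epsilon>) (c \<cdot>\<^sub>v unit_vec n j)) / 2) \<longlongrightarrow> H c i j) (at_right 0)"
        unfolding H_def by (intro tendsto_intros L) auto
      show "\<forall>\<^sub>F \<epsilon> in at_right 0. (qf (W \<epsilon>) (unit_vec n i + c \<cdot>\<^sub>v unit_vec n j) - qf (W \<epsilon>) (unit_vec n i)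
          - qf (W \<epsilon>) (c \<cdot>\<^sub>v unit_vec n j)) / 2 = Re (c * W \<epsilon> $$ (i, j))"
        using eventually_at_right_less[of "0::real"] by eventually_elim (simp only: Re_entry[OF W ij])
    qed
    from tendsto_Complex[OF this[of 1] this[of "- \<i>"]] show ?thesis
      using ij by (simp add: M_def)
  qed
  have dA: "dim_row A = n" using A by simp
  have wgm_M: "wgm \<alpha> A B = M"
    unfolding wgm_def dA
  proof (rule the_equality)
    show "M \<in> carrier_mat n n \<and> (\<forall>i<n. \<forall>j<n. ((\<lambda>\<epsilon>. wgm_pd \<alpha> (shift n \<epsilon> A) (shift n \<epsilon> B) $$ (i, j)) \<longlongrightarrow> M $$ (i, j)) (at_right 0))"
      using Mlim by (simp add: M_def W_def)
    fix M' assume M': "M' \<in> carrier_mat n n \<and> (\<forall>i<n. \<forall>j<n. ((\<lambda>\<epsilon>. wgm_pd \<alpha> (shift n \<epsilon> A) (shift n \<epsilon> B) $$ (i, j)) \<longlongrightarrow> M' $$ (i, j)) (at_right 0))"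
    show "M' = M"
    proof (rule eq_matI)
      fix i j assume "i < dim_row M" "j < dim_col M"
      then have ij: "i < n" "j < n" by (auto simp: M_def)
      then show "M' $$ (i, j) = M $$ (i, j)"
        using M' tendsto_unique[OF _ _ Mlim[OF ij, unfolded W_def]] by simp
    qed (use M' in \<open>auto simp: M_def\<close>)
  qed
  have M: "M \<in> carrier_mat n n" by (simp add: M_def)
  then show "wgm \<alpha> A B \<in> carrier_mat n n" by (simp add: wgm_M)
  have "cnj (M $$ (j, i)) = M $$ (i, j)" if ij: "i < n" "j < n" for i j
  proof (rule tendsto_unique)
    show "((\<lambda>\<epsilon>. W \<epsilon> $$ (i, j)) \<longlongrightarrow> M $$ (i, j)) (at_right 0)" by (rule Mlim[OF ij])
    show "((\<lambda>\<epsilon>. W \<epsilon> $$ (i, j)) \<longlongrightarrow> cnj (M $$ (j, i))) (at_right 0)"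
    proof (rule Lim_transform_eventually[OF tendsto_cnj[OF Mlim[OF ij(2,1)]]])
      show "\<forall>\<^sub>F \<epsilon> in at_right 0. cnj (W \<epsilon> $$ (j, i)) = W \<epsilon> $$ (i, j)"
        using eventually_at_right_less[of "0::real"]
      proof eventually_elim
        case (elim \<epsilon>)
        show ?case using adj_index[of i "W \<epsilon>" j] W[OF elim] ij by simp
      qed
    qed
  qed simp
  then have "adj M = M" using M by (intro eq_matI) auto
  then show "adj (wgm \<alpha> A B) = wgm \<alpha> A B" by (simp add: wgm_M)
  fix v :: "complex vec" assume v: "v \<in> carrier_vec n"
  show "((\<lambda>\<epsilon>. qf (wgm_pd \<alpha> (shift n \<epsilon> A) (shift n \<epsilon> B)) v) \<longlongrightarrow> qf (wgm \<alpha> A B) v) (at_right 0)"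
    unfolding wgm_M W_def[symmetric]
  proof (rule Lim_transform_eventually)
    show "((\<lambda>\<epsilon>. Re (\<Sum>i<n. cnj (v $ i) * (\<Sum>j<n. W \<epsilon> $$ (i, j) * v $ j))) \<longlongrightarrow> qf M v) (at_right 0)"
      unfolding qf_entries[OF M v] by (intro tendsto_intros Mlim) auto
    show "\<forall>\<^sub>F \<epsilon> in at_right 0. Re (\<Sum>i<n. cnj (v $ i) * (\<Sum>j<n. W \<epsilon> $$ (i, j) * v $ j)) = qf (W \<epsilon>) v"
      using eventually_at_right_less[of "0::real"] by eventually_elim (simp only: qf_entries[OF W(1) v])
  qed
qed

lemma wgm_le_arith:
  assumes \<alpha>: "0 < \<alpha>" "\<alpha> < 1"
    and A: "A \<in> carrier_mat n n" "psd_mat A" and B: "B \<in> carrier_mat n n" "psd_mat B"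
    and v: "v \<in> carrier_vec n"
  shows "0 \<le> qf (wgm \<alpha> A B) v" "qf (wgm \<alpha> A B) v \<le> (1 - \<alpha>) * qf A v + \<alpha> * qf B v"
proof -
  note lim = wgm_limit(3)[OF \<alpha> A B v]
  have hA: "adj A = A" and hB: "adj B = B" using A B by (auto simp: psd_mat_iff)
  have *: "0 \<le> qf (wgm_pd \<alpha> (shift n \<epsilon> A) (shift n \<epsilon> B)) v \<and> qf (wgm_pd \<alpha> (shift n \<epsilon> A) (shift n \<epsilon> B)) v
      \<le> (1 - \<alpha>) * (qf A v + \<epsilon> * nsq v) + \<alpha> * (qf B v + \<epsilon> * nsq v)" if "\<epsilon> > 0" for \<epsilon>
    using wgm_pd_le_arith[OF \<alpha> shift_hermitian(1)[OF A(1) hA] shift_pd[OF A that] shift_hermitian(1)[OF B(1) hB]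
        pd_imp_psd[OF shift_pd[OF B that]] v]
    by (simp add: qf_shift[OF A(1) v] qf_shift[OF B(1) v])
  show "0 \<le> qf (wgm \<alpha> A B) v"
    by (rule tendsto_lowerbound[OF lim])
      (use * in \<open>auto intro!: eventually_mono[OF eventually_at_right_less[of "0::real"]]\<close>)
  have "((\<lambda>\<epsilon>. (1 - \<alpha>) * (qf A v + \<epsilon> * nsq v) + \<alpha> * (qf B v + \<epsilon> * nsq v)) \<longlongrightarrow>
      (1 - \<alpha>) * (qf A v + 0 * nsq v) + \<alpha> * (qf B v + 0 * nsq v)) (at_right 0)"
    by (intro tendsto_intros)
  from tendsto_le[OF _ this lim] show "qf (wgm \<alpha> A B) v \<le> (1 - \<alpha>) * qf A v + \<alpha> * qf B v"
    using * by (auto intro!: eventually_mono[OF eventually_at_right_less[of "0::real"]])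
qed

lemma wgm_psd:
  assumes "0 < \<alpha>" "\<alpha> < 1"
    and "A \<in> carrier_mat n n" "psd_mat A" and "B \<in> carrier_mat n n" "psd_mat B"
  shows "psd_mat (wgm \<alpha> A B)"
  using wgm_limit(1,2)[OF assms] wgm_le_arith(1)[OF assms] by (simp add: psd_mat_iff)

lemma qf_eqI:
  assumes A: "A \<in> carrier_mat n n" "adj A = A" and B: "B \<in> carrier_mat n n" "adj B = B"
    and eq: "\<And>v. v \<in> carrier_vec n \<Longrightarrow> qf A v = qf B v"
  shows "A = B"
proof (rule eq_matI)
  fix i j assume "i < dim_row B" "j < dim_col B"
  then have ij: "i < n" "j < n" using B by auto
  have "Re (c * A $$ (i, j)) = Re (c * B $$ (i, j))" for c
    unfolding Re_entry[OF A ij] Re_entry[OF B ij] by (simp add: eq)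
  from this[of 1] this[of "- \<i>"] show "A $$ (i, j) = B $$ (i, j)" by (simp add: complex_eq_iff)
qed (use A B in auto)

text \<open>A sandwich replaces continuity of the functional calculus: if \<open>l\<close> bounds
  \<open>A\<close> and \<open>B\<close> from below, shifting by \<epsilon> enlarges each by at most
  the factor \<open>1 + \<epsilon> / l\<close>, and then the mean grows by at most that
  factor.\<close>

lemma wgm_eq_wgm_pd:
  assumes \<alpha>: "0 < \<alpha>" "\<alpha> < 1"
    and A: "A \<in> carrier_mat n n" "pd_mat A" and B: "B \<in> carrier_mat n n" "pd_mat B"
  shows "wgm \<alpha> A B = wgm_pd \<alpha> A B"
proof (rule qf_eqI)
  note pA = pd_imp_psd[OF A(2)] and pB = pd_imp_psd[OF B(2)]
  show "wgm \<alpha> A B \<in> carrier_mat n n" "adj (wgm \<alpha> A B) = wgm \<alpha> A B"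
    using wgm_limit[OF \<alpha> A(1) pA B(1) pB] by auto
  show "wgm_pd \<alpha> A B \<in> carrier_mat n n" "adj (wgm_pd \<alpha> A B) = wgm_pd \<alpha> A B"
    using wgm_pd_hermitian[OF A B(1) pB] by auto
  fix v :: "complex vec" assume v: "v \<in> carrier_vec n"
  have hA: "adj A = A" and hB: "adj B = B" using A B by (auto simp: pd_mat_iff)
  note sA = shift_hermitian(1)[OF A(1) hA] and sB = shift_hermitian(1)[OF B(1) hB]
  obtain l1 where l1: "l1 > 0" "\<And>v. v \<in> carrier_vec n \<Longrightarrow> l1 * nsq v \<le> qf A v" using pd_lower[OF A] by blast
  obtain l2 where l2: "l2 > 0" "\<And>v. v \<in> carrier_vec n \<Longrightarrow> l2 * nsq v \<le> qf B v" using pd_lower[OF B] by blast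
  define l where "l = min l1 l2"
  have l: "l > 0" using l1 l2 by (simp add: l_def)
  have lA: "l * nsq x \<le> qf A x" and lB: "l * nsq x \<le> qf B x" if "x \<in> carrier_vec n" for x
    using l1(2)[OF that] l2(2)[OF that] mult_right_mono[of l l1 "nsq x"] mult_right_mono[of l l2 "nsq x"]
    by (auto simp: l_def)
  let ?q = "\<lambda>\<epsilon>. qf (wgm_pd \<alpha> (shift n \<epsilon> A) (shift n \<epsilon> B)) v"
  have bounds: "qf (wgm_pd \<alpha> A B) v \<le> ?q \<epsilon> \<and> ?q \<epsilon> \<le> (1 + \<epsilon> / l) * qf (wgm_pd \<alpha> A B) v" if e: "\<epsilon> > 0" for \<epsilon>
  proof
    note pAe = shift_pd[OF A(1) pA e] and pBe = pd_imp_psd[OF shift_pd[OF B(1) pB e]]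
    have "1 * qf (wgm_pd \<alpha> A B) v + 0 * qf (wgm_pd \<alpha> A B) v \<le> ?q \<epsilon>"
      by (rule wgm_pd_concave_mono[OF \<alpha> sA pAe sB pBe A B(1) pB A B(1) pB _ _ _ _ v])
        (use e in \<open>auto simp: qf_shift[OF A(1)] qf_shift[OF B(1)]\<close>)
    then show "qf (wgm_pd \<alpha> A B) v \<le> ?q \<epsilon>" by simp
    have p: "1 + \<epsilon> / l > 0" using e l by (simp add: add_pos_pos)
    have scale: "1 / (1 + \<epsilon> / l) * (x + \<epsilon> * y) \<le> x" if "l * y \<le> x" for x y
    proof -
      have "x + \<epsilon> * y \<le> (1 + \<epsilon> / l) * x"
        using mult_left_mono[OF that, of "\<epsilon> / l"] e l by (simp add: distrib_right)
      then show ?thesis using p by (simp add: divide_le_eq mult.commute)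
    qed
    have "1 / (1 + \<epsilon> / l) * ?q \<epsilon> + 0 * ?q \<epsilon> \<le> qf (wgm_pd \<alpha> A B) v"
      by (rule wgm_pd_concave_mono[OF \<alpha> A B(1) pB sA pAe sB pBe sA pAe sB pBe _ _ _ _ v])
        (use p scale[OF lA] scale[OF lB] in \<open>auto simp: qf_shift[OF A(1)] qf_shift[OF B(1)]\<close>)
    then show "?q \<epsilon> \<le> (1 + \<epsilon> / l) * qf (wgm_pd \<alpha> A B) v"
      using p by (simp add: divide_le_eq mult.commute)
  qed
  have "((\<lambda>\<epsilon>. (1 + \<epsilon> / l) * qf (wgm_pd \<alpha> A B) v) \<longlongrightarrow> (1 + 0 / l) * qf (wgm_pd \<alpha> A B) v) (at_right 0)"
    using l by (intro tendsto_intros) auto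
  then have "(?q \<longlongrightarrow> qf (wgm_pd \<alpha> A B) v) (at_right 0)"
    by (intro tendsto_sandwich[of "\<lambda>_. qf (wgm_pd \<alpha> A B) v" ?q "at_right 0" "\<lambda>\<epsilon>. (1 + \<epsilon> / l) * qf (wgm_pd \<alpha> A B) v"])
      (use bounds in \<open>auto intro!: eventually_mono[OF eventually_at_right_less[of "0::real"]]\<close>)
  then show "qf (wgm \<alpha> A B) v = qf (wgm_pd \<alpha> A B) v"
    using tendsto_unique[OF _ wgm_limit(3)[OF \<alpha> A(1) pA B(1) pB v]] by simp
qed

section \<open>Sufficiency of the condition on the exponents\<close>

lemma arith_psd:
  assumes \<alpha>: "0 < \<alpha>" "\<alpha> < 1"
    and A: "A \<in> carrier_mat n n" "psd_mat A" and B: "B \<in> carrier_mat n n" "psd_mat B"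
  defines "N \<equiv> complex_of_real (1 - \<alpha>) \<cdot>\<^sub>m A + complex_of_real \<alpha> \<cdot>\<^sub>m B"
  shows "N \<in> carrier_mat n n" "psd_mat N"
    "\<And>v. v \<in> carrier_vec n \<Longrightarrow> qf N v = (1 - \<alpha>) * qf A v + \<alpha> * qf B v"
proof -
  show N: "N \<in> carrier_mat n n" using A B by (simp add: N_def)
  show q: "qf N v = (1 - \<alpha>) * qf A v + \<alpha> * qf B v" if "v \<in> carrier_vec n" for v
    unfolding N_def using A B that by (simp add: qf_add[of _ n] qf_smult[of _ n] del: of_real_diff)
  have "adj N = N"
    using A B by (simp add: N_def adj_add[of _ n n] adj_smult psd_mat_iff)
  then show "psd_mat N" using A B \<alpha> by (simp add: psd_mat_iff[OF N] q psd_mat_iff[OF A(1)] psd_mat_iff[OF B(1)])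
qed

text \<open>The two conditions enter separately: \<open>p \<le> q\<close> makes the power
  \<open>p / q\<close> concave, \<open>1 \<le> p\<close> makes the power \<open>1 / p\<close>
  monotone. Writing the arithmetic mean as \<open>mat_powr K (1 / p)\<close> with
  \<open>K = mat_powr N (p / q)\<close> isolates the two uses.\<close>

lemma G_mean_le_A_mean:
  assumes \<alpha>: "0 < \<alpha>" "\<alpha> < 1" and p: "1 \<le> p" "p \<le> q"
    and A: "A \<in> carrier_mat n n" "psd_mat A" and B: "B \<in> carrier_mat n n" "psd_mat B"
  shows "loewner_le (G_mean \<alpha> p A B) (A_mean \<alpha> q A B)"
proof -
  note Ap = mat_powr_psd[OF A, of p] and Bp = mat_powr_psd[OF B, of p]
  note Aq = mat_powr_psd[OF A, of q] and Bq = mat_powr_psd[OF B, of q]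
  define M where "M = wgm \<alpha> (mat_powr A p) (mat_powr B p)"
  note M = wgm_limit(1)[OF \<alpha> Ap Bp, folded M_def] wgm_psd[OF \<alpha> Ap Bp, folded M_def]
  define N where "N = complex_of_real (1 - \<alpha>) \<cdot>\<^sub>m mat_powr A q + complex_of_real \<alpha> \<cdot>\<^sub>m mat_powr B q"
  note N = arith_psd[OF \<alpha> Aq Bq, folded N_def]
  define K where "K = mat_powr N (p / q)"
  note K = mat_powr_psd[OF N(1,2), of "p / q", folded K_def]
  have qq: "q * (p / q) = p" using p by simp
  have MK: "qf M v \<le> qf K v" if v: "v \<in> carrier_vec n" for v
  proof -
    have "qf M v \<le> (1 - \<alpha>) * qf (mat_powr A p) v + \<alpha> * qf (mat_powr B p) v"
      unfolding M_def by (rule wgm_le_arith(2)[OF \<alpha> Ap Bp v])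
    also have "\<dots> = (1 - \<alpha>) * qf (mat_powr (mat_powr A q) (p / q)) v + \<alpha> * qf (mat_powr (mat_powr B q) (p / q)) v"
      by (simp only: mat_powr_powr[OF A] mat_powr_powr[OF B] qq)
    also have "\<dots> \<le> qf K v"
      unfolding K_def
      by (rule mat_powr_concave_mono[OF _ _ N(1,2) Aq Bq _ _ _ _ v]) (use p \<alpha> N(3) in auto)
    finally show ?thesis .
  qed
  have G: "G_mean \<alpha> p A B = mat_powr M (1 / p)" by (simp add: G_mean_def M_def)
  have "p / q * (1 / p) = 1 / q" using p by simp
  then have Am: "A_mean \<alpha> q A B = mat_powr K (1 / p)"
    unfolding A_mean_def K_def mat_powr_powr[OF N(1,2)] unfolding N_def by (simp only:)
  have "1 * qf (mat_powr M (1 / p)) v + 0 * qf (mat_powr M (1 / p)) v \<le> qf (mat_powr K (1 / p)) v"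
    if v: "v \<in> carrier_vec n" for v
    by (rule mat_powr_concave_mono[OF _ _ K M M _ _ _ _ v]) (use p MK in auto)
  then show ?thesis
    unfolding G Am using mat_powr_psd[OF M, of "1 / p"] mat_powr_psd[OF K, of "1 / p"]
    by (subst loewner_le_iff[of _ n]) (auto simp: psd_mat_iff)
qed

section \<open>Real symmetric two-by-two matrices\<close>

definition sym2 :: "real \<Rightarrow> real \<Rightarrow> real \<Rightarrow> complex mat" where
  "sym2 x y z = mat 2 2 (\<lambda>(i, j). complex_of_real (if i = j then (if i = 0 then x else z) else y))"

lemma sym2_carrier [simp]: "sym2 x y z \<in> carrier_mat 2 2"
  by (simp add: sym2_def)

lemma sym2_dim [simp]: "dim_row (sym2 x y z) = 2" "dim_col (sym2 x y z) = 2"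
  by (simp_all add: sym2_def)

lemma adj_sym2 [simp]: "adj (sym2 x y z) = sym2 x y z"
  by (intro eq_matI) (auto simp: sym2_def)

lemma sym2_lin:
  "complex_of_real a \<cdot>\<^sub>m sym2 x y z + complex_of_real b \<cdot>\<^sub>m sym2 x' y' z' =
    sym2 (a * x + b * x') (a * y + b * y') (a * z + b * z')"
  by (intro eq_matI) (auto simp: sym2_def)

lemma sym2_one: "sym2 1 0 1 = 1\<^sub>m 2"
  by (intro eq_matI) (auto simp: sym2_def)

lemma det_sym2: "det (sym2 x y z) = complex_of_real (x * z - y\<^sup>2)"
  by (subst laplace_expansion_column[of _ 2 0])
    (auto simp: cofactor_def det_single sym2_def mat_delete_def numeral_2_eq_2 power2_eq_square)

lemma qf_sym2:
  assumes "v \<in> carrier_vec 2"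
  shows "qf (sym2 x y z) v = x * (cmod (v $ 0))\<^sup>2 + z * (cmod (v $ 1))\<^sup>2 + 2 * y * Re (cnj (v $ 0) * v $ 1)"
  using assms by (simp add: qf_entries[of _ 2] sym2_def numeral_2_eq_2 cmod_def power2_eq_square algebra_simps)

lemma sym2_psd_det:
  assumes "psd_mat (sym2 x y z)"
  shows "x \<ge> 0" "z \<ge> 0" "y\<^sup>2 \<le> x * z"
proof -
  have q: "0 \<le> x * a\<^sup>2 + z * b\<^sup>2 + 2 * y * (a * b)" for a b :: real
  proof -
    define v where "v = vec 2 (\<lambda>i. complex_of_real (if i = 0 then a else b))"
    have v: "v \<in> carrier_vec 2" by (simp add: v_def)
    have "0 \<le> qf (sym2 x y z) v" using assms v by (simp add: psd_mat_iff[of _ 2])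
    then show ?thesis
      using qf_sym2[OF v, of x y z] by (simp add: v_def)
  qed
  show x: "x \<ge> 0" using q[of 1 0] by simp
  show z: "z \<ge> 0" using q[of 0 1] by simp
  show "y\<^sup>2 \<le> x * z"
  proof (cases "z = 0")
    case False
    \<comment> \<open>The vector \<open>(z, -y)\<close> gives \<open>z\<close> times the
      determinant. For \<open>z = 0\<close> that is vacuous, and \<open>(y, -(x + 1))\<close> forces
      \<open>y = 0\<close> instead.\<close>
    have "0 \<le> x * z\<^sup>2 + z * y\<^sup>2 + 2 * y * (z * - y)" using q[of z "- y"] by simp
    also have "\<dots> = z * (x * z - y\<^sup>2)" by (simp add: power2_eq_square algebra_simps)
    finally show ?thesis using z False by (simp add: zero_le_mult_iff)
  next
    case True
    have "0 \<le> x * y\<^sup>2 + 2 * y * (y * - (x + 1))" using q[of y "- (x + 1)"] True by simp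
    also have "\<dots> = - (x + 2) * y\<^sup>2" by (simp add: power2_eq_square algebra_simps)
    finally show ?thesis using x True by (simp add: zero_le_mult_iff)
  qed
qed

lemma det_spectral:
  assumes "spectral 2 A U d"
  shows "det A = complex_of_real (d 0 * d 1)"
proof -
  have U: "unitary_mat 2 U" "A = U * rdiag 2 d * adj U" using assms by (auto simp: spectral_def)
  note u = unitary_matD[OF U(1)]
  have D: "rdiag 2 d = sym2 (d 0) 0 (d 1)" by (intro eq_matI) (auto simp: sym2_def mat_diag_def less_2_cases_iff)
  have "det A = det U * det (rdiag 2 d) * det (adj U)"
    unfolding U(2) using u by (simp add: det_mult[of _ 2] mult_carrier_mat[of _ 2 2 _ 2])
  also have "\<dots> = det (rdiag 2 d) * det (U * adj U)"
    using u(1) by (simp add: det_mult[of _ 2] mult_ac)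
  finally show ?thesis using u by (simp add: D det_sym2)
qed

text \<open>The product is the determinant. The sum comes from a second determinant, that of the
  matrix plus the identity, whose eigenvalues are \<open>d i + 1\<close>.\<close>

lemma sym2_eigenvalues:
  assumes s: "spectral 2 (sym2 x y z) U d"
  shows "d 0 + d 1 = x + z" "d 0 * d 1 = x * z - y\<^sup>2"
proof -
  show 1: "d 0 * d 1 = x * z - y\<^sup>2"
    using det_spectral[OF s] by (metis det_sym2 of_real_eq_iff)
  have "spectral 2 (sym2 1 0 1) U (\<lambda>_. 1)"
    using s spectral_one[of 2 U] by (simp add: spectral_def sym2_one)
  from spectral_lin[OF s this, of 1 1]
  have "spectral 2 (sym2 (x + 1) y (z + 1)) U (\<lambda>i. d i + 1)"
    unfolding sym2_lin by simp
  from det_spectral[OF this] have "(d 0 + 1) * (d 1 + 1) = (x + 1) * (z + 1) - y\<^sup>2"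
    by (metis det_sym2 of_real_eq_iff)
  with 1 show "d 0 + d 1 = x + z" by (simp add: algebra_simps)
qed

text \<open>Every eigenvalue is a root of the quadratic with roots \<open>l0\<close> and
  \<open>l1\<close>. There the power agrees with the affine function with coefficients
  \<open>e0\<close> and \<open>e1\<close>, so both have the same value at the matrix.\<close>

lemma sym2_powr:
  assumes ne: "l0 \<noteq> l1" and sum: "l0 + l1 = x + z" and prod: "l0 * l1 = x * z - y\<^sup>2"
    and e: "e0 + e1 * l0 = l0 powr t" "e0 + e1 * l1 = l1 powr t"
  shows "mat_powr (sym2 x y z) t = sym2 (e0 + e1 * x) (e1 * y) (e0 + e1 * z)"
proof -
  obtain U d where s: "spectral 2 (sym2 x y z) U d"
    using spectral_exists[of "sym2 x y z" 2] by (auto simp: spectral_def)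
  note ev = sym2_eigenvalues[OF s]
  have "(d i - l0) * (d i - l1) = 0" if "i < 2" for i
  proof -
    have "d i * d i - d i * (d 0 + d 1) + d 0 * d 1 = 0"
      using that by (auto simp: less_2_cases_iff algebra_simps)
    then have "d i * d i - d i * (l0 + l1) + l0 * l1 = 0" using ev sum prod by simp
    then show ?thesis by (simp add: algebra_simps)
  qed
  then have "e0 * 1 + e1 * d i = d i powr t" if "i < 2" for i using e that by (metis eq_iff_diff_eq_0 mult.right_neutral mult_eq_0_iff)
  moreover have "spectral 2 (sym2 1 0 1) U (\<lambda>_. 1)"
    using s spectral_one[of 2 U] by (simp add: spectral_def sym2_one)
  from spectral_lin[OF this s, of e0 e1]
  have "spectral 2 (sym2 (e0 + e1 * x) (e1 * y) (e0 + e1 * z)) U (\<lambda>i. e0 * 1 + e1 * d i)"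
    unfolding sym2_lin by simp
  ultimately have "spectral 2 (sym2 (e0 + e1 * x) (e1 * y) (e0 + e1 * z)) U (\<lambda>i. d i powr t)"
    by (rule spectral_cong[rotated])
  with spectral_powr[OF s] show ?thesis by (rule spectral_unique)
qed

text \<open>If \<open>c\<^sup>2 + s\<^sup>2 = 1\<close>, this matrix has eigenvalue \<open>b\<close> at \<open>(c, s)\<close> and eigenvalue \<open>1\<close> at \<open>(-s, c)\<close>.\<close>

definition rot2 :: "real \<Rightarrow> real \<Rightarrow> real \<Rightarrow> complex mat" where
  "rot2 b c s = sym2 (b * c\<^sup>2 + s\<^sup>2) ((b - 1) * c * s) (b * s\<^sup>2 + c\<^sup>2)"

text \<open>The order of quantifiers matters: one \<open>U\<close> serves every \<open>b\<close>, so
  a power of the matrix changes only \<open>b\<close>.\<close>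

lemma rot2_spectral:
  assumes "c\<^sup>2 + s\<^sup>2 = 1"
  shows "\<exists>U. \<forall>b. spectral 2 (rot2 b c s) U (\<lambda>i. if i = 0 then b else 1)"
proof -
  define U where "U = mat 2 2 (\<lambda>(i, j). complex_of_real (if i = j then c else if i = 0 then - s else s))"
  have U: "U \<in> carrier_mat 2 2" by (simp add: U_def)
  have cs: "complex_of_real c * complex_of_real c + complex_of_real s * complex_of_real s = 1"
    using assms by (simp add: power2_eq_square flip: of_real_mult of_real_add)
  then have cs': "complex_of_real s * complex_of_real s + complex_of_real c * complex_of_real c = 1"
    by (simp add: add.commute)
  have "U * adj U = 1\<^sub>m 2"
    by (intro eq_matI) (auto simp: U_def scalar_prod_def numeral_2_eq_2 less_Suc_eq cs cs')
  then have "unitary_mat 2 U" using U by (simp add: unitary_mat_def)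
  moreover have "rot2 b c s = U * rdiag 2 (\<lambda>i. if i = 0 then b else 1) * adj U" for b
    unfolding mat_diag_mult_right[OF U]
    by (intro eq_matI)
      (auto simp: U_def rot2_def sym2_def scalar_prod_def numeral_2_eq_2 less_Suc_eq algebra_simps)
  ultimately show ?thesis by (auto simp: spectral_def)
qed

lemma rot2_carrier [simp]: "rot2 b c s \<in> carrier_mat 2 2"
  by (simp add: rot2_def)

lemma rot2_pd:
  assumes "c\<^sup>2 + s\<^sup>2 = 1" "b > 0"
  shows "pd_mat (rot2 b c s)"
proof -
  obtain U where "spectral 2 (rot2 b c s) U (\<lambda>i. if i = 0 then b else 1)"
    using rot2_spectral[OF assms(1)] by blast
  then show ?thesis by (rule spectral_pd) (simp add: assms(2))
qed

lemma rot2_powr: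
  assumes "c\<^sup>2 + s\<^sup>2 = 1"
  shows "mat_powr (rot2 b c s) t = rot2 (b powr t) c s"
proof -
  obtain U where U: "\<And>b. spectral 2 (rot2 b c s) U (\<lambda>i. if i = 0 then b else 1)"
    using rot2_spectral[OF assms] by blast
  have "spectral 2 (mat_powr (rot2 b c s) t) U (\<lambda>i. if i = 0 then b powr t else 1)"
    using spectral_powr[OF U[of b], of t] by (rule spectral_cong) auto
  then show ?thesis using U[of "b powr t"] by (rule spectral_unique)
qed

lemma sym2_diag_conj: "sym2 w 0 1 * sym2 x y z * sym2 w 0 1 = sym2 (w\<^sup>2 * x) (w * y) z"
  by (intro eq_matI)
    (auto simp: sym2_def scalar_prod_def numeral_2_eq_2 less_Suc_eq power2_eq_square algebra_simps)

text \<open>With \<open>A = diag(a, 1)\<close>, the numbers \<open>l0\<close> and \<open>l1\<close>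
  are the eigenvalues of \<open>A^(-1/2) B A^(-1/2)\<close>. Its power \<alpha> is affine in it, and
  conjugating back by \<open>A^(1/2)\<close> leaves \<open>e0 * A + e1 * B\<close>.\<close>

lemma wgm_pd_sym2:
  assumes a: "a > 0" and ne: "l0 \<noteq> l1"
    and sum: "l0 + l1 = x / a + z" and prod: "l0 * l1 = (x * z - y\<^sup>2) / a"
    and e: "e0 + e1 * l0 = l0 powr \<alpha>" "e0 + e1 * l1 = l1 powr \<alpha>"
  shows "wgm_pd \<alpha> (rot2 a 1 0) (sym2 x y z) = sym2 (e0 * a + e1 * x) (e1 * y) (e0 + e1 * z)"
proof -
  have d: "rot2 b 1 0 = sym2 b 0 1" for b by (simp add: rot2_def)
  have p: "mat_powr (sym2 a 0 1) t = sym2 (a powr t) 0 1" for t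
    using rot2_powr[of 1 0 a t] by (simp add: d)
  have sq: "(a powr t)\<^sup>2 = a powr (2 * t)" for t
    using a by (simp add: power2_eq_square flip: powr_add)
  have m: "a powr -1 = 1 / a" using a by (simp add: powr_minus_divide)
  have C: "mat_powr (sym2 a 0 1) (-1/2) * sym2 x y z * mat_powr (sym2 a 0 1) (-1/2)
    = sym2 (x / a) (a powr (-1/2) * y) z"
    using a m by (simp add: p sym2_diag_conj sq)
  have "(a powr (-1/2) * y)\<^sup>2 = y\<^sup>2 / a" using m by (simp add: power_mult_distrib sq)
  then have "l0 * l1 = x / a * z - (a powr (-1/2) * y)\<^sup>2" using prod by (simp add: diff_divide_distrib)
  from sym2_powr[OF ne sum this e]
  have "wgm_pd \<alpha> (rot2 a 1 0) (sym2 x y z)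
    = sym2 (a powr (1/2)) 0 1 * sym2 (e0 + e1 * (x / a)) (e1 * (a powr (-1/2) * y)) (e0 + e1 * z) * sym2 (a powr (1/2)) 0 1"
    unfolding wgm_pd_def d C by (simp add: p)
  also have "\<dots> = sym2 (a * (e0 + e1 * (x / a))) ((a powr (1/2) * a powr (-1/2)) * (e1 * y)) (e0 + e1 * z)"
    using a by (simp add: sym2_diag_conj sq mult_ac)
  also have "a powr (1/2) * a powr (-1/2) = 1" using a by (simp flip: powr_add)
  also have "a * (e0 + e1 * (x / a)) = e0 * a + e1 * x" using a by (simp add: field_simps)
  finally show ?thesis by simp
qed

lemma means_rot2:
  assumes \<alpha>: "0 < \<alpha>" "\<alpha> < 1" and ab: "a > 0" "b > 0" and cs: "c\<^sup>2 + s\<^sup>2 = 1"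
  shows "G_mean \<alpha> p (rot2 a 1 0) (rot2 b c s) =
      mat_powr (wgm_pd \<alpha> (rot2 (a powr p) 1 0) (rot2 (b powr p) c s)) (1 / p)"
    and "A_mean \<alpha> q (rot2 a 1 0) (rot2 b c s) =
      mat_powr (sym2 ((1 - \<alpha>) * a powr q + \<alpha> * (b powr q * c\<^sup>2 + s\<^sup>2))
        (\<alpha> * ((b powr q - 1) * c * s)) ((1 - \<alpha>) + \<alpha> * (b powr q * s\<^sup>2 + c\<^sup>2))) (1 / q)"
proof -
  have one: "(1::real)\<^sup>2 + 0\<^sup>2 = 1" by simp
  have "wgm \<alpha> (rot2 (a powr p) 1 0) (rot2 (b powr p) c s) = wgm_pd \<alpha> (rot2 (a powr p) 1 0) (rot2 (b powr p) c s)"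
    using ab by (intro wgm_eq_wgm_pd[of \<alpha> _ 2] \<alpha> rot2_pd[OF one] rot2_pd[OF cs]) auto
  then show "G_mean \<alpha> p (rot2 a 1 0) (rot2 b c s) =
      mat_powr (wgm_pd \<alpha> (rot2 (a powr p) 1 0) (rot2 (b powr p) c s)) (1 / p)"
    by (simp only: G_mean_def rot2_powr[OF one] rot2_powr[OF cs])
  show "A_mean \<alpha> q (rot2 a 1 0) (rot2 b c s) =
      mat_powr (sym2 ((1 - \<alpha>) * a powr q + \<alpha> * (b powr q * c\<^sup>2 + s\<^sup>2))
        (\<alpha> * ((b powr q - 1) * c * s)) ((1 - \<alpha>) + \<alpha> * (b powr q * s\<^sup>2 + c\<^sup>2))) (1 / q)"
    unfolding A_mean_def rot2_powr[OF one] rot2_powr[OF cs]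
    by (simp only: rot2_def sym2_lin) simp
qed

lemma arith_rot2_psd:
  assumes \<alpha>: "0 < \<alpha>" "\<alpha> < 1" and ab: "y > 0" "y' > 0" and cs: "c\<^sup>2 + s\<^sup>2 = 1"
  shows "psd_mat (sym2 ((1 - \<alpha>) * y + \<alpha> * (y' * c\<^sup>2 + s\<^sup>2)) (\<alpha> * ((y' - 1) * c * s)) ((1 - \<alpha>) + \<alpha> * (y' * s\<^sup>2 + c\<^sup>2)))"
proof -
  have one: "(1::real)\<^sup>2 + 0\<^sup>2 = 1" by simp
  have eq: "complex_of_real (1 - \<alpha>) \<cdot>\<^sub>m rot2 y 1 0 + complex_of_real \<alpha> \<cdot>\<^sub>m rot2 y' c s
    = sym2 ((1 - \<alpha>) * y + \<alpha> * (y' * c\<^sup>2 + s\<^sup>2)) (\<alpha> * ((y' - 1) * c * s)) ((1 - \<alpha>) + \<alpha> * (y' * s\<^sup>2 + c\<^sup>2))"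
    by (simp only: rot2_def sym2_lin) simp
  show ?thesis
    using arith_psd(2)[OF \<alpha> rot2_carrier pd_imp_psd[OF rot2_pd[OF one ab(1)]] rot2_carrier pd_imp_psd[OF rot2_pd[OF cs ab(2)]]]
    by (simp only: eq)
qed

section \<open>Necessity of the conditions on the exponents\<close>

text \<open>Before the outer powers the means are \<open>M\<close> and \<open>N\<close>. Testing the
  assumed inequality at a unit eigenvector of \<open>N\<close> with eigenvalue at most
  \<open>2 * a powr q\<close> gives \<open>1 \<le> 2 powr (p / q) * (2 * \<kappa>)\<close>, where
  \<kappa> is essentially the trace of \<open>M\<close>; \<open>a\<close> is chosen so small that
  this fails.\<close>

lemma mean_ineq_imp_p_le_q:
  assumes \<alpha>: "0 < \<alpha>" "\<alpha> < 1" and pq: "0 < p" "0 < q"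
    and ineq: "\<And>A B. A \<in> carrier_mat 2 2 \<Longrightarrow> B \<in> carrier_mat 2 2 \<Longrightarrow> pd_mat A \<Longrightarrow> pd_mat B \<Longrightarrow>
      loewner_le (G_mean \<alpha> p A B) (A_mean \<alpha> q A B)"
  shows "p \<le> q"
proof (rule ccontr)
  assume "\<not> p \<le> q"
  then have qp: "q < p" by simp
  \<comment> \<open>\<open>\<delta> \<le> \<kappa>\<close> is exactly the final estimate that has to
    fail.\<close>
  define \<delta> :: real where "\<delta> = 1 / (2 * 2 powr (p / q))"
  have \<delta>: "\<delta> > 0" by (simp add: \<delta>_def)
  have "((\<lambda>X::real. X powr (-\<alpha>)) \<longlongrightarrow> 0) at_top" "((\<lambda>X::real. X powr (\<alpha> - 1)) \<longlongrightarrow> 0) at_top"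
    using \<alpha> by (auto intro!: tendsto_neg_powr filterlim_ident)
  from order_tendstoD(2)[OF tendsto_add_zero[OF this] \<delta>]
  obtain X0 where X0: "\<And>X. X \<ge> X0 \<Longrightarrow> X powr (-\<alpha>) + X powr (\<alpha> - 1) < \<delta>"
    by (auto simp: eventually_at_top_linorder)
  \<comment> \<open>A lower bound for the trace \<open>T\<close>. The factor 2 is lost in
    \<open>X \<ge> T / 2\<close>; the bound 4 ensures \<open>T\<^sup>2 \<ge> 4\<close> and
    \<open>X > 1\<close>.\<close>
  define K where "K = 2 * max X0 2"
  have K: "K \<ge> 4" "K / 2 \<ge> X0" by (auto simp: K_def)
  \<comment> \<open>Solves \<open>a powr (q - p) = K\<close>; this is \<open>s\<^sup>2 / x\<close>,
    the term that makes \<open>T\<close> large.\<close>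
  define a where "a = K powr (- 1 / (p - q))"
  have a: "0 < a" "a < 1"
    using K qp by (auto simp: a_def powr_less_one)
  have aK: "a powr q / a powr p = K"
  proof -
    have "a powr q / a powr p = a powr (q - p)" by (simp add: powr_diff)
    also have "\<dots> = K powr (- 1 / (p - q) * (q - p))" by (simp add: a_def powr_powr)
    also have "- 1 / (p - q) * (q - p) = 1" using qp by (simp add: divide_simps)
    finally show ?thesis using K by simp
  qed
  define x where "x = a powr p"
  define s where "s = sqrt (a powr q)"
  define c where "c = sqrt (1 - a powr q)"
  have aq: "0 < a powr q" "a powr q < 1" using a pq powr_less_mono2[of q a 1] by auto
  have x: "0 < x" "x < 1" using a pq powr_less_mono2[of p a 1] by (auto simp: x_def)
  have s2: "s\<^sup>2 = a powr q" and c2: "c\<^sup>2 = 1 - a powr q" using aq by (auto simp: s_def c_def)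
  have cs: "c\<^sup>2 + s\<^sup>2 = 1" by (simp add: s2 c2)
  \<comment> \<open>Trace of \<open>A^(-p) B^p\<close>. The determinant is 1, so the eigenvalues are
    \<open>X\<close> and \<open>1 / X\<close>.\<close>
  define T where "T = (x * c\<^sup>2 + s\<^sup>2) / x + (x * s\<^sup>2 + c\<^sup>2)"
  have "T = 2 * c\<^sup>2 + s\<^sup>2 / x + x * s\<^sup>2" using x by (simp add: T_def field_simps)
  also have "\<dots> \<ge> K"
  proof -
    have "s\<^sup>2 / x = K" using aK by (simp add: s2 x_def)
    moreover have "0 \<le> 2 * c\<^sup>2" "0 \<le> x * s\<^sup>2" using x by auto
    ultimately show ?thesis by linarith
  qed
  finally have T: "T \<ge> K" .
  define X where "X = (T + sqrt (T\<^sup>2 - 4)) / 2"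
  have T4: "T\<^sup>2 \<ge> 4" using T K power_mono[of 2 T 2] by simp
  have XT: "X \<ge> T / 2" using T4 by (simp add: X_def)
  have X: "X > 1" "X \<ge> X0" using XT T K by auto
  have "X * (T - X) = 1"
    using T4 by (simp add: X_def field_simps power2_eq_square[symmetric])
  then have X_inv: "1 / X = T - X" using X by (simp add: field_simps)
  have ne: "1 / X \<noteq> X" using X by (simp add: field_simps) (metis less_1_mult order_less_irrefl)
  define e1 where "e1 = (X powr \<alpha> - X powr (-\<alpha>)) / (X - 1 / X)"
  define e0 where "e0 = X powr \<alpha> - e1 * X"
  have dX: "X - 1 / X > 0" using X by (simp add: field_simps) (metis less_1_mult)
  have e: "e0 + e1 * (1 / X) = (1 / X) powr \<alpha>" "e0 + e1 * X = X powr \<alpha>"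
  proof -
    have "e1 * (X - 1 / X) = X powr \<alpha> - X powr (-\<alpha>)" using dX by (simp add: e1_def)
    then have "e0 + e1 * (1 / X) = X powr (-\<alpha>)" by (simp add: e0_def algebra_simps)
    then show "e0 + e1 * (1 / X) = (1 / X) powr \<alpha>" using X by (simp add: powr_minus_divide powr_divide)
  qed (simp add: e0_def)
  have mono: "X powr (-\<alpha>) < X powr \<alpha>" using X \<alpha> by (intro powr_less_mono) auto
  have e1: "e1 > 0" using mono dX by (simp add: e1_def)
  \<comment> \<open>\<open>M\<close> is \<open>e0 * A^p + e1 * B^p\<close>, and \<open>A^p\<close>
    and \<open>B^p\<close> both have trace \<open>1 + x\<close>; hence the trace of \<open>M\<close>
    is \<open>\<kappa> * (1 + x)\<close>.\<close>
  define \<kappa> where "\<kappa> = e0 + e1"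
  have \<kappa>_eq: "\<kappa> = X powr (-\<alpha>) + (X powr \<alpha> - X powr (-\<alpha>)) / (X + 1)"
  proof -
    have "\<kappa> = (1 / X) powr \<alpha> + e1 * (1 - 1 / X)" using e(1) by (simp add: \<kappa>_def algebra_simps)
    also have "(1 / X) powr \<alpha> = X powr (-\<alpha>)" using X by (simp add: powr_minus_divide powr_divide)
    also have "e1 * (1 - 1 / X) = (X powr \<alpha> - X powr (-\<alpha>)) / (X + 1)"
    proof -
      have "X - 1 / X = (1 - 1 / X) * (X + 1)" using X by (simp add: field_simps)
      then show ?thesis using X by (simp add: e1_def)
    qed
    finally show ?thesis .
  qed
  have \<kappa>0: "\<kappa> > 0"
    unfolding \<kappa>_eq using mono X by (intro add_pos_pos) auto
  have "(X powr \<alpha> - X powr (-\<alpha>)) / (X + 1) \<le> X powr \<alpha> / X"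
    using X mono by (intro frac_le) auto
  also have "\<dots> = X powr (\<alpha> - 1)" using X by (simp add: powr_diff)
  finally have "\<kappa> \<le> X powr (-\<alpha>) + X powr (\<alpha> - 1)"
    by (simp add: \<kappa>_eq)
  then have \<kappa>: "0 < \<kappa>" "\<kappa> < \<delta>" using X0[OF X(2)] \<kappa>0 by auto
  define b where "b = e1 * ((x - 1) * c * s)"
  define M where "M = sym2 (e0 * x + e1 * (x * c\<^sup>2 + s\<^sup>2)) b (e0 + e1 * (x * s\<^sup>2 + c\<^sup>2))"
  have det_B: "(x * c\<^sup>2 + s\<^sup>2) * (x * s\<^sup>2 + c\<^sup>2) - ((x - 1) * c * s)\<^sup>2 = x"
  proof -
    have "(x * c\<^sup>2 + s\<^sup>2) * (x * s\<^sup>2 + c\<^sup>2) - ((x - 1) * c * s)\<^sup>2 = x * (c\<^sup>2 + s\<^sup>2)\<^sup>2"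
      by (simp add: power2_eq_square algebra_simps)
    then show ?thesis by (simp add: cs)
  qed
  have "wgm_pd \<alpha> (rot2 x 1 0) (rot2 x c s) = M"
    unfolding rot2_def[of x c s] M_def b_def
  proof (rule wgm_pd_sym2[OF x(1) ne _ _ e])
    show "1 / X + X = (x * c\<^sup>2 + s\<^sup>2) / x + (x * s\<^sup>2 + c\<^sup>2)"
      using X_inv by (simp add: T_def)
    show "1 / X * X = ((x * c\<^sup>2 + s\<^sup>2) * (x * s\<^sup>2 + c\<^sup>2) - ((x - 1) * c * s)\<^sup>2) / x"
      unfolding det_B using X x by simp
  qed
  moreover have one: "(1::real)\<^sup>2 + 0\<^sup>2 = 1" by simp
  note pd1 = rot2_pd[OF one x(1)] and pd2 = rot2_pd[OF cs x(1)]
  moreover have Mc: "M \<in> carrier_mat 2 2" by (simp add: M_def)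
  ultimately have M: "psd_mat M"
    using wgm_pd_hermitian(2)[OF rot2_carrier pd1 rot2_carrier pd_imp_psd[OF pd2], of \<alpha>]
      wgm_pd_le_arith(1)[OF \<alpha> rot2_carrier pd1 rot2_carrier pd_imp_psd[OF pd2]]
    by (simp add: psd_mat_iff[OF Mc])
  then obtain U d where dM: "spectral 2 M U d" and d0: "\<And>i. d i \<ge> 0"
    using psd_spectral[of M 2] by (auto simp: M_def)
  have "d 0 + d 1 = \<kappa> * (1 + x)"
  proof -
    have "d 0 + d 1 = e0 * (1 + x) + e1 * (1 + x) * (c\<^sup>2 + s\<^sup>2)"
      using sym2_eigenvalues(1)[OF dM[unfolded M_def]] by (simp add: algebra_simps)
    then show ?thesis by (simp add: cs \<kappa>_def algebra_simps)
  qed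
  also have "\<dots> \<le> \<kappa> * 2" using x \<kappa> by simp
  finally have d_sum: "d 0 + d 1 \<le> 2 * \<kappa>" by simp
  \<comment> \<open>The expanded determinant of \<open>e0 * A^p + e1 * B^p\<close> is
    \<open>x\<close> times the product of the interpolated values at \<open>1 / X\<close> and
    \<open>X\<close>, which cancel.\<close>
  have d_prod: "d 0 * d 1 = x"
  proof -
    have "d 0 * d 1 = (e0 * x + e1 * (x * c\<^sup>2 + s\<^sup>2)) * (e0 + e1 * (x * s\<^sup>2 + c\<^sup>2)) - b\<^sup>2"
      by (rule sym2_eigenvalues(2)[OF dM[unfolded M_def]])
    also have "\<dots> = e0\<^sup>2 * x + e0 * e1 * (x * (x * s\<^sup>2 + c\<^sup>2) + (x * c\<^sup>2 + s\<^sup>2))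
        + e1\<^sup>2 * ((x * c\<^sup>2 + s\<^sup>2) * (x * s\<^sup>2 + c\<^sup>2) - ((x - 1) * c * s)\<^sup>2)"
      by (simp add: b_def power2_eq_square algebra_simps)
    also have "\<dots> = x * ((e0 + e1 * (1 / X)) * (e0 + e1 * X))"
    proof -
      have "x * (x * s\<^sup>2 + c\<^sup>2) + (x * c\<^sup>2 + s\<^sup>2) = x * (1 / X + X)"
        using x X_inv by (simp add: T_def field_simps)
      moreover have "(e0 + e1 * (1 / X)) * (e0 + e1 * X) = e0\<^sup>2 + e0 * e1 * (1 / X + X) + e1\<^sup>2 * (1 / X * X)"
        by (simp add: power2_eq_square algebra_simps)
      ultimately show ?thesis unfolding det_B using X by (simp add: algebra_simps power2_eq_square)
    qed
    also have "(e0 + e1 * (1 / X)) * (e0 + e1 * X) = (1 / X * X) powr \<alpha>"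
      unfolding e using X by (simp only: powr_mult[symmetric])
    finally show ?thesis using X by simp
  qed
  \<comment> \<open>Both eigenvalues are at most \<open>2 * \<kappa>\<close> and their product is
    \<open>x\<close>, so neither can be small.\<close>
  have d_low: "x / (2 * \<kappa>) \<le> d i" if "i < 2" for i
  proof -
    have le: "d 0 \<le> 2 * \<kappa>" "d 1 \<le> 2 * \<kappa>" using d_sum d0[of 0] d0[of 1] by auto
    have "x \<le> d i * (2 * \<kappa>)"
      using that mult_left_mono[OF le(2) d0[of 0]] mult_right_mono[OF le(1) d0[of 1]] d_prod
      by (auto simp: less_2_cases_iff mult.commute)
    then show ?thesis using \<kappa> by (simp add: divide_le_eq)
  qed
  define N where "N = sym2 ((1 - \<alpha>) * a powr q + \<alpha> * (a powr q * c\<^sup>2 + s\<^sup>2))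
        (\<alpha> * ((a powr q - 1) * c * s)) ((1 - \<alpha>) + \<alpha> * (a powr q * s\<^sup>2 + c\<^sup>2))"
  have "psd_mat N" unfolding N_def by (rule arith_rot2_psd[OF \<alpha> aq(1) aq(1) cs])
  then obtain V n where nN: "spectral 2 N V n" and n0: "\<And>i. n i \<ge> 0"
    using psd_spectral[of N 2] by (auto simp: N_def)
  \<comment> \<open>The least eigenvalue is at most the first diagonal entry, where the rotation
    adds at most \<open>\<alpha> * s\<^sup>2\<close>.\<close>
  have "\<exists>i<2. n i \<le> 2 * a powr q"
  proof (rule ccontr)
    assume "\<not> ?thesis"
    then have gt: "n i > 2 * a powr q" if "i < 2" for i using that by (meson not_le)
    then have "n 0 > 2 * a powr q" "n 1 > 2 * a powr q" by auto
    then obtain l where l: "l > 2 * a powr q" "\<And>i. i < 2 \<Longrightarrow> l \<le> n i"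
      by (intro that[of "min (n 0) (n 1)"]) (auto simp: less_2_cases_iff)
    have "l * nsq (unit_vec 2 0) \<le> qf N (unit_vec 2 0)"
      by (rule spectral_lower[OF nN l(2)]) auto
    then have "l \<le> (1 - \<alpha>) * a powr q + \<alpha> * (a powr q * c\<^sup>2 + s\<^sup>2)"
      by (simp add: N_def qf_sym2 nsq_def numeral_2_eq_2)
    also have "\<dots> = a powr q + \<alpha> * (a powr q * c\<^sup>2)" by (simp add: s2 algebra_simps)
    also have "\<dots> \<le> a powr q + 1 * (a powr q * 1)"
      using \<alpha> aq c2 by (intro add_left_mono mult_mono) auto
    finally show False using l by simp
  qed
  then obtain i where i: "i < 2" "n i \<le> 2 * a powr q" by blast
  define u where "u = V *\<^sub>v unit_vec 2 i"
  note ev = spectral_eigvec[OF spectral_powr[OF nN, of "1 / q"] i(1), folded u_def]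
  have pa: "a powr p = x" by (simp add: x_def)
  have "G_mean \<alpha> p (rot2 a 1 0) (rot2 a c s) = mat_powr M (1 / p)"
    unfolding means_rot2(1)[OF \<alpha> a(1) a(1) cs] pa using \<open>wgm_pd \<alpha> (rot2 x 1 0) (rot2 x c s) = M\<close> by simp
  moreover have "A_mean \<alpha> q (rot2 a 1 0) (rot2 a c s) = mat_powr N (1 / q)"
    unfolding means_rot2(2)[OF \<alpha> a(1) a(1) cs] N_def ..
  ultimately have le: "loewner_le (mat_powr M (1 / p)) (mat_powr N (1 / q))"
    using ineq[OF rot2_carrier rot2_carrier rot2_pd[OF one a(1)] rot2_pd[OF cs a(1)]] by simp
  note sM = spectral_powr[OF dM, of "1 / p"] and sN = spectral_powr[OF nN, of "1 / q"]
  have "(x / (2 * \<kappa>)) powr (1 / p) * nsq u \<le> qf (mat_powr M (1 / p)) u"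
    by (rule spectral_lower[OF sM _ ev(1)]) (use d_low x \<kappa> pq in \<open>auto intro!: powr_mono2\<close>)
  also have "\<dots> \<le> qf (mat_powr N (1 / q)) u"
    using le ev(1) loewner_le_iff[OF spectral_carrier[OF sM] spectral_carrier[OF sN] spectral_adj[OF sM] spectral_adj[OF sN]]
    by blast
  also have "\<dots> = n i powr (1 / q)" by (rule ev)
  also have "\<dots> \<le> (2 * a powr q) powr (1 / q)" using i n0 pq by (intro powr_mono2) auto
  finally have "(x / (2 * \<kappa>)) powr (1 / p) \<le> (2 * a powr q) powr (1 / q)" using ev(2) by simp
  then have "((x / (2 * \<kappa>)) powr (1 / p)) powr p \<le> ((2 * a powr q) powr (1 / q)) powr p"
    using pq by (intro powr_mono2) auto
  also have "\<dots> = 2 powr (p / q) * x"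
    using pq a by (simp add: powr_powr powr_mult x_def)
  finally have "x / (2 * \<kappa>) \<le> 2 powr (p / q) * x"
    using pq x \<kappa> by (simp add: powr_powr)
  then have "1 \<le> 2 powr (p / q) * (2 * \<kappa>)"
    using x \<kappa> by (simp add: divide_le_eq mult_ac)
  then have "\<delta> \<le> \<kappa>" by (simp add: \<delta>_def divide_le_eq mult_ac)
  with \<kappa> show False by simp
qed

section \<open>Excluding p < 1\<close>

definition eigmin :: "real \<Rightarrow> real \<Rightarrow> real \<Rightarrow> real" where
  "eigmin x y z = (x + z - sqrt ((x - z)\<^sup>2 + 4 * y\<^sup>2)) / 2"

definition eigmax :: "real \<Rightarrow> real \<Rightarrow> real \<Rightarrow> real" where
  "eigmax x y z = (x + z + sqrt ((x - z)\<^sup>2 + 4 * y\<^sup>2)) / 2"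

text \<open>Slope of the secant of the power function, which is the linear coefficient of its affine
  interpolant.\<close>

definition chord :: "real \<Rightarrow> real \<Rightarrow> real \<Rightarrow> real" where
  "chord t l0 l1 = (l1 powr t - l0 powr t) / (l1 - l0)"

lemma chord_nonneg: "0 \<le> l0 \<Longrightarrow> l0 < l1 \<Longrightarrow> 0 \<le> t \<Longrightarrow> 0 \<le> chord t l0 l1"
  unfolding chord_def by (intro divide_nonneg_nonneg) (auto intro: powr_mono2)

text \<open>The last two product identities locate a diagonal entry near an eigenvalue: their
  distance is \<open>y\<^sup>2\<close> over the distance to the other eigenvalue, hence second order
  in \<open>y\<close> when the gap stays open.\<close>

lemma eig_sym2:
  "eigmin x y z + eigmax x y z = x + z"
  "eigmin x y z * eigmax x y z = x * z - y\<^sup>2"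
  "eigmin x y z \<le> x" "z \<le> eigmax x y z"
  "(x - eigmin x y z) * (eigmax x y z - x) = y\<^sup>2"
  "(eigmax x y z - z) * (z - eigmin x y z) = y\<^sup>2"
  "y \<noteq> 0 \<Longrightarrow> eigmin x y z < eigmax x y z"
proof -
  define r where "r = sqrt ((x - z)\<^sup>2 + 4 * y\<^sup>2)"
  have r2: "r * r = (x - z) * (x - z) + 4 * (y * y)" by (simp add: r_def power2_eq_square)
  have r: "r \<ge> \<bar>x - z\<bar>" unfolding r_def by (rule real_le_rsqrt) simp
  have m: "eigmin x y z = (x + z - r) / 2" "eigmax x y z = (x + z + r) / 2"
    by (simp_all add: eigmin_def eigmax_def r_def)
  show "eigmin x y z + eigmax x y z = x + z" by (simp add: m field_simps)
  show "eigmin x y z * eigmax x y z = x * z - y\<^sup>2" using r2 by (simp add: m power2_eq_square field_simps)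
  show "eigmin x y z \<le> x" "z \<le> eigmax x y z" using r by (auto simp: m)
  show "(x - eigmin x y z) * (eigmax x y z - x) = y\<^sup>2" using r2 by (simp add: m power2_eq_square field_simps)
  show "(eigmax x y z - z) * (z - eigmin x y z) = y\<^sup>2" using r2 by (simp add: m power2_eq_square field_simps)
  assume "y \<noteq> 0"
  then have "r > 0" unfolding r_def by (simp add: add_nonneg_pos)
  then show "eigmin x y z < eigmax x y z" by (simp add: m)
qed

lemma eigmin_nonneg: "psd_mat (sym2 x y z) \<Longrightarrow> 0 \<le> eigmin x y z"
proof -
  assume "psd_mat (sym2 x y z)"
  note d = sym2_psd_det[OF this]
  have "sqrt ((x - z)\<^sup>2 + 4 * y\<^sup>2) \<le> sqrt ((x + z)\<^sup>2)"
    using d by (intro real_sqrt_le_mono) (simp add: power2_eq_square algebra_simps)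
  then show ?thesis using d by (simp add: eigmin_def)
qed

text \<open>Affine interpolation again, anchored at \<open>l0\<close> in the first diagonal entry
  and at \<open>l1\<close> in the second, so that both corrections are second order in
  \<open>y\<close>.\<close>

lemma sym2_powr_eig:
  fixes x y z :: real
  assumes "y \<noteq> 0"
  defines "l0 \<equiv> eigmin x y z" and "l1 \<equiv> eigmax x y z"
  shows "mat_powr (sym2 x y z) t =
    sym2 (l0 powr t + chord t l0 l1 * (x - l0)) (chord t l0 l1 * y) (l1 powr t - chord t l0 l1 * (l1 - z))"
proof -
  define k where "k = chord t l0 l1"
  have lt: "l0 < l1" using eig_sym2(7)[OF assms(1)] by (simp add: l0_def l1_def)
  then have k: "k * (l1 - l0) = l1 powr t - l0 powr t" by (simp add: k_def chord_def)
  have "mat_powr (sym2 x y z) t = sym2 ((l0 powr t - k * l0) + k * x) (k * y) ((l0 powr t - k * l0) + k * z)"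
    by (rule sym2_powr[of l0 l1]) (use lt k eig_sym2(1,2)[of x y z] in \<open>auto simp: l0_def[symmetric] l1_def[symmetric] algebra_simps\<close>)
  also have "(l0 powr t - k * l0) + k * x = l0 powr t + k * (x - l0)" by (simp add: algebra_simps)
  also have "(l0 powr t - k * l0) + k * z = l1 powr t - k * (l1 - z)" using k by (simp add: algebra_simps)
  finally show ?thesis by (simp add: k_def)
qed

lemma tendsto_eig:
  assumes "(x \<longlongrightarrow> 0) F" "(y \<longlongrightarrow> 0) F" "(z \<longlongrightarrow> 1) F"
  shows "((\<lambda>a. eigmin (x a) (y a) (z a)) \<longlongrightarrow> 0) F" "((\<lambda>a. eigmax (x a) (y a) (z a)) \<longlongrightarrow> 1) F"
proof -
  have "((\<lambda>a. eigmin (x a) (y a) (z a)) \<longlongrightarrow> (0 + 1 - sqrt ((0 - 1)\<^sup>2 + 4 * 0\<^sup>2)) / 2) F"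
    unfolding eigmin_def by (intro tendsto_intros assms) auto
  then show "((\<lambda>a. eigmin (x a) (y a) (z a)) \<longlongrightarrow> 0) F" by simp
  have "((\<lambda>a. eigmax (x a) (y a) (z a)) \<longlongrightarrow> (0 + 1 + sqrt ((0 - 1)\<^sup>2 + 4 * 0\<^sup>2)) / 2) F"
    unfolding eigmax_def by (intro tendsto_intros assms) auto
  then show "((\<lambda>a. eigmax (x a) (y a) (z a)) \<longlongrightarrow> 1) F" by simp
qed

lemma tendsto_chord:
  assumes "(l0 \<longlongrightarrow> 0) F" "(l1 \<longlongrightarrow> 1) F" "\<forall>\<^sub>F a in F. 0 \<le> l0 a" "t > 0"
  shows "((\<lambda>a. chord t (l0 a) (l1 a)) \<longlongrightarrow> 1) F"
proof -
  have A: "((\<lambda>a. l0 a powr t) \<longlongrightarrow> 0 powr t) F"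
    by (rule tendsto_powr2[OF assms(1) tendsto_const assms(3,4)])
  have B: "((\<lambda>a. l1 a powr t) \<longlongrightarrow> 1 powr t) F" by (intro tendsto_intros assms) auto
  have "((\<lambda>a. chord t (l0 a) (l1 a)) \<longlongrightarrow> (1 powr t - 0 powr t) / (1 - 0)) F"
    unfolding chord_def by (rule tendsto_divide[OF tendsto_diff[OF B A] tendsto_diff[OF assms(2,1)]]) simp
  then show ?thesis by simp
qed

text \<open>Bernoulli's inequality, from Young's inequality for \<open>u powr r\<close> and 1 with
  weights \<open>1 / r\<close> and \<open>1 - 1 / r\<close>.\<close>

lemma powr_ge_tangent:
  fixes u r :: real
  assumes "u > 0" "r \<ge> 1"
  shows "1 + r * (u - 1) \<le> u powr r"
proof -
  have "(u powr r) powr (1 / r) * 1 powr (1 - 1 / r) \<le> 1 / r * u powr r + (1 - 1 / r) * 1"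
    using assms by (intro Youngs_inequality_0) auto
  then have "u \<le> 1 / r * u powr r + (1 - 1 / r)" using assms by (simp add: powr_powr)
  then have "r * u \<le> r * (1 / r * u powr r + (1 - 1 / r))" using assms by (intro mult_left_mono) auto
  then show ?thesis using assms by (simp add: algebra_simps)
qed

text \<open>Young's inequality at 2 would only give a weak bound. At the square root
  \<open>w\<close> of 2, followed by squaring, it leaves \<open>\<alpha>^2 * (w - 1)^2\<close>,
  strictly below \<open>\<alpha> * (w - 1)^2\<close>.\<close>

lemma two_powr_less:
  fixes \<alpha> :: real
  assumes "0 < \<alpha>" "\<alpha> < 1"
  shows "2 powr \<alpha> < 1 + \<alpha>"
proof -
  define w :: real where "w = sqrt 2"
  have w: "w > 0" "w * w = 2" by (auto simp: w_def)
  have "w powr \<alpha> * 1 powr (1 - \<alpha>) \<le> \<alpha> * w + (1 - \<alpha>) * 1"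
    using assms w by (intro Youngs_inequality_0) auto
  then have le: "w powr \<alpha> \<le> 1 + \<alpha> * (w - 1)" by (simp add: algebra_simps)
  have "2 powr \<alpha> = w powr \<alpha> * w powr \<alpha>" using w by (simp flip: powr_mult)
  also have "\<dots> \<le> (1 + \<alpha> * (w - 1)) * (1 + \<alpha> * (w - 1))" by (intro mult_mono le order.trans[OF _ le]) auto
  also have "\<dots> = 1 + 2 * (\<alpha> * (w - 1)) + \<alpha> * \<alpha> * ((w - 1) * (w - 1))" by (simp add: algebra_simps)
  also have "\<dots> < 1 + 2 * (\<alpha> * (w - 1)) + \<alpha> * ((w - 1) * (w - 1))"
  proof -
    have "w \<noteq> 1" using w by auto
    then have "(w - 1) * (w - 1) > 0" by (simp add: zero_less_mult_iff) linarith
    then show ?thesis using assms by (intro add_strict_left_mono mult_strict_right_mono) auto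
  qed
  also have "\<dots> = 1 + \<alpha>" using w by (simp add: algebra_simps)
  finally show ?thesis .
qed

lemma sym2_diff: "sym2 x y z - sym2 x' y' z' = sym2 (x - x') (y - y') (z - z')"
  by (intro eq_matI) (auto simp: sym2_def)

lemma mat_powr_le_one:
  assumes N: "N \<in> carrier_mat n n" "psd_mat N" and le: "\<And>v. v \<in> carrier_vec n \<Longrightarrow> qf N v \<le> nsq v"
    and t: "t \<ge> 0" and v: "v \<in> carrier_vec n"
  shows "qf (mat_powr N t) v \<le> nsq v"
proof -
  obtain U d where s: "spectral n N U d" "\<And>i. d i \<ge> 0" using psd_spectral[OF N] by blast
  have "d i \<le> 1" if "i < n" for i using spectral_eigvec[OF s(1) that] le by metis
  then have "d i powr t \<le> 1" if "i < n" for i using s(2)[of i] t that powr_mono2[of t "d i" 1] by simp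
  from spectral_upper[OF spectral_powr[OF s(1)] this v] show ?thesis by simp
qed

lemma arith_rot2_le_one:
  assumes \<alpha>: "0 < \<alpha>" "\<alpha> < 1" and ab: "y \<le> 1" "y' \<le> 1" and cs: "c\<^sup>2 + s\<^sup>2 = 1"
    and v: "v \<in> carrier_vec 2"
  shows "qf (sym2 ((1 - \<alpha>) * y + \<alpha> * (y' * c\<^sup>2 + s\<^sup>2)) (\<alpha> * ((y' - 1) * c * s)) ((1 - \<alpha>) + \<alpha> * (y' * s\<^sup>2 + c\<^sup>2))) v \<le> nsq v"
proof -
  have one: "(1::real)\<^sup>2 + 0\<^sup>2 = 1" by simp
  have le: "qf (rot2 b c s) v \<le> nsq v" if cs': "c\<^sup>2 + s\<^sup>2 = 1" and "b \<le> 1" for b c s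
  proof -
    obtain U where "spectral 2 (rot2 b c s) U (\<lambda>i. if i = 0 then b else 1)"
      using rot2_spectral[OF cs'] by blast
    from spectral_upper[OF this _ v, of 1] \<open>b \<le> 1\<close> show ?thesis by simp
  qed
  have eq: "sym2 ((1 - \<alpha>) * y + \<alpha> * (y' * c\<^sup>2 + s\<^sup>2)) (\<alpha> * ((y' - 1) * c * s)) ((1 - \<alpha>) + \<alpha> * (y' * s\<^sup>2 + c\<^sup>2))
    = complex_of_real (1 - \<alpha>) \<cdot>\<^sub>m rot2 y 1 0 + complex_of_real \<alpha> \<cdot>\<^sub>m rot2 y' c s"
    by (simp only: rot2_def sym2_lin) simp
  have "qf (complex_of_real (1 - \<alpha>) \<cdot>\<^sub>m rot2 y 1 0 + complex_of_real \<alpha> \<cdot>\<^sub>m rot2 y' c s) v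
    = (1 - \<alpha>) * qf (rot2 y 1 0) v + \<alpha> * qf (rot2 y' c s) v"
    using v by (simp add: qf_add[of _ 2] qf_smult[of _ 2] del: of_real_diff)
  also have "\<dots> \<le> (1 - \<alpha>) * nsq v + \<alpha> * nsq v"
    using \<alpha> by (intro add_mono mult_left_mono le one cs ab) auto
  also have "\<dots> = nsq v" by (simp add: algebra_simps)
  finally show ?thesis unfolding eq .
qed

text \<open>Positivity of the difference bounds the square of its off-diagonal entry
  \<open>D a * s a\<close> by the product of its diagonal entries, at most \<open>a * U a\<close>
  and \<open>(s a)\<^sup>2 / a * V a\<close>. Hence \<open>(D a)\<^sup>2 \<le> U a * V a\<close>,
  and letting \<open>a\<close> tend to 0 contradicts \<open>two_powr_less\<close>.\<close>

lemma mean_ineq_imp_one_le_p: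
  assumes \<alpha>: "0 < \<alpha>" "\<alpha> < 1" and pq: "0 < p" "0 < q"
    and ineq: "\<And>A B. A \<in> carrier_mat 2 2 \<Longrightarrow> B \<in> carrier_mat 2 2 \<Longrightarrow> pd_mat A \<Longrightarrow> pd_mat B \<Longrightarrow>
      loewner_le (G_mean \<alpha> p A B) (A_mean \<alpha> q A B)"
  shows "1 \<le> p"
proof (rule ccontr)
  assume "\<not> 1 \<le> p"
  then have p1: "p < 1" by simp
  define F where "F = at_right (0::real)"
  \<comment> \<open>For \<open>b = 2 powr (1 / p) * a\<close> this gives
    \<open>b powr p = 2 * x a\<close> and \<open>b powr q = \<zeta> * y a\<close>.\<close>
  define \<zeta> where "\<zeta> = 2 powr (q / p)"
  have \<zeta>: "\<zeta> > 0" by (simp add: \<zeta>_def)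
  define x where "x a = a powr p" for a :: real
  define y where "y a = a powr q" for a :: real
  define s where "s a = a powr (1 + q)" for a :: real
  define c where "c a = sqrt (1 - (s a)\<^sup>2)" for a
  define \<sigma> where "\<sigma> a = a powr (2 + 2 * q - p)" for a :: real
  \<comment> \<open>Trace of \<open>A^(-p) B^p\<close>, rewritten with
    \<open>\<sigma> = s\<^sup>2 / x\<close>. The determinant is 2, hence the 8 in the discriminant;
    without rotation the eigenvalues are 1 and 2.\<close>
  define T where "T a = 3 + \<sigma> a * (1 - x a) * (1 - 2 * x a)" for a
  define l0 where "l0 a = (T a - sqrt ((T a)\<^sup>2 - 8)) / 2" for a
  define l1 where "l1 a = (T a + sqrt ((T a)\<^sup>2 - 8)) / 2" for a
  define e1 where "e1 a = chord \<alpha> (l0 a) (l1 a)" for a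
  define e0 where "e0 a = l0 a powr \<alpha> - e1 a * l0 a" for a
  \<comment> \<open>The off-diagonal entries before the outer powers are \<open>m a * s a\<close>
    and \<open>n a * s a\<close>; with \<open>s\<close> split off, \<open>m\<close> and
    \<open>n\<close> have nonzero limits.\<close>
  define m where "m a = e1 a * ((2 * x a - 1) * c a)" for a
  define M1 where "M1 a = e0 a * x a + e1 a * (2 * x a * (c a)\<^sup>2 + (s a)\<^sup>2)" for a
  define M3 where "M3 a = e0 a + e1 a * (2 * x a * (s a)\<^sup>2 + (c a)\<^sup>2)" for a
  define n where "n a = \<alpha> * ((\<zeta> * y a - 1) * c a)" for a
  define N1 where "N1 a = (1 - \<alpha>) * y a + \<alpha> * (\<zeta> * y a * (c a)\<^sup>2 + (s a)\<^sup>2)" for a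
  define N3 where "N3 a = (1 - \<alpha>) + \<alpha> * (\<zeta> * y a * (s a)\<^sup>2 + (c a)\<^sup>2)" for a
  define \<mu>0 where "\<mu>0 a = eigmin (M1 a) (m a * s a) (M3 a)" for a
  define \<mu>1 where "\<mu>1 a = eigmax (M1 a) (m a * s a) (M3 a)" for a
  define \<nu>0 where "\<nu>0 a = eigmin (N1 a) (n a * s a) (N3 a)" for a
  define \<nu>1 where "\<nu>1 a = eigmax (N1 a) (n a * s a) (N3 a)" for a
  define kM where "kM a = chord (1 / p) (\<mu>0 a) (\<mu>1 a)" for a
  define kN where "kN a = chord (1 / q) (\<nu>0 a) (\<nu>1 a)" for a
  define D where "D a = kN a * n a - kM a * m a" for a
  \<comment> \<open>\<open>N1 a = y a * w a\<close> and \<open>w\<close> has a positive limit, so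
    \<open>N1 a powr (1 / q)\<close> is of order \<open>a\<close>.\<close>
  define w where "w a = (1 - \<alpha>) + \<alpha> * (\<zeta> * (c a)\<^sup>2 + a powr (2 + q))" for a
  define U where "U a = w a powr (1 / q) + kN a * ((n a)\<^sup>2 * a powr (1 + 2 * q)) / (\<nu>1 a - N1 a)" for a
  \<comment> \<open>The first term tends to 0 through \<open>a powr (1 - p)\<close>, where
    \<open>p < 1\<close> is decisive; the others carry a factor \<open>a\<close>.\<close>
  define V where "V a = 1 / p * (a powr (1 - p) * (1 - x a) * (1 - 2 * x a) / (l1 a - 1) + a * e1 a * (1 - 2 * x a))
      + kM a * (a * (m a)\<^sup>2) / (M3 a - \<mu>0 a)" for a

  have pos: "\<forall>\<^sub>F a in F. 0 < a" unfolding F_def by (rule eventually_at_right_less)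
  have id0: "((\<lambda>a. a) \<longlongrightarrow> 0) F" unfolding F_def by (rule tendsto_ident_at)
  have pw: "((\<lambda>a. a powr r) \<longlongrightarrow> 0) F" if "r > 0" for r :: real
  proof -
    have "((\<lambda>a. a powr r) \<longlongrightarrow> 0 powr r) F"
      by (rule tendsto_powr2[OF id0 tendsto_const _ that]) (use pos in \<open>auto elim: eventually_mono\<close>)
    then show ?thesis by simp
  qed
  have x0: "(x \<longlongrightarrow> 0) F" and y0: "(y \<longlongrightarrow> 0) F" and s0: "(s \<longlongrightarrow> 0) F" and \<sigma>0: "(\<sigma> \<longlongrightarrow> 0) F"
    unfolding x_def y_def s_def \<sigma>_def using pq p1 by (auto intro!: pw)
  have "(c \<longlongrightarrow> sqrt (1 - 0\<^sup>2)) F" unfolding c_def by (intro tendsto_intros s0)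
  then have c1: "(c \<longlongrightarrow> 1) F" by simp
  have "(T \<longlongrightarrow> 3 + 0 * (1 - 0) * (1 - 2 * 0)) F" unfolding T_def by (intro tendsto_intros \<sigma>0 x0)
  then have T3: "(T \<longlongrightarrow> 3) F" by simp
  have "(l0 \<longlongrightarrow> (3 - sqrt (3\<^sup>2 - 8)) / 2) F" "(l1 \<longlongrightarrow> (3 + sqrt (3\<^sup>2 - 8)) / 2) F"
    unfolding l0_def l1_def by (intro tendsto_intros T3; simp)+
  then have l01: "(l0 \<longlongrightarrow> 1) F" "(l1 \<longlongrightarrow> 2) F" by simp_all
  have "(e1 \<longlongrightarrow> (2 powr \<alpha> - 1 powr \<alpha>) / (2 - 1)) F"
    unfolding e1_def chord_def by (intro tendsto_intros l01) auto
  then have e1_lim: "(e1 \<longlongrightarrow> 2 powr \<alpha> - 1) F" by simp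
  have "(e0 \<longlongrightarrow> 1 powr \<alpha> - (2 powr \<alpha> - 1) * 1) F"
    unfolding e0_def by (intro tendsto_intros l01 e1_lim) auto
  then have e0_lim: "(e0 \<longlongrightarrow> 1 - (2 powr \<alpha> - 1)) F" by simp
  have "(m \<longlongrightarrow> (2 powr \<alpha> - 1) * ((2 * 0 - 1) * 1)) F" unfolding m_def by (intro tendsto_intros e1_lim x0 c1)
  then have m_lim: "(m \<longlongrightarrow> - (2 powr \<alpha> - 1)) F" by simp
  have "(n \<longlongrightarrow> \<alpha> * ((\<zeta> * 0 - 1) * 1)) F" unfolding n_def by (intro tendsto_intros y0 c1)
  then have n_lim: "(n \<longlongrightarrow> - \<alpha>) F" by simp
  have "(M1 \<longlongrightarrow> (1 - (2 powr \<alpha> - 1)) * 0 + (2 powr \<alpha> - 1) * (2 * 0 * 1\<^sup>2 + 0\<^sup>2)) F"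
    unfolding M1_def by (intro tendsto_intros e0_lim e1_lim x0 c1 s0)
  then have M1_lim: "(M1 \<longlongrightarrow> 0) F" by simp
  have "(M3 \<longlongrightarrow> (1 - (2 powr \<alpha> - 1)) + (2 powr \<alpha> - 1) * (2 * 0 * 0\<^sup>2 + 1\<^sup>2)) F"
    unfolding M3_def by (intro tendsto_intros e0_lim e1_lim x0 c1 s0)
  then have M3_lim: "(M3 \<longlongrightarrow> 1) F" by simp
  have "(N1 \<longlongrightarrow> (1 - \<alpha>) * 0 + \<alpha> * (\<zeta> * 0 * 1\<^sup>2 + 0\<^sup>2)) F"
    unfolding N1_def by (intro tendsto_intros y0 c1 s0)
  then have N1_lim: "(N1 \<longlongrightarrow> 0) F" by simp
  have "(N3 \<longlongrightarrow> (1 - \<alpha>) + \<alpha> * (\<zeta> * 0 * 0\<^sup>2 + 1\<^sup>2)) F"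
    unfolding N3_def by (intro tendsto_intros y0 c1 s0)
  then have N3_lim: "(N3 \<longlongrightarrow> 1) F" by simp
  have ms: "((\<lambda>a. m a * s a) \<longlongrightarrow> 0) F" and ns: "((\<lambda>a. n a * s a) \<longlongrightarrow> 0) F"
    using tendsto_mult[OF m_lim s0] tendsto_mult[OF n_lim s0] by simp_all
  have \<mu>_lim: "(\<mu>0 \<longlongrightarrow> 0) F" "(\<mu>1 \<longlongrightarrow> 1) F"
    unfolding \<mu>0_def \<mu>1_def by (rule tendsto_eig[OF M1_lim ms M3_lim])+
  have \<nu>_lim: "(\<nu>0 \<longlongrightarrow> 0) F" "(\<nu>1 \<longlongrightarrow> 1) F"
    unfolding \<nu>0_def \<nu>1_def by (rule tendsto_eig[OF N1_lim ns N3_lim])+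

  define ok where "ok a \<longleftrightarrow> 0 < a \<and> s a < 1 \<and> x a < 1 / 2 \<and> y a < 1 \<and> \<zeta> * y a < 1 \<and>
      N1 a < \<nu>1 a \<and> \<mu>0 a < M3 a \<and> 0 < M3 a" for a
  have "\<forall>\<^sub>F a in F. \<zeta> * y a < 1"
    by (rule order_tendstoD(2)[OF tendsto_mult_right_zero[OF y0]]) simp
  moreover have "\<forall>\<^sub>F a in F. N1 a < 1 / 2" "\<forall>\<^sub>F a in F. 1 / 2 < \<nu>1 a" "\<forall>\<^sub>F a in F. \<mu>0 a < 1 / 2" "\<forall>\<^sub>F a in F. 1 / 2 < M3 a"
    "\<forall>\<^sub>F a in F. s a < 1" "\<forall>\<^sub>F a in F. x a < 1 / 2" "\<forall>\<^sub>F a in F. y a < 1"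
    using order_tendstoD(2)[OF N1_lim, of "1 / 2"] order_tendstoD(1)[OF \<nu>_lim(2), of "1 / 2"]
      order_tendstoD(2)[OF \<mu>_lim(1), of "1 / 2"] order_tendstoD(1)[OF M3_lim, of "1 / 2"]
      order_tendstoD(2)[OF s0, of 1] order_tendstoD(2)[OF x0, of "1 / 2"] order_tendstoD(2)[OF y0, of 1]
    by simp_all
  ultimately have ok: "\<forall>\<^sub>F a in F. ok a"
    using pos by eventually_elim (auto simp: ok_def)

  \<comment> \<open>The signs of the eigenvalues are part of the claim because the limits of
    \<open>kM\<close> and \<open>kN\<close> rely on them.\<close>
  have main: "0 \<le> \<mu>0 a \<and> 0 \<le> \<nu>0 a \<and> (D a)\<^sup>2 \<le> U a * V a" if "ok a" for a
  proof -
    have a: "0 < a" and s1: "s a < 1" and x12: "x a < 1 / 2" and y1: "y a < 1" and \<zeta>y: "\<zeta> * y a < 1"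
      and gapN: "N1 a < \<nu>1 a" and gapM: "\<mu>0 a < M3 a" and M3: "0 < M3 a"
      using that by (auto simp: ok_def)
    have sp: "s a > 0" and xp: "x a > 0" and yp: "y a > 0" and \<sigma>p: "\<sigma> a > 0"
      using a by (auto simp: s_def x_def y_def \<sigma>_def)
    have s2: "(s a)\<^sup>2 = a powr (2 + 2 * q)" by (simp add: s_def power2_eq_square flip: powr_add)
    have s2_1: "(s a)\<^sup>2 < 1" using sp s1 power_strict_mono[of "s a" 1 2] by simp
    have c2: "(c a)\<^sup>2 = 1 - (s a)\<^sup>2" using s2_1 by (simp add: c_def)
    have cs: "(c a)\<^sup>2 + (s a)\<^sup>2 = 1" by (simp add: c2)
    have cp: "c a > 0" using s2_1 by (simp add: c_def)
    have \<sigma>s: "\<sigma> a = (s a)\<^sup>2 / x a" unfolding s2 \<sigma>_def x_def by (simp add: powr_diff)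
    define b where "b = 2 powr (1 / p) * a"
    have b: "b > 0" "b powr p = 2 * x a" "b powr q = \<zeta> * y a"
      using a pq by (auto simp: b_def x_def y_def \<zeta>_def powr_mult powr_powr)
    have T_eq: "T a = (2 * x a * (c a)\<^sup>2 + (s a)\<^sup>2) / x a + (2 * x a * (s a)\<^sup>2 + (c a)\<^sup>2)"
      using xp by (simp add: T_def \<sigma>s c2 field_simps)
    have T3: "T a \<ge> 3" using \<sigma>p x12 xp by (simp add: T_def)
    then have T8: "(T a)\<^sup>2 - 8 \<ge> 1" using power_mono[of 3 "T a" 2] by simp
    then have sq: "sqrt ((T a)\<^sup>2 - 8) \<ge> 1" by simp
    have lsum: "l0 a + l1 a = T a" by (simp add: l0_def l1_def field_simps)
    have lprod: "l0 a * l1 a = 2"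
      using T8 by (simp add: l0_def l1_def field_simps power2_eq_square[symmetric])
    have l_lt: "l0 a < l1 a" using sq by (simp add: l0_def l1_def)
    have l1_2: "l1 a \<ge> 2"
    proof -
      have "(3 + 1) / 2 \<le> l1 a" unfolding l1_def using sq T3 by (intro divide_right_mono add_mono) auto
      then show ?thesis by simp
    qed
    have l0p: "l0 a > 0" using lprod l1_2 by (metis less_eq_real_def linorder_not_le mult_nonpos_nonneg not_numeral_le_zero order_trans zero_le_numeral)
    have l_gap: "(1 - l0 a) * (l1 a - 1) = T a - 3" using lsum lprod by (simp add: algebra_simps)
    have l0_1: "1 - l0 a = (T a - 3) / (l1 a - 1)" using l_gap l1_2 by (simp add: field_simps)
    then have l0_le: "l0 a \<le> 1" using T3 l1_2 by (smt (verit) divide_nonneg_nonneg)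
    have e1n: "e1 a > 0" unfolding e1_def chord_def
      using l_lt l0p \<alpha> by (intro divide_pos_pos) (auto intro: powr_less_mono2)
    have e: "e0 a + e1 a * l0 a = l0 a powr \<alpha>" "e0 a + e1 a * l1 a = l1 a powr \<alpha>"
    proof -
      have "e1 a * (l1 a - l0 a) = l1 a powr \<alpha> - l0 a powr \<alpha>" using l_lt by (simp add: e1_def chord_def)
      then show "e0 a + e1 a * l1 a = l1 a powr \<alpha>" by (simp add: e0_def algebra_simps)
    qed (simp add: e0_def)
    \<comment> \<open>The interpolant increases and \<open>l0 a \<le> 1\<close>, so its value at 1
      is at least \<open>l0 a powr \<alpha>\<close>, hence at least \<open>l0 a\<close>. The loss
      \<open>1 - l0 a\<close> is then controlled by \<open>l_gap\<close>.\<close>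
    have e01: "e0 a + e1 a \<ge> l0 a"
    proof -
      have "l0 a = l0 a powr 1" using l0p by simp
      also have "\<dots> \<le> l0 a powr \<alpha>" using l0p l0_le \<alpha> by (intro powr_mono') auto
      also have "\<dots> \<le> e0 a + e1 a * 1"
        unfolding e(1)[symmetric] using e1n l0_le by (intro add_left_mono mult_left_mono) auto
      also have "\<dots> = e0 a + e1 a" by simp
      finally show ?thesis .
    qed
    have one: "(1::real)\<^sup>2 + 0\<^sup>2 = 1" by simp
    have x2p: "2 * x a > 0" using xp by simp
    note pd1 = rot2_pd[OF one xp] and pd2 = rot2_pd[OF cs x2p]
    define M where "M = sym2 (M1 a) (m a * s a) (M3 a)"
    define N where "N = sym2 (N1 a) (n a * s a) (N3 a)"
    have "wgm_pd \<alpha> (rot2 (x a) 1 0) (rot2 (2 * x a) (c a) (s a)) =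
      sym2 (e0 a * x a + e1 a * (2 * x a * (c a)\<^sup>2 + (s a)\<^sup>2)) (e1 a * ((2 * x a - 1) * c a * s a))
        (e0 a + e1 a * (2 * x a * (s a)\<^sup>2 + (c a)\<^sup>2))"
      unfolding rot2_def[of "2 * x a"]
    proof (rule wgm_pd_sym2[OF xp _ _ _ e])
      show "l0 a \<noteq> l1 a" using l_lt by simp
      show "l0 a + l1 a = (2 * x a * (c a)\<^sup>2 + (s a)\<^sup>2) / x a + (2 * x a * (s a)\<^sup>2 + (c a)\<^sup>2)"
        unfolding lsum by (rule T_eq)
      have "(2 * x a * (c a)\<^sup>2 + (s a)\<^sup>2) * (2 * x a * (s a)\<^sup>2 + (c a)\<^sup>2) - ((2 * x a - 1) * c a * s a)\<^sup>2
        = 2 * x a * ((c a)\<^sup>2 + (s a)\<^sup>2)\<^sup>2" by (simp add: power2_eq_square algebra_simps)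
      then show "l0 a * l1 a = ((2 * x a * (c a)\<^sup>2 + (s a)\<^sup>2) * (2 * x a * (s a)\<^sup>2 + (c a)\<^sup>2) - ((2 * x a - 1) * c a * s a)\<^sup>2) / x a"
        using xp by (simp add: lprod cs)
    qed
    also have "\<dots> = M" by (simp add: M_def M1_def m_def M3_def mult.assoc)
    finally have wM: "wgm_pd \<alpha> (rot2 (x a) 1 0) (rot2 (2 * x a) (c a) (s a)) = M" .
    have Mc: "M \<in> carrier_mat 2 2" and Nc: "N \<in> carrier_mat 2 2" by (simp_all add: M_def N_def)
    have Mpsd: "psd_mat M"
      using wgm_pd_hermitian(2)[OF rot2_carrier pd1 rot2_carrier pd_imp_psd[OF pd2], of \<alpha>]
        wgm_pd_le_arith(1)[OF \<alpha> rot2_carrier pd1 rot2_carrier pd_imp_psd[OF pd2]]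
      unfolding wM by (simp add: psd_mat_iff[OF Mc])
    have N_eq: "N = sym2 ((1 - \<alpha>) * y a + \<alpha> * (\<zeta> * y a * (c a)\<^sup>2 + (s a)\<^sup>2))
        (\<alpha> * ((\<zeta> * y a - 1) * c a * s a)) ((1 - \<alpha>) + \<alpha> * (\<zeta> * y a * (s a)\<^sup>2 + (c a)\<^sup>2))"
      by (simp add: N_def N1_def n_def N3_def mult.assoc)
    have \<zeta>yp: "\<zeta> * y a > 0" using \<zeta> yp by simp
    have Npsd: "psd_mat N" unfolding N_eq by (rule arith_rot2_psd[OF \<alpha> yp \<zeta>yp cs])
    have N_le: "qf N v \<le> nsq v" if "v \<in> carrier_vec 2" for v
      unfolding N_eq using y1 \<zeta>y by (intro arith_rot2_le_one[OF \<alpha> _ _ cs that]) auto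
    have G: "G_mean \<alpha> p (rot2 a 1 0) (rot2 b (c a) (s a)) = mat_powr M (1 / p)"
      unfolding means_rot2(1)[OF \<alpha> a b(1) cs] b(2) x_def[of a, symmetric] wM ..
    have Am: "A_mean \<alpha> q (rot2 a 1 0) (rot2 b (c a) (s a)) = mat_powr N (1 / q)"
      unfolding means_rot2(2)[OF \<alpha> a b(1) cs] b(3) y_def[of a, symmetric] N_eq ..
    have "loewner_le (mat_powr M (1 / p)) (mat_powr N (1 / q))"
      using ineq[OF rot2_carrier rot2_carrier rot2_pd[OF one a] rot2_pd[OF cs b(1)]] unfolding G Am .
    then have diff: "psd_mat (mat_powr N (1 / q) - mat_powr M (1 / p))" by (simp add: loewner_le_def)
    have ms0: "m a * s a \<noteq> 0" and ns0: "n a * s a \<noteq> 0"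
      using e1n x12 cp sp \<alpha> \<zeta>y by (auto simp: m_def n_def)
    note Gs = sym2_powr_eig[OF ms0, of "M1 a" "M3 a" "1 / p", folded M_def \<mu>0_def \<mu>1_def kM_def]
    note As = sym2_powr_eig[OF ns0, of "N1 a" "N3 a" "1 / q", folded N_def \<nu>0_def \<nu>1_def kN_def]
    define G1 where "G1 = \<mu>0 a powr (1 / p) + kM a * (M1 a - \<mu>0 a)"
    define G3 where "G3 = \<mu>1 a powr (1 / p) - kM a * (\<mu>1 a - M3 a)"
    define A1 where "A1 = \<nu>0 a powr (1 / q) + kN a * (N1 a - \<nu>0 a)"
    define A3 where "A3 = \<nu>1 a powr (1 / q) - kN a * (\<nu>1 a - N3 a)"
    note psd_d = sym2_psd_det[OF diff[unfolded Gs As sym2_diff, folded G1_def G3_def A1_def A3_def]]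
    have G1: "G1 \<ge> 0"
      using sym2_psd_det(1)[OF mat_powr_psd(2)[OF Mc Mpsd, of "1 / p", unfolded Gs]] by (simp add: G1_def)
    have A3: "A3 \<le> 1"
    proof -
      have "qf (mat_powr N (1 / q)) (unit_vec 2 1) \<le> nsq (unit_vec 2 1)"
        using pq by (intro mat_powr_le_one[OF Nc Npsd N_le]) auto
      then show ?thesis by (simp add: As A3_def qf_sym2 nsq_def numeral_2_eq_2)
    qed
    have "(kN a * (n a * s a) - kM a * (m a * s a))\<^sup>2 \<le> (A1 - G1) * (A3 - G3)" by (rule psd_d)
    \<comment> \<open>Dropping \<open>G1\<close> and replacing \<open>A3\<close> by 1 only enlarges
      the two nonnegative factors.\<close>
    also have "\<dots> \<le> A1 * (1 - G3)" using psd_d G1 A3 by (intro mult_mono) auto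
    also have "kN a * (n a * s a) - kM a * (m a * s a) = D a * s a" by (simp add: D_def algebra_simps)
    finally have D_le: "(D a * s a)\<^sup>2 \<le> A1 * (1 - G3)" .
    have \<mu>0n: "\<mu>0 a \<ge> 0" using eigmin_nonneg Mpsd by (simp add: M_def \<mu>0_def)
    have \<nu>0n: "\<nu>0 a \<ge> 0" using eigmin_nonneg Npsd by (simp add: N_def \<nu>0_def)
    note eM = eig_sym2[where x = "M1 a" and y = "m a * s a" and z = "M3 a", folded \<mu>0_def \<mu>1_def]
    note eN = eig_sym2[where x = "N1 a" and y = "n a * s a" and z = "N3 a", folded \<nu>0_def \<nu>1_def]
    have kMn: "kM a \<ge> 0" and kNn: "kN a \<ge> 0"
      using chord_nonneg[OF \<mu>0n eM(7)[OF ms0]] chord_nonneg[OF \<nu>0n eN(7)[OF ns0]] pq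
      by (auto simp: kM_def kN_def)
    have A1_le: "A1 \<le> a * U a"
    proof -
      have s_y: "(s a)\<^sup>2 = y a * a powr (2 + q)" unfolding s2 y_def by (simp add: add.commute flip: powr_add)
      have s_a: "(s a)\<^sup>2 = a * a powr (1 + 2 * q)"
      proof -
        have "a * a powr (1 + 2 * q) = a powr (1 + (1 + 2 * q))"
          using a by (intro powr_mult_base) simp
        also have "1 + (1 + 2 * q) = 2 + 2 * q" by simp
        finally show ?thesis unfolding s2 ..
      qed
      have "N1 a = y a * w a" by (simp add: N1_def w_def s_y algebra_simps)
      then have "\<nu>0 a powr (1 / q) \<le> (y a * w a) powr (1 / q)"
        using eN(3) \<nu>0n pq by (intro powr_mono2) auto
      also have "\<dots> = a * w a powr (1 / q)"
        using a pq by (simp add: powr_mult y_def powr_powr)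
      finally have 1: "\<nu>0 a powr (1 / q) \<le> a * w a powr (1 / q)" .
      have "N1 a - \<nu>0 a = (n a * s a)\<^sup>2 / (\<nu>1 a - N1 a)"
        using eN(5) gapN by (simp add: field_simps)
      also have "\<dots> = a * ((n a)\<^sup>2 * a powr (1 + 2 * q) / (\<nu>1 a - N1 a))"
        by (simp add: power_mult_distrib s_a)
      finally have 2: "N1 a - \<nu>0 a = a * ((n a)\<^sup>2 * a powr (1 + 2 * q) / (\<nu>1 a - N1 a))" .
      show ?thesis unfolding A1_def U_def 2 using 1 by (simp add: algebra_simps)
    qed
    have G3_ge: "1 - G3 \<le> (s a)\<^sup>2 / a * V a"
    proof -
      \<comment> \<open>The tangent at 1 lies below the power \<open>1 / p\<close>, which is convex
        because \<open>p < 1\<close>.\<close>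
      have "1 + 1 / p * (M3 a - 1) \<le> M3 a powr (1 / p)"
        using M3 pq p1 by (intro powr_ge_tangent) auto
      also have "\<dots> \<le> \<mu>1 a powr (1 / p)" using M3 eM(4) pq by (intro powr_mono2) auto
      finally have 1: "1 - \<mu>1 a powr (1 / p) \<le> 1 / p * (1 - M3 a)" by (simp add: algebra_simps)
      have "1 - M3 a = 1 - (e0 a + e1 a) + e1 a * ((s a)\<^sup>2 * (1 - 2 * x a))"
        by (simp add: M3_def c2 algebra_simps)
      also have "1 - (e0 a + e1 a) \<le> (T a - 3) / (l1 a - 1)" using e01 l0_1 by simp
      also have "T a - 3 = (s a)\<^sup>2 / a * (a powr (1 - p) * (1 - x a) * (1 - 2 * x a))"
      proof -
        have "(s a)\<^sup>2 / a * a powr (1 - p) = \<sigma> a"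
          using a by (simp add: \<sigma>s x_def powr_diff)
        then have "(s a)\<^sup>2 / a * (a powr (1 - p) * (1 - x a) * (1 - 2 * x a)) = \<sigma> a * (1 - x a) * (1 - 2 * x a)"
          by (simp only: mult.assoc[symmetric])
        then show ?thesis by (simp add: T_def)
      qed
      finally have 2: "1 - M3 a \<le> (s a)\<^sup>2 / a * (a powr (1 - p) * (1 - x a) * (1 - 2 * x a) / (l1 a - 1) + a * e1 a * (1 - 2 * x a))"
        using a by (simp add: distrib_left mult_ac)
      have 3: "\<mu>1 a - M3 a = (s a)\<^sup>2 / a * (a * (m a)\<^sup>2 / (M3 a - \<mu>0 a))"
      proof -
        have "\<mu>1 a - M3 a = (m a * s a)\<^sup>2 / (M3 a - \<mu>0 a)" using eM(6) gapM by (simp add: field_simps)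
        then show ?thesis using a by (simp add: power_mult_distrib mult.commute)
      qed
      have "1 - G3 = (1 - \<mu>1 a powr (1 / p)) + kM a * (\<mu>1 a - M3 a)" by (simp add: G3_def)
      also have "\<dots> \<le> 1 / p * (1 - M3 a) + kM a * (\<mu>1 a - M3 a)" using 1 by simp
      also have "\<dots> \<le> 1 / p * ((s a)\<^sup>2 / a * (a powr (1 - p) * (1 - x a) * (1 - 2 * x a) / (l1 a - 1) + a * e1 a * (1 - 2 * x a)))
          + kM a * ((s a)\<^sup>2 / a * (a * (m a)\<^sup>2 / (M3 a - \<mu>0 a)))"
        unfolding 3 using pq by (intro add_right_mono mult_left_mono 2) auto
      also have "\<dots> = (s a)\<^sup>2 / a * V a" by (simp add: V_def distrib_left mult_ac)
      finally show ?thesis .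
    qed
    have A1n: "A1 \<ge> 0" using psd_d(1) G1 by simp
    have G3n: "1 - G3 \<ge> 0" using psd_d(2) A3 by simp
    have "(D a * s a)\<^sup>2 \<le> (a * U a) * ((s a)\<^sup>2 / a * V a)"
      using D_le A1_le G3_ge A1n G3n by (meson mult_mono order.trans)
    also have "\<dots> = (s a)\<^sup>2 * (U a * V a)" using a by simp
    finally have "(s a)\<^sup>2 * (D a)\<^sup>2 \<le> (s a)\<^sup>2 * (U a * V a)" by (simp add: power_mult_distrib mult.commute)
    then have "(D a)\<^sup>2 \<le> U a * V a" using sp by simp
    then show ?thesis using \<mu>0n \<nu>0n by simp
  qed

  have kM_lim: "(kM \<longlongrightarrow> 1) F" unfolding kM_def
    using pq main by (intro tendsto_chord \<mu>_lim eventually_mono[OF ok]) auto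
  have kN_lim: "(kN \<longlongrightarrow> 1) F" unfolding kN_def
    using pq main by (intro tendsto_chord \<nu>_lim eventually_mono[OF ok]) auto
  \<comment> \<open>The limit is the secant slope \<open>2 powr \<alpha> - 1\<close> minus the
    tangent slope \<alpha>.\<close>
  have "(D \<longlongrightarrow> 1 * (- \<alpha>) - 1 * (- (2 powr \<alpha> - 1))) F"
    unfolding D_def by (intro tendsto_intros kM_lim kN_lim m_lim n_lim)
  then have D2_lim: "((\<lambda>a. (D a)\<^sup>2) \<longlongrightarrow> (2 powr \<alpha> - 1 - \<alpha>)\<^sup>2) F"
    by (intro tendsto_power) (simp add: algebra_simps)
  have UV_lim: "((\<lambda>a. U a * V a) \<longlongrightarrow> 0) F"
  proof -
    define W where "W = (1 - \<alpha>) + \<alpha> * (\<zeta> * 1\<^sup>2 + 0)"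
    have w: "(w \<longlongrightarrow> W) F"
      unfolding w_def W_def using pq by (intro tendsto_intros c1 pw) auto
    have W: "W \<noteq> 0" using \<alpha> mult_pos_pos[OF \<alpha>(1) \<zeta>] by (simp add: W_def)
    have U: "(U \<longlongrightarrow> W powr (1 / q) + 1 * ((- \<alpha>)\<^sup>2 * 0) / (1 - 0)) F"
      unfolding U_def using pq W by (intro tendsto_intros kN_lim n_lim \<nu>_lim N1_lim pw w) auto
    have V: "(V \<longlongrightarrow> 1 / p * (0 * (1 - 0) * (1 - 2 * 0) / (2 - 1) + 0 * (2 powr \<alpha> - 1) * (1 - 2 * 0))
        + 1 * (0 * (- (2 powr \<alpha> - 1))\<^sup>2) / (1 - 0)) F"
      unfolding V_def using p1 pq
      by (intro tendsto_intros kM_lim m_lim \<mu>_lim M3_lim l01 e1_lim x0 id0 pw) auto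
    show ?thesis using tendsto_mult[OF U V] by simp
  qed
  have "F \<noteq> bot" by (simp add: F_def)
  moreover have "\<forall>\<^sub>F a in F. (D a)\<^sup>2 \<le> U a * V a"
    using ok by eventually_elim (use main in blast)
  ultimately have "(2 powr \<alpha> - 1 - \<alpha>)\<^sup>2 \<le> 0"
    using tendsto_le UV_lim D2_lim by blast
  then show False using two_powr_less[OF \<alpha>] by simp
qed

theorem theorem4p16:
  fixes \<alpha> p q :: real
  assumes "0 < \<alpha>" and "\<alpha> < 1" and "0 < p" and "0 < q"
  shows "((\<forall>n::nat. \<forall>A B :: complex mat. A \<in> carrier_mat n n \<longrightarrow> B \<in> carrier_mat n n \<longrightarrow>
              psd_mat A \<longrightarrow> psd_mat B \<longrightarrow> loewner_le (G_mean \<alpha> p A B) (A_mean \<alpha> q A B))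
          \<longleftrightarrow> (\<forall>A B :: complex mat. A \<in> carrier_mat 2 2 \<longrightarrow> B \<in> carrier_mat 2 2 \<longrightarrow>
              pd_mat A \<longrightarrow> pd_mat B \<longrightarrow> loewner_le (G_mean \<alpha> p A B) (A_mean \<alpha> q A B)))
       \<and> ((\<forall>A B :: complex mat. A \<in> carrier_mat 2 2 \<longrightarrow> B \<in> carrier_mat 2 2 \<longrightarrow>
              pd_mat A \<longrightarrow> pd_mat B \<longrightarrow> loewner_le (G_mean \<alpha> p A B) (A_mean \<alpha> q A B))
          \<longleftrightarrow> 1 \<le> p \<and> p \<le> q)"
proof -
  let ?ineq = "\<lambda>A B. loewner_le (G_mean \<alpha> p A B) (A_mean \<alpha> q A B)"
  let ?i = "\<forall>n::nat. \<forall>A B :: complex mat. A \<in> carrier_mat n n \<longrightarrow> B \<in> carrier_mat n n \<longrightarrow>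
      psd_mat A \<longrightarrow> psd_mat B \<longrightarrow> ?ineq A B"
  let ?ii = "\<forall>A B :: complex mat. A \<in> carrier_mat 2 2 \<longrightarrow> B \<in> carrier_mat 2 2 \<longrightarrow>
      pd_mat A \<longrightarrow> pd_mat B \<longrightarrow> ?ineq A B"
  have "?ii" if "?i" using that pd_imp_psd by blast
  moreover have "1 \<le> p \<and> p \<le> q" if "?ii"
    using that mean_ineq_imp_one_le_p[OF assms] mean_ineq_imp_p_le_q[OF assms] by blast
  moreover have "?i" if "1 \<le> p \<and> p \<le> q"
    using that G_mean_le_A_mean[OF assms(1,2)] by blast
  ultimately show ?thesis by blast
qed

end
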